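(* Let $M$ be a 6-dimensional manifold with a special generalized Calabi-Yau structure $(\kappa,\Omega)$. Then the induced metric $g$ is Einstein if and only if $(M,\kappa,\Omega)$ is a Calabi-Yau manifold.
   Context: Notation: $e^{i_1\dots i_r}=e^{i_1}\wedge\dots\wedge e^{i_r}$. An $\mathrm{SU}(3)$-structure on a smooth 6-manifold $M$ is a pair $(\kappa,\Omega)$, with $\kappa$ a non-degenerate 2-form and $\Omega$ a 3-form such that at every point there is a coframe $e^1,\dots,e^6$ with $$\kappa=e^{12}+e^{34}+e^{56},\qquad \Omega=e^{135}-e^{146}-e^{245}-e^{236}$$ (i.e. $\Omega$ is a normalized $\kappa$-positive 3-form). In the dual frame the induced almost complex structure $J$ is $Je_1=e_2$, $Je_3=e_4$, $Je_5=e_6$; the induced metric is $g=\sum_i e^i\otimes e^i$, i.e. $g(X,Y)=\kappa(X,JY)$. $J$ acts on $r$-forms by $(J\alpha)(X_1,\dots,X_r)=\alpha(JX_1,\dots,JX_r)$, and $\varepsilon=\Omega+iJ\Omega$ is the complex volume form, of type $(3,0)$. The structure is special generalized Calabi-Yau (SGCY) if $d\kappa=0$ and $d\Omega=0$. It is Calabi-Yau (integrable) if $\nabla\kappa=0$, $\nabla J=0$, $\nabla\varepsilon=0$ for the Levi-Civita connection $\nabla$ of $g$; equivalently $d\kappa=0$, $d\Omega=0$ and $d(J\Omega)=0$. $g$ is Einstein if the traceless part of its Ricci tensor vanishes. No compactness is assumed. *)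

theory Defs
  imports "HOL-Analysis.Analysis" "HOL-Combinatorics.Permutations"
begin

section \<open>Smooth maps\<close>

text \<open>Meant for open \<open>S\<close>: all iterated directional derivatives exist and are continuous.\<close>

fun Ck_on :: "nat \<Rightarrow> 'a::real_normed_vector set \<Rightarrow> ('a \<Rightarrow> 'b::real_normed_vector) \<Rightarrow> bool" where
  "Ck_on 0 S f \<longleftrightarrow> continuous_on S f"
| "Ck_on (Suc k) S f \<longleftrightarrow>
     (\<forall>x\<in>S. f differentiable (at x)) \<and>
     (\<forall>v. Ck_on k S (\<lambda>x. frechet_derivative f (at x) v))"

definition smooth_on :: "'a::real_normed_vector set \<Rightarrow> ('a \<Rightarrow> 'b::real_normed_vector) \<Rightarrow> bool" where
  "smooth_on S f \<longleftrightarrow> (\<forall>k. Ck_on k S f)"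

section \<open>Smooth manifolds\<close>

type_synonym ('a, 'n) chart = "'a set \<times> ('a \<Rightarrow> real^'n)"

definition chart_image :: "('a, 'n::finite) chart \<Rightarrow> (real^'n) set" where
  "chart_image c = snd c ` fst c"

definition is_chart :: "'a topology \<Rightarrow> ('a, 'n::finite) chart \<Rightarrow> bool" where
  "is_chart X c \<longleftrightarrow> openin X (fst c) \<and> open (chart_image c) \<and>
     homeomorphic_map (subtopology X (fst c)) (top_of_set (chart_image c)) (snd c)"

definition transition :: "('a, 'n::finite) chart \<Rightarrow> ('a, 'n) chart \<Rightarrow> real^'n \<Rightarrow> real^'n" where
  "transition c c' = snd c' \<circ> inv_into (fst c) (snd c)"

definition overlap :: "('a, 'n::finite) chart \<Rightarrow> ('a, 'n) chart \<Rightarrow> (real^'n) set" where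
  "overlap c c' = snd c ` (fst c \<inter> fst c')"

text \<open>The atlas \<open>A\<close> need not be maximal; the dimension is \<open>CARD('n)\<close>.\<close>

definition smooth_manifold :: "'a topology \<Rightarrow> ('a, 'n::finite) chart set \<Rightarrow> bool" where
  "smooth_manifold X A \<longleftrightarrow> Hausdorff_space X \<and> second_countable X \<and>
     (\<forall>c\<in>A. is_chart X c) \<and> (\<Union>c\<in>A. fst c) = topspace X \<and>
     (\<forall>c\<in>A. \<forall>c'\<in>A. smooth_on (overlap c c') (transition c c'))"

section \<open>Differential forms\<close>

text \<open>A covariant \<open>k\<close>-tensor on \<open>real^'n\<close> is a function on lists of vectors, of which only the
  values on lists of length \<open>k\<close> matter. A tensor field on a manifold is given by its local
  representatives, one on the image of each chart of the atlas, related by pullback along the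
  transition maps. In the representative for \<open>c\<close>, the vector \<open>axis i 1\<close> stands for the
  \<open>i\<close>-th coordinate vector field of \<open>c\<close>.\<close>

type_synonym ('n, 'b) tensor = "(real^'n) list \<Rightarrow> 'b"

type_synonym ('a, 'n, 'b) field = "('a, 'n) chart \<Rightarrow> real^'n \<Rightarrow> 'b"

definition alternating_form :: "nat \<Rightarrow> ('n::finite, real) tensor \<Rightarrow> bool" where
  "alternating_form k \<omega> \<longleftrightarrow>
     (\<forall>vs. length vs = k \<longrightarrow>
        (\<forall>i<k. linear (\<lambda>v. \<omega> (vs[i := v]))) \<and>
        (\<forall>i j. i < j \<and> j < k \<and> vs ! i = vs ! j \<longrightarrow> \<omega> vs = 0))"

definition differential_form ::
    "('a, 'n::finite) chart set \<Rightarrow> nat \<Rightarrow> ('a, 'n, ('n, real) tensor) field \<Rightarrow> bool" where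
  "differential_form A k \<omega> \<longleftrightarrow>
     (\<forall>c\<in>A. (\<forall>x\<in>chart_image c. alternating_form k (\<omega> c x)) \<and>
        (\<forall>vs. length vs = k \<longrightarrow> smooth_on (chart_image c) (\<lambda>x. \<omega> c x vs))) \<and>
     (\<forall>c\<in>A. \<forall>c'\<in>A. \<forall>x\<in>overlap c c'. \<forall>vs. length vs = k \<longrightarrow>
        \<omega> c x vs =
          \<omega> c' (transition c c' x) (map (frechet_derivative (transition c c') (at x)) vs))"

definition ext_deriv ::
    "(real^'n \<Rightarrow> ('n::finite, real) tensor) \<Rightarrow> real^'n \<Rightarrow> ('n, real) tensor" where
  "ext_deriv \<omega> x vs =
     (\<Sum>i<length vs. (-1)^i *
        frechet_derivative (\<lambda>y. \<omega> y (take i vs @ drop (Suc i) vs)) (at x) (vs ! i))"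

definition closed_form ::
    "('a, 'n::finite) chart set \<Rightarrow> nat \<Rightarrow> ('a, 'n, ('n, real) tensor) field \<Rightarrow> bool" where
  "closed_form A k \<omega> \<longleftrightarrow>
     (\<forall>c\<in>A. \<forall>x\<in>chart_image c. \<forall>vs. length vs = Suc k \<longrightarrow> ext_deriv (\<omega> c) x vs = 0)"

text \<open>The normalization is \<open>(\<alpha> \<and> \<beta>)(u, v) = \<alpha>(u) \<beta>(v) - \<alpha>(v) \<beta>(u)\<close>.\<close>

definition wedge :: "(real^'n \<Rightarrow> real) list \<Rightarrow> ('n::finite, real) tensor" where
  "wedge es vs =
     (\<Sum>p | p permutes {..<length es}. of_int (sign p) * (\<Prod>i<length es. (es ! i) (vs ! p i)))"

section \<open>Riemannian geometry in a chart\<close>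

text \<open>\<open>levi_civita g x u v\<close> is the covariant derivative at \<open>x\<close>, in direction \<open>u\<close>, of the vector
  field with constant coordinates \<open>v\<close>. The two conditions are vanishing torsion and \<open>\<nabla>g = 0\<close>.\<close>

definition levi_civita ::
    "(real^'n \<Rightarrow> real^'n \<Rightarrow> real^'n \<Rightarrow> real) \<Rightarrow> real^'n \<Rightarrow> real^'n \<Rightarrow> real^'n \<Rightarrow> real^'n::finite" where
  "levi_civita g x = (THE \<Gamma>. bilinear \<Gamma> \<and> (\<forall>u v. \<Gamma> u v = \<Gamma> v u) \<and>
     (\<forall>u v w. frechet_derivative (\<lambda>y. g y v w) (at x) u = g x (\<Gamma> u v) w + g x v (\<Gamma> u w)))"

definition cov_deriv ::
    "(real^'n \<Rightarrow> real^'n \<Rightarrow> real^'n \<Rightarrow> real^'n) \<Rightarrow>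
     (real^'n \<Rightarrow> ('n::finite, 'b::real_normed_vector) tensor) \<Rightarrow>
     real^'n \<Rightarrow> real^'n \<Rightarrow> ('n, 'b) tensor" where
  "cov_deriv \<Gamma> T x u vs =
     frechet_derivative (\<lambda>y. T y vs) (at x) u - (\<Sum>i<length vs. T x (vs[i := \<Gamma> x u (vs ! i)]))"

definition cov_deriv_endo ::
    "(real^'n \<Rightarrow> real^'n \<Rightarrow> real^'n \<Rightarrow> real^'n) \<Rightarrow> (real^'n \<Rightarrow> real^'n \<Rightarrow> real^'n) \<Rightarrow>
     real^'n \<Rightarrow> real^'n \<Rightarrow> real^'n \<Rightarrow> real^'n::finite" where
  "cov_deriv_endo \<Gamma> J x u v =
     frechet_derivative (\<lambda>y. J y v) (at x) u + \<Gamma> x u (J x v) - J x (\<Gamma> x u v)"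

text \<open>\<open>R(u, v)w = \<nabla>\<^sub>u\<nabla>\<^sub>v w - \<nabla>\<^sub>v\<nabla>\<^sub>u w\<close> for constant coordinate fields, whose brackets vanish.\<close>

definition riemann ::
    "(real^'n \<Rightarrow> real^'n \<Rightarrow> real^'n \<Rightarrow> real^'n) \<Rightarrow>
     real^'n \<Rightarrow> real^'n \<Rightarrow> real^'n \<Rightarrow> real^'n \<Rightarrow> real^'n::finite" where
  "riemann \<Gamma> x u v w =
     frechet_derivative (\<lambda>y. \<Gamma> y v w) (at x) u - frechet_derivative (\<lambda>y. \<Gamma> y u w) (at x) v
     + \<Gamma> x u (\<Gamma> x v w) - \<Gamma> x v (\<Gamma> x u w)"

definition ricci ::
    "(real^'n \<Rightarrow> real^'n \<Rightarrow> real^'n \<Rightarrow> real) \<Rightarrow> real^'n \<Rightarrow> real^'n \<Rightarrow> real^'n::finite \<Rightarrow> real" where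
  "ricci g x v w = trace (matrix (\<lambda>u. riemann (levi_civita g) x u v w))"

definition gram :: "(real^'n \<Rightarrow> real^'n \<Rightarrow> real) \<Rightarrow> real^'n^'n::finite" where
  "gram b = (\<chi> i j. b (axis i 1) (axis j 1))"

definition metric_trace ::
    "(real^'n \<Rightarrow> real^'n \<Rightarrow> real) \<Rightarrow> (real^'n \<Rightarrow> real^'n::finite \<Rightarrow> real) \<Rightarrow> real" where
  "metric_trace g b = trace (matrix_inv (gram g) ** gram b)"

definition traceless_ricci ::
    "(real^'n \<Rightarrow> real^'n \<Rightarrow> real^'n \<Rightarrow> real) \<Rightarrow> real^'n \<Rightarrow> real^'n \<Rightarrow> real^'n::finite \<Rightarrow> real" where
  "traceless_ricci g x v w =
     ricci g x v w - metric_trace (g x) (ricci g x) / real CARD('n) * g x v w"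

definition einstein ::
    "('a, 'n::finite) chart set \<Rightarrow> ('a, 'n, real^'n \<Rightarrow> real^'n \<Rightarrow> real) field \<Rightarrow> bool" where
  "einstein A g \<longleftrightarrow>
     (\<forall>c\<in>A. \<forall>x\<in>chart_image c. \<forall>v w. traceless_ricci (g c) x v w = 0)"

section \<open>SU(3)-structures\<close>

text \<open>Frames and coframes are indexed by the type \<open>6\<close>, in which the numerals \<open>1, \<dots>, 6\<close> are the
  six distinct elements (and \<open>6 = 0\<close>).\<close>

definition coframe :: "(6 \<Rightarrow> real^6 \<Rightarrow> real) \<Rightarrow> bool" where
  "coframe e \<longleftrightarrow> (\<forall>i. linear (e i)) \<and> bij (\<lambda>v. \<chi> i. e i v)"

definition dual_frame :: "(6 \<Rightarrow> real^6 \<Rightarrow> real) \<Rightarrow> (6 \<Rightarrow> real^6) \<Rightarrow> bool" where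
  "dual_frame e b \<longleftrightarrow> (\<forall>i j. e i (b j) = (if i = j then 1 else 0))"

definition adapted_coframe ::
    "(6, real) tensor \<Rightarrow> (6, real) tensor \<Rightarrow> (6 \<Rightarrow> real^6 \<Rightarrow> real) \<Rightarrow> bool" where
  "adapted_coframe \<kappa> \<Omega> e \<longleftrightarrow> coframe e \<and>
     (\<forall>vs. length vs = 2 \<longrightarrow>
        \<kappa> vs = wedge [e 1, e 2] vs + wedge [e 3, e 4] vs + wedge [e 5, e 6] vs) \<and>
     (\<forall>vs. length vs = 3 \<longrightarrow>
        \<Omega> vs = wedge [e 1, e 3, e 5] vs - wedge [e 1, e 4, e 6] vs
              - wedge [e 2, e 4, e 5] vs - wedge [e 2, e 3, e 6] vs)"

definition nondegenerate :: "(6, real) tensor \<Rightarrow> bool" where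
  "nondegenerate \<kappa> \<longleftrightarrow> (\<forall>v. (\<forall>w. \<kappa> [v, w] = 0) \<longrightarrow> v = 0)"

definition su3_structure ::
    "('a, 6) chart set \<Rightarrow> ('a, 6, (6, real) tensor) field \<Rightarrow> ('a, 6, (6, real) tensor) field \<Rightarrow> bool"
  where
  "su3_structure A \<kappa> \<Omega> \<longleftrightarrow> differential_form A 2 \<kappa> \<and> differential_form A 3 \<Omega> \<and>
     (\<forall>c\<in>A. \<forall>x\<in>chart_image c. nondegenerate (\<kappa> c x)) \<and>
     (\<forall>c\<in>A. \<forall>x\<in>chart_image c. \<exists>e. adapted_coframe (\<kappa> c x) (\<Omega> c x) e)"

text \<open>The description is definite: any two adapted coframes differ by an element of
  \<open>SU(3)\<close> and so give the same \<open>J\<close>.\<close>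

definition induced_J :: "(6, real) tensor \<Rightarrow> (6, real) tensor \<Rightarrow> real^6 \<Rightarrow> real^6" where
  "induced_J \<kappa> \<Omega> = (THE J. linear J \<and> (\<forall>v. J (J v) = - v) \<and>
     (\<exists>e b. adapted_coframe \<kappa> \<Omega> e \<and> dual_frame e b \<and>
        J (b 1) = b 2 \<and> J (b 3) = b 4 \<and> J (b 5) = b 6))"

definition J_field ::
    "('a, 6, (6, real) tensor) field \<Rightarrow> ('a, 6, (6, real) tensor) field \<Rightarrow>
     ('a, 6, real^6 \<Rightarrow> real^6) field" where
  "J_field \<kappa> \<Omega> c x = induced_J (\<kappa> c x) (\<Omega> c x)"

definition induced_metric ::
    "('a, 6, (6, real) tensor) field \<Rightarrow> ('a, 6, (6, real) tensor) field \<Rightarrow>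
     ('a, 6, real^6 \<Rightarrow> real^6 \<Rightarrow> real) field" where
  "induced_metric \<kappa> \<Omega> c x u v = \<kappa> c x [u, J_field \<kappa> \<Omega> c x v]"

definition complex_volume ::
    "('a, 6, (6, real) tensor) field \<Rightarrow> ('a, 6, (6, real) tensor) field \<Rightarrow>
     ('a, 6, (6, complex) tensor) field" where
  "complex_volume \<kappa> \<Omega> c x vs =
     complex_of_real (\<Omega> c x vs) + \<i> * complex_of_real (\<Omega> c x (map (J_field \<kappa> \<Omega> c x) vs))"

definition special_generalized_calabi_yau ::
    "('a, 6) chart set \<Rightarrow> ('a, 6, (6, real) tensor) field \<Rightarrow> ('a, 6, (6, real) tensor) field \<Rightarrow> bool"
  where
  "special_generalized_calabi_yau A \<kappa> \<Omega> \<longleftrightarrow>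
     su3_structure A \<kappa> \<Omega> \<and> closed_form A 2 \<kappa> \<and> closed_form A 3 \<Omega>"

definition calabi_yau ::
    "('a, 6) chart set \<Rightarrow> ('a, 6, (6, real) tensor) field \<Rightarrow> ('a, 6, (6, real) tensor) field \<Rightarrow> bool"
  where
  "calabi_yau A \<kappa> \<Omega> \<longleftrightarrow> su3_structure A \<kappa> \<Omega> \<and>
     (\<forall>c\<in>A. \<forall>x\<in>chart_image c.
        let \<Gamma> = levi_civita (induced_metric \<kappa> \<Omega> c) in
        (\<forall>u vs. length vs = 2 \<longrightarrow> cov_deriv \<Gamma> (\<kappa> c) x u vs = 0) \<and>
        (\<forall>u v. cov_deriv_endo \<Gamma> (J_field \<kappa> \<Omega> c) x u v = 0) \<and>
        (\<forall>u vs. length vs = 3 \<longrightarrow> cov_deriv \<Gamma> (complex_volume \<kappa> \<Omega> c) x u vs = 0))"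

end

theory Submission
  imports Defs
begin

text \<open>
Both sides of the equivalence are local, so everything happens on the image of one chart, with the
metric \<open>g\<close>, its Levi-Civita connection \<open>\<nabla>\<close>, the almost complex structure \<open>J\<close> and its derivative
\<open>A\<^sub>u = \<nabla>\<^sub>u J\<close>.

\<^bold>\<open>Torsion.\<close> A skew endomorphism that anticommutes with \<open>J\<close> is a cross product with a vector, where
\<open>g(x \<times> y, z) = \<Omega>(x, y, z)\<close>; hence \<open>A\<^sub>u w = a(u) \<times> w\<close> for an endomorphism \<open>a\<close> of the tangent space. The
equations \<open>d\<kappa> = 0\<close> and \<open>d\<Omega> = 0\<close> say that \<open>a\<close> is \<open>J\<close>-linear, symmetric and trace-free, that is, a
trace-free Hermitian \<open>3 \<times> 3\<close> matrix, and that the Hermitian connection \<open>\<nabla>\<^sup>h\<^sub>u = \<nabla>\<^sub>u - \<onehalf> J A\<^sub>u\<close>, which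
preserves \<open>g\<close> and \<open>J\<close>, preserves \<open>\<Omega>\<close> as well (\<open>torsion_relations\<close>, \<open>herm_Omega\<close>).

\<^bold>\<open>Curvature.\<close> The derivative of \<open>a\<close> does not enter the \<open>J\<close>-invariant part of the Ricci tensor, which is
therefore quadratic in \<open>a\<close>: for an orthonormal frame \<open>b\<^sub>i\<close>,
\<open>Ric(x, x) + Ric(Jx, Jx) = \<onehalf> \<Sum>\<^sub>i |A\<^sub>x b\<^sub>i|\<^sup>2 - \<Sum>\<^sub>i |A\<^bsub>b\<^sub>i\<^esub> x|\<^sup>2 = 4 |a x|\<^sup>2 - |a|\<^sup>2 |x|\<^sup>2\<close> (\<open>ricci_J_invariant\<close>).
Indeed, the Bianchi identity expresses the left side by the trace of \<open>J\<close> against the curvature and by the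
rough Laplacian of \<open>J\<close>. Up to terms quadratic in \<open>A\<close>, the first agrees with the same trace for the
curvature of \<open>\<nabla>\<^sup>h\<close>, which vanishes because \<open>\<nabla>\<^sup>h\<close> preserves \<open>\<Omega>\<close>; the relevant part of the second is quadratic in
\<open>A\<close>, as one sees by differentiating \<open>J\<^sup>2 = -1\<close> twice.

\<^bold>\<open>Conclusion.\<close> If \<open>g\<close> is Einstein, then \<open>|a x|\<^sup>2 = \<mu> |x|\<^sup>2\<close>, so \<open>a\<^sup>2 = \<mu>\<close>. The three eigenvalues of \<open>a\<close> are
\<open>\<plusminus>\<surd>\<mu>\<close> and add up to zero, so \<open>a = 0\<close>; then \<open>\<nabla>J = 0\<close>, and \<open>\<nabla> = \<nabla>\<^sup>h\<close> preserves \<open>\<kappa>\<close> and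
\<open>\<epsilon>\<close>. Conversely, if \<open>\<nabla>J = 0\<close>, then \<open>J\<close> commutes with the curvature and the same identities force
\<open>Ric = 0\<close> (\<open>ricci_flat\<close>).
\<close>

section \<open>Smooth functions on open sets\<close>

abbreviation dd :: "('a::real_normed_vector \<Rightarrow> 'b::real_normed_vector) \<Rightarrow> 'a \<Rightarrow> 'a \<Rightarrow> 'b" where
  "dd f x u \<equiv> frechet_derivative f (at x) u"

lemma dd_eqI: "(f has_derivative f') (at x) \<Longrightarrow> dd f x u = f' u"
  using frechet_derivative_at by fastforce

lemma has_dd: "f differentiable (at x) \<Longrightarrow> (f has_derivative dd f x) (at x)"
  using frechet_derivative_works by blast

lemma linear_dd: "f differentiable (at x) \<Longrightarrow> linear (dd f x)"
  using has_dd has_derivative_linear by blast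

lemma differentiable_cong_open:
  assumes "open U" "x \<in> U" "\<And>y. y \<in> U \<Longrightarrow> f y = h y"
  shows "f differentiable (at x) \<longleftrightarrow> h differentiable (at x)"
  unfolding differentiable_def
  by (metis assms has_derivative_transform_within_open)

lemma dd_cong_open:
  assumes "open U" "x \<in> U" "\<And>y. y \<in> U \<Longrightarrow> f y = h y"
  shows "dd f x u = dd h x u"
proof -
  have "(f has_derivative f') (at x) \<longleftrightarrow> (h has_derivative f') (at x)" for f'
    by (metis assms has_derivative_transform_within_open)
  then show ?thesis unfolding frechet_derivative_def by simp
qed

lemma dd_const [simp]: "dd (\<lambda>y. c) x u = 0"
  by (simp add: frechet_derivative_const)

lemma dd_add:
  "f differentiable (at x) \<Longrightarrow> h differentiable (at x) \<Longrightarrow> dd (\<lambda>y. f y + h y) x u = dd f x u + dd h x u"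
  by (rule dd_eqI) (intro derivative_intros has_dd)

lemma dd_diff:
  "f differentiable (at x) \<Longrightarrow> h differentiable (at x) \<Longrightarrow> dd (\<lambda>y. f y - h y) x u = dd f x u - dd h x u"
  by (rule dd_eqI) (intro derivative_intros has_dd)

lemma dd_minus: "f differentiable (at x) \<Longrightarrow> dd (\<lambda>y. - f y) x u = - dd f x u"
  by (rule dd_eqI) (intro derivative_intros has_dd)

lemma dd_sum:
  "(\<And>i. i \<in> I \<Longrightarrow> f i differentiable (at x)) \<Longrightarrow> dd (\<lambda>y. \<Sum>i\<in>I. f i y) x u = (\<Sum>i\<in>I. dd (f i) x u)"
  by (rule dd_eqI[where f'="\<lambda>u. \<Sum>i\<in>I. dd (f i) x u"]) (auto intro!: derivative_intros has_dd)

lemma dd_scaleR: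
  fixes a :: "'a::real_normed_vector \<Rightarrow> real"
  shows "a differentiable (at x) \<Longrightarrow> f differentiable (at x) \<Longrightarrow>
    dd (\<lambda>y. a y *\<^sub>R f y) x u = dd a x u *\<^sub>R f x + a x *\<^sub>R dd f x u"
  by (rule dd_eqI[where f'="\<lambda>u. dd a x u *\<^sub>R f x + a x *\<^sub>R dd f x u"])
     (auto intro!: derivative_eq_intros has_dd simp: fun_eq_iff)

lemma dd_mult:
  fixes a f :: "'a::real_normed_vector \<Rightarrow> real"
  shows "a differentiable (at x) \<Longrightarrow> f differentiable (at x) \<Longrightarrow>
    dd (\<lambda>y. a y * f y) x u = dd a x u * f x + a x * dd f x u"
  using dd_scaleR[of a x f u] by simp

lemma dd_bounded_linear:
  assumes "bounded_linear L" "f differentiable (at x)"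
  shows "dd (\<lambda>y. L (f y)) x u = L (dd f x u)"
  by (rule dd_eqI[where f'="\<lambda>u. L (dd f x u)"])
     (rule bounded_linear.has_derivative[OF assms(1) has_dd[OF assms(2)]])

lemma differentiable_bounded_linear:
  "bounded_linear L \<Longrightarrow> f differentiable (at x) \<Longrightarrow> (\<lambda>y. L (f y)) differentiable (at x)"
  unfolding differentiable_def using bounded_linear.has_derivative by blast

lemma Ck_on_cong:
  assumes "open U" "\<And>y. y \<in> U \<Longrightarrow> f y = h y"
  shows "Ck_on k U f \<longleftrightarrow> Ck_on k U h"
  using assms
proof (induction k arbitrary: f h)
  case 0 then show ?case by (auto intro: continuous_on_cong)
next
  case (Suc k)
  have "Ck_on k U (\<lambda>x. dd f x v) \<longleftrightarrow> Ck_on k U (\<lambda>x. dd h x v)" for v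
    using Suc.prems by (intro Suc.IH) (auto intro!: dd_cong_open[where U=U])
  then show ?case using differentiable_cong_open[OF Suc.prems(1) _ Suc.prems(2)] by auto
qed

lemma Ck_on_SucD: "Ck_on (Suc k) U f \<Longrightarrow> Ck_on k U f"
proof (induction k arbitrary: f)
  case 0
  then show ?case
    by (auto intro!: continuous_at_imp_continuous_on differentiable_imp_continuous_within)
next
  case (Suc k)
  note unfold = Ck_on.simps(2)[THEN iffD1, OF Suc.prems]
  show ?case using unfold Suc.IH by (subst Ck_on.simps(2)) blast
qed

lemma Ck_on_const: "Ck_on k U (\<lambda>x. c)"
  by (induction k arbitrary: c) auto

lemma Ck_on_add:
  assumes "open U" shows "Ck_on k U f \<Longrightarrow> Ck_on k U h \<Longrightarrow> Ck_on k U (\<lambda>x. f x + h x)"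
proof (induction k arbitrary: f h)
  case 0 then show ?case by (auto intro: continuous_intros)
next
  case (Suc k)
  have "Ck_on k U (\<lambda>x. dd (\<lambda>y. f y + h y) x v)" for v
    using Suc by (subst Ck_on_cong[OF assms, of _ "\<lambda>x. dd f x v + dd h x v"]) (auto simp: dd_add)
  then show ?case using Suc.prems by auto
qed

lemma Ck_on_scaleR:
  fixes a :: "'a::real_normed_vector \<Rightarrow> real"
  assumes "open U" shows "Ck_on k U a \<Longrightarrow> Ck_on k U f \<Longrightarrow> Ck_on k U (\<lambda>x. a x *\<^sub>R f x)"
proof (induction k arbitrary: a f)
  case 0 then show ?case by (auto intro: continuous_intros)
next
  case (Suc k)
  have "Ck_on k U (\<lambda>x. dd (\<lambda>y. a y *\<^sub>R f y) x v)" for v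
    using Suc Ck_on_SucD[OF Suc.prems(1)] Ck_on_SucD[OF Suc.prems(2)]
    by (subst Ck_on_cong[OF assms, of _ "\<lambda>x. dd a x v *\<^sub>R f x + a x *\<^sub>R dd f x v"])
       (auto simp: dd_scaleR intro!: Ck_on_add assms)
  then show ?case using Suc.prems by auto
qed

lemma Ck_on_bounded_linear:
  assumes "open U" "bounded_linear L" shows "Ck_on k U f \<Longrightarrow> Ck_on k U (\<lambda>x. L (f x))"
proof (induction k arbitrary: f)
  case 0 then show ?case by (auto intro: bounded_linear.continuous_on assms)
next
  case (Suc k)
  have "Ck_on k U (\<lambda>x. dd (\<lambda>y. L (f y)) x v)" for v
    using Suc assms by (subst Ck_on_cong[OF assms(1), of _ "\<lambda>x. L (dd f x v)"]) (auto simp: dd_bounded_linear)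
  then show ?case using Suc.prems by (auto intro!: differentiable_bounded_linear[OF assms(2)])
qed

lemma Ck_on_inverse:
  fixes a :: "'a::real_normed_vector \<Rightarrow> real"
  assumes "open U" "\<And>x. x \<in> U \<Longrightarrow> a x \<noteq> 0"
  shows "Ck_on k U a \<Longrightarrow> Ck_on k U (\<lambda>x. inverse (a x))"
proof (induction k)
  case 0 then show ?case using assms by (auto intro!: continuous_on_inverse)
next
  case (Suc k)
  have inv: "Ck_on k U (\<lambda>x. inverse (a x))" using Suc Ck_on_SucD by blast
  have d: "((\<lambda>y. inverse (a y)) has_derivative (\<lambda>v. - (inverse (a x) * dd a x v * inverse (a x)))) (at x)" if "x \<in> U" for x
    by (rule Deriv.has_derivative_inverse) (use Suc.prems that assms in \<open>auto intro: has_dd\<close>)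
  have "Ck_on k U (\<lambda>x. dd (\<lambda>y. inverse (a y)) x v)" for v
  proof (subst Ck_on_cong[OF assms(1)])
    show "dd (\<lambda>y. inverse (a y)) x v = (-1) *\<^sub>R (inverse (a x) *\<^sub>R (dd a x v *\<^sub>R inverse (a x)))" if "x \<in> U" for x
      using dd_eqI[OF d[OF that], of v] by simp
    show "Ck_on k U (\<lambda>x. (-1) *\<^sub>R (inverse (a x) *\<^sub>R (dd a x v *\<^sub>R inverse (a x))))"
      using Suc.prems inv assms by (intro Ck_on_scaleR Ck_on_const) auto
  qed
  then show ?case using d unfolding Ck_on.simps differentiable_def by blast
qed

lemma smooth_on_cong:
  "open U \<Longrightarrow> (\<And>y. y \<in> U \<Longrightarrow> f y = h y) \<Longrightarrow> smooth_on U f \<longleftrightarrow> smooth_on U h"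
  unfolding smooth_on_def using Ck_on_cong by blast

lemma smooth_on_const: "smooth_on U (\<lambda>x. c)"
  by (simp add: smooth_on_def Ck_on_const)

lemma smooth_on_add: "open U \<Longrightarrow> smooth_on U f \<Longrightarrow> smooth_on U h \<Longrightarrow> smooth_on U (\<lambda>x. f x + h x)"
  by (simp add: smooth_on_def Ck_on_add)

lemma smooth_on_scaleR:
  fixes a :: "'a::real_normed_vector \<Rightarrow> real"
  shows "open U \<Longrightarrow> smooth_on U a \<Longrightarrow> smooth_on U f \<Longrightarrow> smooth_on U (\<lambda>x. a x *\<^sub>R f x)"
  by (simp add: smooth_on_def Ck_on_scaleR)

lemma smooth_on_mult:
  fixes a f :: "'a::real_normed_vector \<Rightarrow> real"
  shows "open U \<Longrightarrow> smooth_on U a \<Longrightarrow> smooth_on U f \<Longrightarrow> smooth_on U (\<lambda>x. a x * f x)"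
  using smooth_on_scaleR[of U a f] by simp

lemma smooth_on_minus: "open U \<Longrightarrow> smooth_on U f \<Longrightarrow> smooth_on U (\<lambda>x. - f x)"
  using smooth_on_scaleR[of U "\<lambda>_. -1" f] smooth_on_const by auto

lemma smooth_on_diff: "open U \<Longrightarrow> smooth_on U f \<Longrightarrow> smooth_on U h \<Longrightarrow> smooth_on U (\<lambda>x. f x - h x)"
  using smooth_on_add[of U f "\<lambda>x. - h x"] smooth_on_minus by auto

lemma smooth_on_sum:
  "open U \<Longrightarrow> (\<And>i. i \<in> I \<Longrightarrow> smooth_on U (f i)) \<Longrightarrow> smooth_on U (\<lambda>x. \<Sum>i\<in>I. f i x)"
  by (induction I rule: infinite_finite_induct) (auto intro: smooth_on_const smooth_on_add)

lemma smooth_on_prod: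
  fixes f :: "'i \<Rightarrow> 'a::real_normed_vector \<Rightarrow> real"
  shows "open U \<Longrightarrow> (\<And>i. i \<in> I \<Longrightarrow> smooth_on U (f i)) \<Longrightarrow> smooth_on U (\<lambda>x. \<Prod>i\<in>I. f i x)"
  by (induction I rule: infinite_finite_induct) (auto intro: smooth_on_const smooth_on_mult)

lemma smooth_on_divide:
  fixes a f :: "'a::real_normed_vector \<Rightarrow> real"
  shows "open U \<Longrightarrow> smooth_on U f \<Longrightarrow> smooth_on U a \<Longrightarrow> (\<And>x. x \<in> U \<Longrightarrow> a x \<noteq> 0) \<Longrightarrow> smooth_on U (\<lambda>x. f x / a x)"
  unfolding divide_inverse
  by (intro smooth_on_mult) (auto simp: smooth_on_def Ck_on_inverse)

lemma smooth_on_bounded_linear: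
  "open U \<Longrightarrow> bounded_linear L \<Longrightarrow> smooth_on U f \<Longrightarrow> smooth_on U (\<lambda>x. L (f x))"
  by (simp add: smooth_on_def Ck_on_bounded_linear)

lemma smooth_on_dd: "smooth_on U f \<Longrightarrow> smooth_on U (\<lambda>x. dd f x v)"
  unfolding smooth_on_def using Ck_on.simps(2) by blast

lemma smooth_on_differentiable: "smooth_on U f \<Longrightarrow> x \<in> U \<Longrightarrow> f differentiable (at x)"
  unfolding smooth_on_def using Ck_on.simps(2) by blast

lemma smooth_on_continuous: "smooth_on U f \<Longrightarrow> continuous_on U f"
  unfolding smooth_on_def using Ck_on.simps(1) by blast

lemma linear_smooth:
  fixes L :: "'a::euclidean_space \<Rightarrow> 'b::real_normed_vector"
  assumes "linear L" shows "smooth_on U L"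
proof -
  have bl: "bounded_linear L" using assms linear_conv_bounded_linear by blast
  have "Ck_on k U L" for k
  proof (cases k)
    case 0 then show ?thesis by (simp add: bl linear_continuous_on)
  next
    case (Suc j)
    have "(L has_derivative L) (at x)" for x using bl bounded_linear_imp_has_derivative by blast
    then have "dd L x = L" "L differentiable (at x)" for x
      by (auto simp: fun_eq_iff intro: dd_eqI differentiableI)
    then show ?thesis using Suc by (simp add: Ck_on_const)
  qed
  then show ?thesis by (simp add: smooth_on_def)
qed

lemma linear_family_expand:
  fixes F :: "real^'n \<Rightarrow> 'b::real_vector"
  assumes "linear F" shows "F w = (\<Sum>i\<in>UNIV. w $ i *\<^sub>R F (axis i 1))"
proof -
  have "F (\<Sum>i\<in>UNIV. w $ i *\<^sub>R axis i 1) = (\<Sum>i\<in>UNIV. w $ i *\<^sub>R F (axis i 1))"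
    using assms by (simp add: linear_sum linear_cmul)
  moreover have "(\<Sum>i\<in>UNIV. w $ i *\<^sub>R axis i 1) = w"
    using basis_expansion[of w] by (simp add: scalar_mult_eq_scaleR)
  ultimately show ?thesis by simp
qed

text \<open>A tensor field is a family \<open>F y\<close> of linear maps for which \<open>F y w\<close> is smooth for each constant \<open>w\<close>.
Expanding the argument in the standard basis reduces statements about a variable argument \<open>W y\<close> to
constant ones; the product rule \<open>dd_apply\<close> below rests on the same expansion.\<close>

lemma smooth_on_apply:
  fixes F :: "'a::real_normed_vector \<Rightarrow> real^'n \<Rightarrow> 'b::real_normed_vector"
  assumes "open U" "\<And>y. y \<in> U \<Longrightarrow> linear (F y)" "\<And>w. smooth_on U (\<lambda>y. F y w)" "smooth_on U W"
  shows "smooth_on U (\<lambda>y. F y (W y))"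
proof (subst smooth_on_cong[OF assms(1)])
  show "F y (W y) = (\<Sum>i\<in>UNIV. W y $ i *\<^sub>R F y (axis i 1))" if "y \<in> U" for y
    using linear_family_expand assms(2) that by blast
  show "smooth_on U (\<lambda>y. \<Sum>i\<in>UNIV. W y $ i *\<^sub>R F y (axis i 1))"
    using assms by (intro smooth_on_sum smooth_on_scaleR smooth_on_bounded_linear[OF _ bounded_linear_vec_nth]) auto
qed

lemma dd_apply:
  fixes F :: "'a::real_normed_vector \<Rightarrow> real^'n \<Rightarrow> 'b::real_normed_vector"
  assumes U: "open U" "x \<in> U" and lin: "\<And>y. y \<in> U \<Longrightarrow> linear (F y)"
    and F: "\<And>w. (\<lambda>y. F y w) differentiable (at x)" and W: "W differentiable (at x)"
  shows "(\<lambda>y. F y (W y)) differentiable (at x)"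
    and "dd (\<lambda>y. F y (W y)) x u = dd (\<lambda>y. F y (W x)) x u + F x (dd W x u)"
proof -
  have e: "F y w = (\<Sum>i\<in>UNIV. w $ i *\<^sub>R F y (axis i 1))" if "y \<in> U" for y w
    using linear_family_expand lin that by blast
  have Wi: "(\<lambda>y. W y $ i) differentiable (at x)" for i
    using differentiable_bounded_linear[OF bounded_linear_vec_nth W] .
  have dWi: "dd (\<lambda>y. W y $ i) x u = dd W x u $ i" for i
    using dd_bounded_linear[OF bounded_linear_vec_nth W] .
  have d: "(\<lambda>y. \<Sum>i\<in>UNIV. W y $ i *\<^sub>R F y (axis i 1)) differentiable (at x)"
    by (intro differentiable_sum ballI differentiable_scaleR Wi F finite)
  show "(\<lambda>y. F y (W y)) differentiable (at x)"
    by (rule differentiable_cong_open[OF U e, THEN iffD2, OF _ d])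
  have "dd (\<lambda>y. F y (W y)) x u = dd (\<lambda>y. \<Sum>i\<in>UNIV. W y $ i *\<^sub>R F y (axis i 1)) x u"
    by (rule dd_cong_open[OF U e])
  also have "\<dots> = (\<Sum>i\<in>UNIV. W x $ i *\<^sub>R dd (\<lambda>y. F y (axis i 1)) x u) + (\<Sum>i\<in>UNIV. dd W x u $ i *\<^sub>R F x (axis i 1))"
    by (subst dd_sum) (auto simp: Wi F dd_scaleR dWi sum.distrib add.commute intro!: differentiable_scaleR)
  also have "(\<Sum>i\<in>UNIV. W x $ i *\<^sub>R dd (\<lambda>y. F y (axis i 1)) x u) = dd (\<lambda>y. \<Sum>i\<in>UNIV. W x $ i *\<^sub>R F y (axis i 1)) x u"
    by (subst dd_sum) (auto simp: F dd_scaleR intro!: differentiable_scaleR)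
  also have "\<dots> = dd (\<lambda>y. F y (W x)) x u"
    by (rule dd_cong_open[OF U e[symmetric]])
  also have "(\<Sum>i\<in>UNIV. dd W x u $ i *\<^sub>R F x (axis i 1)) = F x (dd W x u)"
    by (rule e[OF U(2), symmetric])
  finally show "dd (\<lambda>y. F y (W y)) x u = dd (\<lambda>y. F y (W x)) x u + F x (dd W x u)" .
qed

text \<open>Cramer's rule. Everything that is defined by duality owes its smoothness to it: the inverse of \<open>\<kappa>\<close>, the
almost complex structure in terms of \<open>g\<close> and \<open>\<kappa>\<close>, and the Christoffel symbols in the Koszul formula.\<close>

lemma smooth_on_solve:
  fixes \<beta> :: "'a::real_normed_vector \<Rightarrow> real^'n \<Rightarrow> real^'n \<Rightarrow> real"
  assumes U: "open U" and lin: "\<And>y v. y \<in> U \<Longrightarrow> linear (\<beta> y v)"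
    and nondeg: "\<And>y v. y \<in> U \<Longrightarrow> (\<And>w. \<beta> y w v = 0) \<Longrightarrow> v = 0"
    and smooth_rules: "\<And>v w. smooth_on U (\<lambda>y. \<beta> y v w)" and sm': "\<And>w. smooth_on U (\<lambda>y. l y w)"
    and lin': "\<And>y w. y \<in> U \<Longrightarrow> linear (\<lambda>v. \<beta> y v w)"
    and X: "\<And>y w. y \<in> U \<Longrightarrow> \<beta> y w (X y) = l y w"
  shows "smooth_on U X"
proof -
  define M where "M y = (\<chi> i j. \<beta> y (axis i 1) (axis j 1))" for y
  have Mv: "(M y *v v) $ i = \<beta> y (axis i 1) v" if "y \<in> U" for y v i
    using linear_family_expand[OF lin[OF that], of "axis i 1" v]
    by (simp add: M_def matrix_vector_mult_def mult.commute)
  have det: "det (M y) \<noteq> 0" if "y \<in> U" for y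
  proof
    assume "det (M y) = 0"
    then obtain v where v: "v \<noteq> 0" "M y *v v = 0"
      by (metis invertible_det_nz invertible_left_inverse matrix_left_invertible_ker)
    have "\<beta> y w v = 0" for w
      using linear_family_expand[OF lin'[OF that], of w v] Mv[OF that, of v] v by simp
    then show False using nondeg that v by blast
  qed
  have Xk: "X y $ k = det (\<chi> i j. if j = k then l y (axis i 1) else M y $ i $ j) / det (M y)" if y: "y \<in> U" for y k
  proof -
    have "M y *v X y = (\<chi> i. l y (axis i 1))" by (simp add: vec_eq_iff Mv y X)
    from this[unfolded cramer[OF det[OF y]]] show ?thesis by (simp cong: if_cong)
  qed
  have sdet: "smooth_on U (\<lambda>y. det (\<chi> i j. N y i j))" if "\<And>i j. smooth_on U (\<lambda>y. N y i j)" for N :: "'a \<Rightarrow> 'n \<Rightarrow> 'n \<Rightarrow> real"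
    unfolding det_def by (auto intro!: smooth_on_sum smooth_on_mult smooth_on_prod smooth_on_const U that)
  have "smooth_on U (\<lambda>y. X y $ k)" for k
  proof (subst smooth_on_cong[OF U Xk])
    show "smooth_on U (\<lambda>y. det (\<chi> i j. if j = k then l y (axis i 1) else M y $ i $ j) / det (M y))"
    proof (intro smooth_on_divide sdet U det)
      show "smooth_on U (\<lambda>y. if j = k then l y (axis i 1) else M y $ i $ j)" for i j
        by (cases "j = k") (simp_all add: smooth_rules sm' M_def)
      show "smooth_on U (\<lambda>y. det (M y))" unfolding M_def by (intro sdet smooth_rules)
    qed
  qed
  then have "smooth_on U (\<lambda>y. \<Sum>i\<in>UNIV. X y $ i *\<^sub>R (axis i 1 :: real^'n))"
    by (intro smooth_on_sum smooth_on_scaleR smooth_on_const U)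
  moreover have "(\<Sum>i\<in>UNIV. X y $ i *\<^sub>R (axis i 1 :: real^'n)) = X y" for y
    using linear_family_expand[OF linear_ident, of "X y"] by simp
  ultimately show ?thesis by simp
qed

lemma dd_line:
  assumes "f differentiable (at (x + t *\<^sub>R u))"
  shows "((\<lambda>t. f (x + t *\<^sub>R u)) has_vector_derivative dd f (x + t *\<^sub>R u) u) (at t)"
proof -
  have "((\<lambda>t. x + t *\<^sub>R u) has_derivative (\<lambda>h. h *\<^sub>R u)) (at t)"
    by (auto intro!: derivative_eq_intros)
  then have "((\<lambda>t. f (x + t *\<^sub>R u)) has_derivative (\<lambda>h. dd f (x + t *\<^sub>R u) (h *\<^sub>R u))) (at t)"
    using has_derivative_compose has_dd[OF assms] by fastforce
  then show ?thesis
    unfolding has_vector_derivative_def using linear_cmul[OF linear_dd[OF assms]] by simp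
qed

text \<open>The mean value theorem in direction \<open>u\<close>, applied to the first difference in direction \<open>v\<close>, and then in
direction \<open>v\<close>.\<close>

lemma second_difference_mean_value:
  fixes f :: "'a::real_normed_vector \<Rightarrow> real"
  assumes smooth_rules: "smooth_on U f" and s: "0 < s"
    and sq: "\<And>a b. 0 \<le> a \<Longrightarrow> a \<le> s \<Longrightarrow> 0 \<le> b \<Longrightarrow> b \<le> s \<Longrightarrow> x + a *\<^sub>R u + b *\<^sub>R v \<in> U"
  shows "\<exists>a b. 0 \<le> a \<and> a \<le> s \<and> 0 \<le> b \<and> b \<le> s \<and>
    f (x + s *\<^sub>R u + s *\<^sub>R v) - f (x + s *\<^sub>R u) - f (x + s *\<^sub>R v) + f x
      = s * s * dd (\<lambda>y. dd f y u) (x + a *\<^sub>R u + b *\<^sub>R v) v"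
proof -
  define h where "h a = f (x + s *\<^sub>R v + a *\<^sub>R u) - f (x + a *\<^sub>R u)" for a
  define h' where "h' a = dd f (x + s *\<^sub>R v + a *\<^sub>R u) u - dd f (x + a *\<^sub>R u) u" for a
  have dh: "(h has_real_derivative h' a) (at a)" if "0 \<le> a" "a \<le> s" for a
  proof -
    have 1: "x + s *\<^sub>R v + a *\<^sub>R u \<in> U" using sq[OF that, of s] s by (simp add: algebra_simps)
    have 2: "x + a *\<^sub>R u \<in> U" using sq[OF that, of 0] s by simp
    show ?thesis unfolding h_def h'_def has_real_derivative_iff_has_vector_derivative
      by (intro has_vector_derivative_diff dd_line smooth_on_differentiable[OF smooth_rules] 1 2)
  qed
  obtain a where a: "0 < a" "a < s" "h s - h 0 = s * h' a"
    using MVT2[OF s, of h h'] dh by auto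
  define k where "k b = dd f (x + a *\<^sub>R u + b *\<^sub>R v) u" for b
  have dk: "(k has_real_derivative dd (\<lambda>y. dd f y u) (x + a *\<^sub>R u + b *\<^sub>R v) v) (at b)" if "0 \<le> b" "b \<le> s" for b
    unfolding k_def has_real_derivative_iff_has_vector_derivative
    using sq[of a b] a that
    by (intro dd_line[where f="\<lambda>y. dd f y u"] smooth_on_differentiable[OF smooth_on_dd[OF smooth_rules]]) auto
  obtain b where b: "0 < b" "b < s" "k s - k 0 = s * dd (\<lambda>y. dd f y u) (x + a *\<^sub>R u + b *\<^sub>R v) v"
    using MVT2[OF s, of k "\<lambda>b. dd (\<lambda>y. dd f y u) (x + a *\<^sub>R u + b *\<^sub>R v) v"] dk by auto
  have "h' a = k s - k 0" by (simp add: h'_def k_def algebra_simps)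
  then have "f (x + s *\<^sub>R u + s *\<^sub>R v) - f (x + s *\<^sub>R u) - f (x + s *\<^sub>R v) + f x = s * s * dd (\<lambda>y. dd f y u) (x + a *\<^sub>R u + b *\<^sub>R v) v"
    using a(3) b(3) by (simp add: h_def algebra_simps)
  then show ?thesis using a b by (meson less_imp_le)
qed

text \<open>The second difference is symmetric in \<open>u\<close> and \<open>v\<close>, so the two mixed derivatives take a common value,
at two points that are arbitrarily close to \<open>x\<close>; they are continuous.\<close>

lemma dd_commute_real:
  fixes f :: "'a::real_normed_vector \<Rightarrow> real"
  assumes U: "open U" "x \<in> U" and smooth_rules: "smooth_on U f"
  shows "dd (\<lambda>y. dd f y u) x v = dd (\<lambda>y. dd f y v) x u"
proof (rule ccontr)
  let ?p = "\<lambda>y. dd (\<lambda>y. dd f y u) y v" and ?q = "\<lambda>y. dd (\<lambda>y. dd f y v) y u"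
  assume ne: "?p x \<noteq> ?q x"
  define e where "e = \<bar>?p x - ?q x\<bar> / 2"
  have e: "e > 0" using ne by (simp add: e_def)
  have "continuous_on U ?p" "continuous_on U ?q"
    by (intro smooth_on_continuous smooth_on_dd smooth_rules)+
  then have "isCont ?p x" "isCont ?q x" using U continuous_on_eq_continuous_at by blast+
  then obtain d1 d2 where d: "d1 > 0" "d2 > 0" "\<And>y. dist y x < d1 \<Longrightarrow> dist (?p y) (?p x) < e"
    "\<And>y. dist y x < d2 \<Longrightarrow> dist (?q y) (?q x) < e"
    using e unfolding continuous_at_eps_delta by metis
  obtain d3 where d3: "d3 > 0" "ball x d3 \<subseteq> U" using U openE by blast
  define r where "r = min d3 (min d1 d2)"
  define s where "s = r / (norm u + norm v + 1)"
  have r: "r > 0" using d d3 by (simp add: r_def)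
  have n: "norm u + norm v + 1 > 0" by (smt (verit) norm_ge_zero)
  have s: "s > 0" using r n by (simp add: s_def)
  have near: "dist (x + a *\<^sub>R u + b *\<^sub>R v) x < r" if "0 \<le> a" "a \<le> s" "0 \<le> b" "b \<le> s" for a b
  proof -
    have "norm (a *\<^sub>R u + b *\<^sub>R v) \<le> a * norm u + b * norm v"
      using norm_triangle_ineq[of "a *\<^sub>R u" "b *\<^sub>R v"] that by simp
    also have "\<dots> \<le> s * norm u + s * norm v" using that by (intro add_mono mult_right_mono) auto
    also have "\<dots> < s * (norm u + norm v + 1)" using s by (simp add: algebra_simps)
    also have "\<dots> = r" using n by (simp add: s_def)
    finally show ?thesis by (simp add: dist_norm algebra_simps)
  qed
  have inU: "x + a *\<^sub>R u + b *\<^sub>R v \<in> U" if "0 \<le> a" "a \<le> s" "0 \<le> b" "b \<le> s" for a b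
    using near[OF that] d3 by (auto simp: r_def dist_commute)
  obtain a b where ab: "0 \<le> a" "a \<le> s" "0 \<le> b" "b \<le> s"
    "f (x + s *\<^sub>R u + s *\<^sub>R v) - f (x + s *\<^sub>R u) - f (x + s *\<^sub>R v) + f x = s * s * ?p (x + a *\<^sub>R u + b *\<^sub>R v)"
    using second_difference_mean_value[OF smooth_rules s inU] by blast
  have inU': "x + a *\<^sub>R v + b *\<^sub>R u \<in> U" if "0 \<le> a" "a \<le> s" "0 \<le> b" "b \<le> s" for a b
    using inU[of b a] that by (simp add: algebra_simps)
  obtain a' b' where ab': "0 \<le> a'" "a' \<le> s" "0 \<le> b'" "b' \<le> s"
    "f (x + s *\<^sub>R v + s *\<^sub>R u) - f (x + s *\<^sub>R v) - f (x + s *\<^sub>R u) + f x = s * s * ?q (x + a' *\<^sub>R v + b' *\<^sub>R u)"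
    using second_difference_mean_value[OF smooth_rules s inU'] by blast
  have "s * s * ?p (x + a *\<^sub>R u + b *\<^sub>R v) = s * s * ?q (x + a' *\<^sub>R v + b' *\<^sub>R u)"
    using ab(5) ab'(5) by (simp add: algebra_simps)
  then have "?p (x + a *\<^sub>R u + b *\<^sub>R v) = ?q (x + a' *\<^sub>R v + b' *\<^sub>R u)" using s by simp
  moreover have "dist (?p (x + a *\<^sub>R u + b *\<^sub>R v)) (?p x) < e"
    using near[OF ab(1-4)] by (intro d(3)) (simp add: r_def)
  moreover have "dist (?q (x + a' *\<^sub>R v + b' *\<^sub>R u)) (?q x) < e"
    using near[OF ab'(3,4,1,2)] by (intro d(4)) (simp add: r_def algebra_simps)
  ultimately show False unfolding e_def dist_real_def by (simp add: abs_if split: if_splits)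
qed

lemma dd_commute:
  fixes f :: "'a::real_normed_vector \<Rightarrow> 'b::euclidean_space"
  assumes U: "open U" "x \<in> U" and smooth_rules: "smooth_on U f"
  shows "dd (\<lambda>y. dd f y u) x v = dd (\<lambda>y. dd f y v) x u"
proof (rule euclidean_eqI)
  fix i :: 'b
  have bl: "bounded_linear (\<lambda>w::'b. w \<bullet> i)" by (rule bounded_linear_inner_left)
  have e: "dd (\<lambda>y. dd f y u) x v \<bullet> i = dd (\<lambda>y. dd (\<lambda>z. f z \<bullet> i) y u) x v" for u v
  proof -
    have "dd (\<lambda>y. dd (\<lambda>z. f z \<bullet> i) y u) x v = dd (\<lambda>y. dd f y u \<bullet> i) x v"
      by (intro dd_cong_open[OF U] dd_bounded_linear[OF bl] smooth_on_differentiable[OF smooth_rules])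
    also have "\<dots> = dd (\<lambda>y. dd f y u) x v \<bullet> i"
      by (intro dd_bounded_linear[OF bl] smooth_on_differentiable[OF smooth_on_dd[OF smooth_rules] U(2)])
    finally show ?thesis by simp
  qed
  show "dd (\<lambda>y. dd f y u) x v \<bullet> i = dd (\<lambda>y. dd f y v) x u \<bullet> i"
    unfolding e by (intro dd_commute_real[OF U] smooth_on_bounded_linear[OF U(1) bl] smooth_rules)
qed

section \<open>Linear algebra of an SU(3)-structure\<close>

lemma exhaust_6:
  fixes x :: 6
  shows "x = 1 \<or> x = 2 \<or> x = 3 \<or> x = 4 \<or> x = 5 \<or> x = 6"
proof (induct x)
  case (of_int z)
  then have "z = 0 \<or> z = 1 \<or> z = 2 \<or> z = 3 \<or> z = 4 \<or> z = 5" by fastforce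
  then show ?case by auto
qed

lemma forall_6: "(\<forall>i::6. P i) \<longleftrightarrow> P 1 \<and> P 2 \<and> P 3 \<and> P 4 \<and> P 5 \<and> P 6"
  by (metis exhaust_6)

lemma UNIV_6: "UNIV = {1, 2, 3, 4, 5, 6::6}"
  using exhaust_6 by auto

lemma sum_6: "sum f (UNIV::6 set) = f 1 + f 2 + f 3 + f 4 + f 5 + f 6"
  unfolding UNIV_6 by (simp add: ac_simps)

lemma wedge_2: "wedge [a, b] [x, y] = a x * b y - a y * b x"
proof -
  have "{..<length [a, b]} = insert 0 {1}" by auto
  then show ?thesis
    unfolding wedge_def
    by (simp add: sum_over_permutations_insert sign_swap_id sign_id)
qed

lemma wedge_3:
  "wedge [a, b, c] [x, y, z] =
     a x * b y * c z + a y * b z * c x + a z * b x * c y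
     - a x * b z * c y - a y * b x * c z - a z * b y * c x"
proof -
  have "{..<length [a, b, c]} = insert 0 (insert 1 {2})" by auto
  then show ?thesis
    unfolding wedge_def
    by (simp add: sum_over_permutations_insert sign_swap_id sign_id sign_compose permutation_swap_id)
qed

locale su3_frame =
  fixes \<kappa> \<Omega> :: "(6, real) tensor" and e :: "6 \<Rightarrow> real^6 \<Rightarrow> real" and b :: "6 \<Rightarrow> real^6"
  assumes adapted: "adapted_coframe \<kappa> \<Omega> e" and dual: "dual_frame e b"
begin

lemma linear_e: "linear (e i)"
  using adapted by (simp add: adapted_coframe_def coframe_def)

lemmas e_simps = linear_add[OF linear_e] linear_diff[OF linear_e] linear_cmul[OF linear_e]
  linear_neg[OF linear_e] linear_0[OF linear_e] linear_sum[OF linear_e]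

lemma e_b: "e i (b j) = (if i = j then 1 else 0)"
  using dual by (simp add: dual_frame_def)

lemma e_ext: "(\<And>i. e i v = e i w) \<Longrightarrow> v = w"
  using adapted by (auto simp: adapted_coframe_def coframe_def bij_def inj_def vec_eq_iff)

lemma expand: "v = (\<Sum>i\<in>UNIV. e i v *\<^sub>R b i)"
  by (rule e_ext) (simp add: e_simps e_b if_distrib[of "(*) _"] cong: if_cong)

lemma kappa_e: "\<kappa> [x, y] = e 1 x * e 2 y - e 1 y * e 2 x + (e 3 x * e 4 y - e 3 y * e 4 x)
    + (e 5 x * e 6 y - e 5 y * e 6 x)"
  using adapted by (simp add: adapted_coframe_def wedge_2)

lemma Omega_e: "\<Omega> [x, y, z] = wedge [e 1, e 3, e 5] [x, y, z] - wedge [e 1, e 4, e 6] [x, y, z]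
              - wedge [e 2, e 4, e 5] [x, y, z] - wedge [e 2, e 3, e 6] [x, y, z]"
  using adapted by (simp add: adapted_coframe_def)

lemmas Omega_e' = Omega_e[unfolded wedge_3]

lemma kappa_nondeg: assumes "\<And>w. \<kappa> [w, v] = 0" shows "v = 0"
proof -
  have "\<forall>j. \<kappa> [b j, v] = 0" using assms by simp
  then have "\<forall>i. e i v = 0" by (simp add: forall_6 kappa_e e_b)
  then show ?thesis by (intro e_ext) (simp add: e_simps)
qed

definition Jf :: "real^6 \<Rightarrow> real^6" where
  "Jf v = e 1 v *\<^sub>R b 2 - e 2 v *\<^sub>R b 1 + e 3 v *\<^sub>R b 4 - e 4 v *\<^sub>R b 3 + e 5 v *\<^sub>R b 6 - e 6 v *\<^sub>R b 5"

lemma e_Jf: "e 1 (Jf v) = - e 2 v" "e 2 (Jf v) = e 1 v" "e 3 (Jf v) = - e 4 v"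
    "e 4 (Jf v) = e 3 v" "e 5 (Jf v) = - e 6 v" "e 6 (Jf v) = e 5 v"
  by (simp_all add: Jf_def e_simps e_b)

lemma e_ext6: "e 1 v = e 1 w \<Longrightarrow> e 2 v = e 2 w \<Longrightarrow> e 3 v = e 3 w \<Longrightarrow> e 4 v = e 4 w \<Longrightarrow> e 5 v = e 5 w
  \<Longrightarrow> e 6 v = e 6 w \<Longrightarrow> v = w"
  using e_ext forall_6[of "\<lambda>i. e i v = e i w"] by blast

lemma linear_Jf: "linear Jf"
  by (rule linearI; rule e_ext6; simp add: e_Jf e_simps)

lemma Jf_Jf: "Jf (Jf v) = - v"
  by (rule e_ext6; simp add: e_Jf e_simps)

lemma Jf_b: "Jf (b 1) = b 2" "Jf (b 3) = b 4" "Jf (b 5) = b 6"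
  "Jf (b 2) = - b 1" "Jf (b 4) = - b 3" "Jf (b 6) = - b 5"
  by (simp_all add: Jf_def e_b)

lemma Jf_unique:
  assumes "linear J" "\<forall>v. J (J v) = - v" "J (b 1) = b 2" "J (b 3) = b 4" "J (b 5) = b 6"
  shows "J = Jf"
proof
  fix v
  have "J (b 2) = - b 1" "J (b 4) = - b 3" "J (b 6) = - b 5" using assms by metis+
  then have Jb: "\<forall>i. J (b i) = Jf (b i)" using assms by (simp add: forall_6 Jf_b)
  have "J v = J (\<Sum>i\<in>UNIV. e i v *\<^sub>R b i)" using expand by simp
  also have "\<dots> = Jf (\<Sum>i\<in>UNIV. e i v *\<^sub>R b i)"
    using Jb by (simp add: linear_sum linear_cmul assms(1) linear_Jf)
  also have "\<dots> = Jf v" using expand by simp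
  finally show "J v = Jf v" .
qed

lemma kappa_Jf: "\<kappa> [x, Jf y] = (\<Sum>i\<in>UNIV. e i x * e i y)"
  by (simp add: kappa_e e_Jf sum_6)

lemma linear_Omega: "linear (\<lambda>x. \<Omega> [x, y, z])" "linear (\<lambda>y. \<Omega> [x, y, z])" "linear (\<lambda>z. \<Omega> [x, y, z])"
  by (rule linearI; simp add: Omega_e' e_simps algebra_simps)+

text \<open>The multiplication table of the cross product dual to \<open>\<Omega>\<close>, from which almost all finite computations
below are read off.\<close>

lemma Omega_bb:
  shows
    "\<Omega> [u, b 1, b 1] = 0" "\<Omega> [u, b 1, b 2] = 0" "\<Omega> [u, b 1, b 3] = e 5 u" "\<Omega> [u, b 1, b 4] = - e 6 u" "\<Omega> [u, b 1, b 5] = - e 3 u" "\<Omega> [u, b 1, b 6] = e 4 u"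
    "\<Omega> [u, b 2, b 1] = 0" "\<Omega> [u, b 2, b 2] = 0" "\<Omega> [u, b 2, b 3] = - e 6 u" "\<Omega> [u, b 2, b 4] = - e 5 u" "\<Omega> [u, b 2, b 5] = e 4 u" "\<Omega> [u, b 2, b 6] = e 3 u"
    "\<Omega> [u, b 3, b 1] = - e 5 u" "\<Omega> [u, b 3, b 2] = e 6 u" "\<Omega> [u, b 3, b 3] = 0" "\<Omega> [u, b 3, b 4] = 0" "\<Omega> [u, b 3, b 5] = e 1 u" "\<Omega> [u, b 3, b 6] = - e 2 u"
    "\<Omega> [u, b 4, b 1] = e 6 u" "\<Omega> [u, b 4, b 2] = e 5 u" "\<Omega> [u, b 4, b 3] = 0" "\<Omega> [u, b 4, b 4] = 0" "\<Omega> [u, b 4, b 5] = - e 2 u" "\<Omega> [u, b 4, b 6] = - e 1 u"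
    "\<Omega> [u, b 5, b 1] = e 3 u" "\<Omega> [u, b 5, b 2] = - e 4 u" "\<Omega> [u, b 5, b 3] = - e 1 u" "\<Omega> [u, b 5, b 4] = e 2 u" "\<Omega> [u, b 5, b 5] = 0" "\<Omega> [u, b 5, b 6] = 0"
    "\<Omega> [u, b 6, b 1] = - e 4 u" "\<Omega> [u, b 6, b 2] = - e 3 u" "\<Omega> [u, b 6, b 3] = e 2 u" "\<Omega> [u, b 6, b 4] = e 1 u" "\<Omega> [u, b 6, b 5] = 0" "\<Omega> [u, b 6, b 6] = 0"
  by (simp_all add: Omega_e' e_b)

lemmas Omega_neg = linear_neg[OF linear_Omega(1)] linear_neg[OF linear_Omega(2)] linear_neg[OF linear_Omega(3)]

lemma kappa_dual: "\<kappa> [w, \<Sum>k\<in>UNIV. b k $ a *\<^sub>R Jf (b k)] = w $ a"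
proof -
  have "\<kappa> [w, \<Sum>k\<in>UNIV. b k $ a *\<^sub>R Jf (b k)] = (\<Sum>k\<in>UNIV. b k $ a * e k w)"
    by (simp add: kappa_e e_simps sum_6 e_b Jf_b algebra_simps)
  also have "\<dots> = (\<Sum>k\<in>UNIV. e k w *\<^sub>R b k) $ a"
    by (simp add: sum_component mult.commute)
  also have "\<dots> = w $ a" using expand[of w] by simp
  finally show ?thesis .
qed

lemma kappa_dual_exists: "\<exists>E. \<forall>w a. \<kappa> [w, E a] = w $ a"
  using kappa_dual by (intro exI[of _ "\<lambda>a. \<Sum>k\<in>UNIV. b k $ a *\<^sub>R Jf (b k)"]) blast

text \<open>The vectors \<open>E i\<close> are the columns of the inverse of \<open>\<kappa>\<close>, so the left side is a contraction of
\<open>\<Omega> \<otimes> \<Omega>\<close> with two copies of that inverse and does not involve the frame. It shows that \<open>g\<close>, hence \<open>J\<close>,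
is the same for all adapted frames, and that \<open>g\<close> depends smoothly on \<open>\<kappa>\<close> and \<open>\<Omega>\<close>.\<close>

lemma metric_contraction:
  assumes E: "\<And>w a. \<kappa> [w, E a] = w $ a"
  shows "(\<Sum>i\<in>UNIV. \<Sum>j\<in>UNIV. \<Omega> [u, axis i 1, axis j 1] * \<Omega> [v, E i, E j]) = - 4 * \<kappa> [u, Jf v]"
proof -
  \<comment> \<open>the inverse of \<open>\<kappa>\<close> is the bivector \<open>\<Sum>\<^sub>k b\<^sub>k \<otimes> J b\<^sub>k\<close>, which replaces the sum over coordinates by one over the frame\<close>
  have Ea: "E a = (\<Sum>k\<in>UNIV. b k $ a *\<^sub>R Jf (b k))" for a
  proof -
    have "\<kappa> [w, E a - (\<Sum>k\<in>UNIV. b k $ a *\<^sub>R Jf (b k))]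
        = \<kappa> [w, E a] - \<kappa> [w, \<Sum>k\<in>UNIV. b k $ a *\<^sub>R Jf (b k)]" for w
      by (simp add: kappa_e e_simps algebra_simps)
    then show ?thesis using kappa_nondeg E kappa_dual by force
  qed
  have split: "\<Omega> [v, E i, E j] = (\<Sum>k\<in>UNIV. \<Sum>l\<in>UNIV. b k $ i * b l $ j * \<Omega> [v, Jf (b k), Jf (b l)])" for i j
  proof -
    have 1: "\<Omega> [v, x, E j] = (\<Sum>l\<in>UNIV. b l $ j * \<Omega> [v, x, Jf (b l)])" for x
      by (simp add: Ea[of j] linear_sum[OF linear_Omega(3)] linear_cmul[OF linear_Omega(3)])
    have "\<Omega> [v, E i, y] = (\<Sum>k\<in>UNIV. b k $ i * \<Omega> [v, Jf (b k), y])" for y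
      by (simp add: Ea[of i] linear_sum[OF linear_Omega(2)] linear_cmul[OF linear_Omega(2)])
    from this[of "E j"] show ?thesis unfolding 1 by (simp add: sum_distrib_left mult.assoc)
  qed
  have join: "\<Omega> [u, b k, b l] = (\<Sum>i\<in>UNIV. \<Sum>j\<in>UNIV. b k $ i * b l $ j * \<Omega> [u, axis i 1, axis j 1])" for k l
  proof -
    have 1: "\<Omega> [u, x, b l] = (\<Sum>j\<in>UNIV. b l $ j * \<Omega> [u, x, axis j 1])" for x
      using linear_family_expand[OF linear_Omega(3)[of u x], of "b l"] by simp
    have "\<Omega> [u, b k, y] = (\<Sum>i\<in>UNIV. b k $ i * \<Omega> [u, axis i 1, y])" for y
      using linear_family_expand[OF linear_Omega(2)[of u y], of "b k"] by simp
    from this[of "b l"] show ?thesis unfolding 1 by (simp add: sum_distrib_left mult.assoc)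
  qed
  have "(\<Sum>i\<in>UNIV. \<Sum>j\<in>UNIV. \<Omega> [u, axis i 1, axis j 1] * \<Omega> [v, E i, E j])
      = (\<Sum>i\<in>UNIV. \<Sum>j\<in>UNIV. \<Sum>k\<in>UNIV. \<Sum>l\<in>UNIV. b k $ i * b l $ j * \<Omega> [u, axis i 1, axis j 1] * \<Omega> [v, Jf (b k), Jf (b l)])"
    unfolding split by (simp add: sum_distrib_left mult_ac)
  also have "\<dots> = (\<Sum>i\<in>UNIV. \<Sum>k\<in>UNIV. \<Sum>j\<in>UNIV. \<Sum>l\<in>UNIV. b k $ i * b l $ j * \<Omega> [u, axis i 1, axis j 1] * \<Omega> [v, Jf (b k), Jf (b l)])"
    by (intro sum.cong refl sum.swap)
  also have "\<dots> = (\<Sum>k\<in>UNIV. \<Sum>i\<in>UNIV. \<Sum>l\<in>UNIV. \<Sum>j\<in>UNIV. b k $ i * b l $ j * \<Omega> [u, axis i 1, axis j 1] * \<Omega> [v, Jf (b k), Jf (b l)])"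
    by (subst sum.swap) (intro sum.cong refl sum.swap)
  also have "\<dots> = (\<Sum>k\<in>UNIV. \<Sum>l\<in>UNIV. \<Sum>i\<in>UNIV. \<Sum>j\<in>UNIV. b k $ i * b l $ j * \<Omega> [u, axis i 1, axis j 1] * \<Omega> [v, Jf (b k), Jf (b l)])"
    by (intro sum.cong refl sum.swap)
  also have "\<dots> = (\<Sum>k\<in>UNIV. \<Sum>l\<in>UNIV. \<Omega> [u, b k, b l] * \<Omega> [v, Jf (b k), Jf (b l)])"
    unfolding join by (simp add: sum_distrib_right)
  also have "\<dots> = - 4 * (\<Sum>i\<in>UNIV. e i u * e i v)"
    by (simp add: sum_6 Jf_b Omega_neg Omega_bb)
  finally show ?thesis by (simp add: kappa_Jf)
qed

end

lemma Jf_independent: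
  assumes "su3_frame \<kappa> \<Omega> e b" "su3_frame \<kappa> \<Omega> e' b'"
  shows "su3_frame.Jf e b = su3_frame.Jf e' b'"
proof
  fix v
  interpret f: su3_frame \<kappa> \<Omega> e b by (rule assms)
  interpret f': su3_frame \<kappa> \<Omega> e' b' by (rule assms)
  obtain E where E: "\<And>w a. \<kappa> [w, E a] = w $ a" using f.kappa_dual_exists by blast
  have "\<kappa> [u, f.Jf v] = \<kappa> [u, f'.Jf v]" for u
    using f.metric_contraction[OF E, of u v] f'.metric_contraction[OF E, of u v] by simp
  then have "\<kappa> [u, f.Jf v - f'.Jf v] = 0" for u
    by (simp add: f.kappa_e f.e_simps algebra_simps)
  then show "f.Jf v = f'.Jf v" using f.kappa_nondeg by force
qed

context su3_frame begin

lemma induced_J_eq: "induced_J \<kappa> \<Omega> = Jf"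
  unfolding induced_J_def
proof (rule the_equality)
  show "linear Jf \<and> (\<forall>v. Jf (Jf v) = - v) \<and> (\<exists>e b. adapted_coframe \<kappa> \<Omega> e \<and> dual_frame e b \<and>
        Jf (b 1) = b 2 \<and> Jf (b 3) = b 4 \<and> Jf (b 5) = b 6)"
    using linear_Jf Jf_Jf Jf_b adapted dual by blast
next
  fix J assume "linear J \<and> (\<forall>v. J (J v) = - v) \<and> (\<exists>e b. adapted_coframe \<kappa> \<Omega> e \<and> dual_frame e b \<and>
        J (b 1) = b 2 \<and> J (b 3) = b 4 \<and> J (b 5) = b 6)"
  then obtain e' b' where J: "linear J" "\<forall>v. J (J v) = - v" "adapted_coframe \<kappa> \<Omega> e'" "dual_frame e' b'"
    "J (b' 1) = b' 2" "J (b' 3) = b' 4" "J (b' 5) = b' 6" by blast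
  then interpret f': su3_frame \<kappa> \<Omega> e' b' by unfold_locales
  have "J = f'.Jf" using f'.Jf_unique J by blast
  then show "J = Jf" using Jf_independent su3_frame_axioms f'.su3_frame_axioms by metis
qed

end

lemma dual_frame_exists:
  assumes "coframe e" shows "\<exists>b. dual_frame e b"
proof -
  have "\<exists>v. \<forall>i. e i v = (if i = j then 1 else 0)" for j
  proof -
    have "surj (\<lambda>v. \<chi> i. e i v)" using assms by (simp add: coframe_def bij_def)
    then obtain v where "(\<chi> i. e i v) = axis j 1" by (metis surjD)
    then have "\<forall>i. e i v = (if i = j then 1 else 0)" by (simp add: vec_eq_iff axis_def)
    then show ?thesis by blast
  qed
  then show ?thesis unfolding dual_frame_def by metis
qed

context su3_frame begin

abbreviation "g x y \<equiv> \<kappa> [x, Jf y]"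

lemma g_sym: "g x y = g y x" by (simp add: kappa_Jf mult.commute)

lemma g_J_skew: "g (Jf x) y = - g x (Jf y)" by (simp add: kappa_Jf sum_6 e_Jf)

lemma kappa_eq_g: "\<kappa> [x, y] = g (Jf x) y" by (simp add: kappa_Jf kappa_e sum_6 e_Jf)

lemma g_nonneg: "g x x \<ge> 0" by (simp add: kappa_Jf sum_nonneg)

lemma g_b: "g v (b i) = e i v"
  by (simp add: kappa_Jf e_b if_distrib[of "(*) _"] cong: if_cong)

lemma Omega_J: "\<Omega> [Jf x, y, z] = \<Omega> [x, Jf y, z]"
  by (simp add: Omega_e' e_Jf algebra_simps)

text \<open>Lagrange's identity for \<open>x \<times> y\<close>. The last term is there because \<open>x \<times> J x = 0\<close>: only the part of \<open>y\<close> that is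
orthogonal to the complex line of \<open>x\<close> contributes.\<close>

lemma cross_norm: "(\<Sum>k\<in>UNIV. (\<Omega> [x, y, b k])^2) = g x x * g y y - (g x y)^2 - (g (Jf x) y)^2"
  unfolding kappa_Jf
  by (simp add: sum_6 Omega_e' e_b e_Jf) (simp add: power2_eq_square algebra_simps)

text \<open>\<open>\<Omega>\<close> is a calibration: \<open>\<Omega>(x, y, z)\<close> is the inner product of \<open>x \<times> y\<close> with \<open>z\<close>, and
\<open>|x \<times> y| \<le> |x| |y|\<close>.\<close>

lemma Omega_comass: "(\<Omega> [x, y, z])^2 \<le> g x x * g y y * g z z"
proof -
  define c where "c = (\<chi> k. \<Omega> [x, y, b k])"
  define s where "s = (\<chi> k. e k z)"
  have "\<Omega> [x, y, z] = \<Omega> [x, y, \<Sum>k\<in>UNIV. e k z *\<^sub>R b k]" using expand[of z] by simp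
  also have "\<dots> = c \<bullet> s"
    by (simp add: linear_sum[OF linear_Omega(3)] linear_cmul[OF linear_Omega(3)] c_def s_def inner_vec_def mult.commute)
  finally have O: "\<Omega> [x, y, z] = c \<bullet> s" .
  have ss: "s \<bullet> s = g z z" by (simp add: s_def inner_vec_def kappa_Jf)
  have "c \<bullet> c = g x x * g y y - (g x y)^2 - (g (Jf x) y)^2"
    unfolding cross_norm[symmetric] by (simp add: c_def inner_vec_def power2_eq_square)
  then have "c \<bullet> c \<le> g x x * g y y" by simp
  then have "(c \<bullet> c) * (s \<bullet> s) \<le> g x x * g y y * g z z"
    unfolding ss using g_nonneg[of z] by (rule mult_right_mono)
  then show ?thesis using Cauchy_Schwarz_ineq[of c s] unfolding O by linarith
qed

end

lemma linear_dd_param: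
  fixes F :: "'a::real_normed_vector \<Rightarrow> 'c::real_vector \<Rightarrow> 'b::real_normed_vector"
  assumes U: "open U" "x \<in> U" and lin: "\<And>y. y \<in> U \<Longrightarrow> linear (F y)"
    and F: "\<And>w. (\<lambda>y. F y w) differentiable (at x)"
  shows "linear (\<lambda>w. dd (\<lambda>y. F y w) x u)"
proof (rule linearI)
  fix v w and c :: real
  have "dd (\<lambda>y. F y (v + w)) x u = dd (\<lambda>y. F y v + F y w) x u"
    by (rule dd_cong_open[OF U]) (simp add: linear_add[OF lin])
  then show "dd (\<lambda>y. F y (v + w)) x u = dd (\<lambda>y. F y v) x u + dd (\<lambda>y. F y w) x u"
    by (simp add: dd_add F)
  have "dd (\<lambda>y. F y (c *\<^sub>R v)) x u = dd (\<lambda>y. c *\<^sub>R F y v) x u"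
    by (rule dd_cong_open[OF U]) (simp add: linear_cmul[OF lin])
  then show "dd (\<lambda>y. F y (c *\<^sub>R v)) x u = c *\<^sub>R dd (\<lambda>y. F y v) x u"
    by (simp add: dd_scaleR F)
qed

section \<open>Connections in a chart\<close>

lemma dd_apply2:
  fixes F :: "'a::real_normed_vector \<Rightarrow> real^'n \<Rightarrow> real^'m \<Rightarrow> 'b::real_normed_vector"
  assumes U: "open U" "x \<in> U" and lin: "\<And>y w. y \<in> U \<Longrightarrow> linear (\<lambda>v. F y v w)" "\<And>y v. y \<in> U \<Longrightarrow> linear (\<lambda>w. F y v w)"
    and F: "\<And>v w. (\<lambda>y. F y v w) differentiable (at x)"
    and V: "V differentiable (at x)" and W: "W differentiable (at x)"
  shows "(\<lambda>y. F y (V y) (W y)) differentiable (at x)"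
    and "dd (\<lambda>y. F y (V y) (W y)) x u = dd (\<lambda>y. F y (V x) (W x)) x u + F x (dd V x u) (W x) + F x (V x) (dd W x u)"
proof -
  have d: "(\<lambda>y. F y v (W y)) differentiable (at x)" for v
    by (rule dd_apply(1)[OF U lin(2) F W])
  show "(\<lambda>y. F y (V y) (W y)) differentiable (at x)"
    by (rule dd_apply(1)[where F="\<lambda>y v. F y v (W y)", OF U lin(1) d V])
  have "dd (\<lambda>y. F y (V y) (W y)) x u = dd (\<lambda>y. F y (V x) (W y)) x u + F x (dd V x u) (W x)"
    by (rule dd_apply(2)[where F="\<lambda>y v. F y v (W y)", OF U lin(1) d V])
  also have "dd (\<lambda>y. F y (V x) (W y)) x u = dd (\<lambda>y. F y (V x) (W x)) x u + F x (V x) (dd W x u)"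
    by (rule dd_apply(2)[OF U lin(2) F W])
  finally show "dd (\<lambda>y. F y (V y) (W y)) x u = dd (\<lambda>y. F y (V x) (W x)) x u + F x (dd V x u) (W x) + F x (V x) (dd W x u)"
    by simp
qed

lemma dd_apply3:
  fixes F :: "'a::real_normed_vector \<Rightarrow> real^'n \<Rightarrow> real^'m \<Rightarrow> real^'k \<Rightarrow> 'b::real_normed_vector"
  assumes U: "open U" "x \<in> U" and lin: "\<And>y w z. y \<in> U \<Longrightarrow> linear (\<lambda>v. F y v w z)"
     "\<And>y v z. y \<in> U \<Longrightarrow> linear (\<lambda>w. F y v w z)" "\<And>y v w. y \<in> U \<Longrightarrow> linear (\<lambda>z. F y v w z)"
    and F: "\<And>v w z. (\<lambda>y. F y v w z) differentiable (at x)"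
    and V: "V differentiable (at x)" and W: "W differentiable (at x)" and Z: "Z differentiable (at x)"
  shows "(\<lambda>y. F y (V y) (W y) (Z y)) differentiable (at x)"
    and "dd (\<lambda>y. F y (V y) (W y) (Z y)) x u = dd (\<lambda>y. F y (V x) (W x) (Z x)) x u
      + F x (dd V x u) (W x) (Z x) + F x (V x) (dd W x u) (Z x) + F x (V x) (W x) (dd Z x u)"
proof -
  have d: "(\<lambda>y. F y v w (Z y)) differentiable (at x)" for v w
    by (rule dd_apply(1)[OF U lin(3) F Z])
  show "(\<lambda>y. F y (V y) (W y) (Z y)) differentiable (at x)"
    by (rule dd_apply2(1)[where F="\<lambda>y v w. F y v w (Z y)", OF U lin(1) lin(2) d V W])
  have "dd (\<lambda>y. F y (V y) (W y) (Z y)) x u = dd (\<lambda>y. F y (V x) (W x) (Z y)) x u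
      + F x (dd V x u) (W x) (Z x) + F x (V x) (dd W x u) (Z x)"
    by (rule dd_apply2(2)[where F="\<lambda>y v w. F y v w (Z y)", OF U lin(1) lin(2) d V W])
  also have "dd (\<lambda>y. F y (V x) (W x) (Z y)) x u = dd (\<lambda>y. F y (V x) (W x) (Z x)) x u + F x (V x) (W x) (dd Z x u)"
    by (rule dd_apply(2)[OF U lin(3) F Z])
  finally show "dd (\<lambda>y. F y (V y) (W y) (Z y)) x u = dd (\<lambda>y. F y (V x) (W x) (Z x)) x u
      + F x (dd V x u) (W x) (Z x) + F x (V x) (dd W x u) (Z x) + F x (V x) (W x) (dd Z x u)"
    by simp
qed

text \<open>A connection is given by its Christoffel symbols: \<open>G y u v\<close> is the covariant derivative, in direction
\<open>u\<close>, of the field with constant coordinates \<open>v\<close>. Torsion may be present.\<close>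

locale connection =
  fixes U :: "(real^'n::finite) set" and G :: "real^'n \<Rightarrow> real^'n \<Rightarrow> real^'n \<Rightarrow> real^'n"
  assumes open_U: "open U"
    and lin_dir: "\<And>y v. y \<in> U \<Longrightarrow> linear (\<lambda>u. G y u v)"
    and lin_arg: "\<And>y u. y \<in> U \<Longrightarrow> linear (\<lambda>v. G y u v)"
    and smooth_G: "\<And>u v. smooth_on U (\<lambda>y. G y u v)"
begin

definition nab :: "(real^'n \<Rightarrow> real^'n) \<Rightarrow> real^'n \<Rightarrow> real^'n \<Rightarrow> real^'n" where
  "nab V x u = dd V x u + G x u (V x)"

text \<open>An affine vector field with value \<open>v\<close> and vanishing covariant derivative at \<open>x\<close>. An identity between
tensor fields, evaluated on such fields and differentiated at \<open>x\<close>, turns into the identity between their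
covariant derivatives without any correction terms.\<close>

definition par :: "real^'n \<Rightarrow> real^'n \<Rightarrow> real^'n \<Rightarrow> real^'n" where
  "par x v y = v - G x (y - x) v"

lemma par_at [simp]: "x \<in> U \<Longrightarrow> par x v x = v"
  by (simp add: par_def linear_0[OF lin_dir])

lemma smooth_par: assumes "x \<in> U" shows "smooth_on U (par x v)"
proof -
  have "par x v = (\<lambda>y. v - (G x y v - G x x v))"
    by (simp add: par_def fun_eq_iff linear_diff[OF lin_dir[OF assms]])
  moreover have "smooth_on U (\<lambda>y. v - (G x y v - G x x v))"
    by (intro smooth_on_diff smooth_on_const open_U linear_smooth lin_dir assms)
  ultimately show ?thesis by simp
qed

lemma diff_par: "x \<in> U \<Longrightarrow> par x v differentiable (at x)"
  using smooth_par smooth_on_differentiable by blast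

lemma nab_par [simp]: assumes "x \<in> U" shows "nab (par x v) x u = 0"
proof -
  have bl: "bounded_linear (\<lambda>u. G x u v)" using lin_dir[OF assms] linear_conv_bounded_linear by blast
  have "(par x v has_derivative (\<lambda>u. - G x u v)) (at x)"
    unfolding par_def by (auto intro!: derivative_eq_intros bounded_linear.has_derivative[OF bl])
  then show ?thesis using dd_eqI assms by (fastforce simp: nab_def)
qed

lemma diff_G: "x \<in> U \<Longrightarrow> (\<lambda>y. G y u v) differentiable (at x)"
  using smooth_G smooth_on_differentiable by blast

lemma smooth_nab: assumes "smooth_on U V" shows "smooth_on U (\<lambda>y. nab V y u)"
  unfolding nab_def
  by (intro smooth_on_add open_U smooth_on_dd assms smooth_on_apply[OF open_U lin_arg smooth_G])

lemma nab_cong: "x \<in> U \<Longrightarrow> (\<And>y. y \<in> U \<Longrightarrow> V y = W y) \<Longrightarrow> nab V x u = nab W x u"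
  unfolding nab_def using dd_cong_open[OF open_U] by metis

lemma nab_add:
  "x \<in> U \<Longrightarrow> V differentiable (at x) \<Longrightarrow> W differentiable (at x) \<Longrightarrow> nab (\<lambda>y. V y + W y) x u = nab V x u + nab W x u"
  unfolding nab_def by (simp add: dd_add linear_add[OF lin_arg])

lemma nab_diff:
  "x \<in> U \<Longrightarrow> V differentiable (at x) \<Longrightarrow> W differentiable (at x) \<Longrightarrow> nab (\<lambda>y. V y - W y) x u = nab V x u - nab W x u"
  unfolding nab_def by (simp add: dd_diff linear_diff[OF lin_arg])

lemma nab_cmul:
  "x \<in> U \<Longrightarrow> V differentiable (at x) \<Longrightarrow> nab (\<lambda>y. c *\<^sub>R V y) x u = c *\<^sub>R nab V x u"
  unfolding nab_def by (simp add: dd_scaleR linear_cmul[OF lin_arg] scaleR_right_distrib)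

lemma nab_const: "nab (\<lambda>_. v) x u = G x u v"
  by (simp add: nab_def)

text \<open>The partial derivatives commute, so only the curvature survives.\<close>

lemma nab_commutator:
  assumes x: "x \<in> U" and V: "smooth_on U V"
  shows "nab (\<lambda>y. nab V y v) x u - nab (\<lambda>y. nab V y u) x v = riemann G x u v (V x)"
proof -
  have dV: "V differentiable (at x)" "(\<lambda>y. dd V y v) differentiable (at x)" for v
    using V x smooth_on_dd smooth_on_differentiable by blast+
  have e: "nab (\<lambda>y. nab V y v) x u = dd (\<lambda>y. dd V y v) x u + (dd (\<lambda>y. G y v (V x)) x u + G x v (dd V x u))
      + (G x u (dd V x v) + G x u (G x v (V x)))" for u v
  proof -
    have "dd (\<lambda>y. dd V y v + G y v (V y)) x u = dd (\<lambda>y. dd V y v) x u + dd (\<lambda>y. G y v (V y)) x u"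
      by (intro dd_add dV dd_apply(1)[OF open_U x lin_arg diff_G[OF x]])
    moreover have "dd (\<lambda>y. G y v (V y)) x u = dd (\<lambda>y. G y v (V x)) x u + G x v (dd V x u)"
      by (intro dd_apply(2)[OF open_U x lin_arg diff_G[OF x]] dV)
    ultimately show ?thesis unfolding nab_def by (simp add: linear_add[OF lin_arg[OF x]])
  qed
  show ?thesis
    unfolding e riemann_def using dd_commute[OF open_U x V, of u v] by simp
qed

lemma riemann_nab: "riemann G x u v w = nab (\<lambda>y. G y v w) x u - nab (\<lambda>y. G y u w) x v"
  by (simp add: riemann_def nab_def)

lemma riemann_skew: "riemann G x u v w = - riemann G x v u w"
  by (simp add: riemann_def)

lemma linear_riemann_dir: assumes "x \<in> U" shows "linear (\<lambda>u. riemann G x u v w)"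
proof -
  have 1: "linear (\<lambda>u. dd (\<lambda>y. G y v w) x u)" 
    using linear_dd diff_G assms by blast
  have 2: "linear (\<lambda>u. dd (\<lambda>y. G y u w) x v)"
    by (rule linear_dd_param[OF open_U assms lin_dir diff_G[OF assms]])
  have 3: "linear (\<lambda>u. G x u (G x v w))" using lin_dir assms by blast
  have 4: "linear (\<lambda>u. G x v (G x u w))"
    using linear_compose[OF lin_dir[OF assms] lin_arg[OF assms]] by (simp add: o_def)
  show ?thesis unfolding riemann_def
    by (intro linear_compose_add linear_compose_sub 1 2 3 4)
qed

lemma bianchi:
  assumes x: "x \<in> U" and sym: "\<And>y u v. y \<in> U \<Longrightarrow> G y u v = G y v u"
  shows "riemann G x u v w + riemann G x v w u + riemann G x w u v = 0"
proof -
  have "nab (\<lambda>y. G y v w) x u = nab (\<lambda>y. G y w v) x u" for u v w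
    using sym by (intro nab_cong[OF x]) auto
  from this[of v w u] this[of w u v] this[of u v w] show ?thesis
    unfolding riemann_nab by simp
qed

end

text \<open>\<open>h_parallel\<close> is the equation \<open>\<nabla>h = 0\<close>, evaluated on fields with constant coordinates.\<close>

locale parallel_bilinear = connection U G
  for U :: "(real^'n::finite) set" and G +
  fixes h :: "real^'n \<Rightarrow> real^'n \<Rightarrow> real^'n \<Rightarrow> real"
  assumes h_lin1: "\<And>y w. y \<in> U \<Longrightarrow> linear (\<lambda>v. h y v w)"
    and h_lin2: "\<And>y v. y \<in> U \<Longrightarrow> linear (\<lambda>w. h y v w)"
    and h_smooth: "\<And>v w. smooth_on U (\<lambda>y. h y v w)"
    and h_parallel: "\<And>x u v w. x \<in> U \<Longrightarrow> dd (\<lambda>y. h y v w) x u = h x (G x u v) w + h x v (G x u w)"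
begin

lemma h_diff: "x \<in> U \<Longrightarrow> (\<lambda>y. h y v w) differentiable (at x)"
  using h_smooth smooth_on_differentiable by blast

lemma dd_h:
  assumes x: "x \<in> U" and V: "V differentiable (at x)" and W: "W differentiable (at x)"
  shows "dd (\<lambda>y. h y (V y) (W y)) x u = h x (nab V x u) (W x) + h x (V x) (nab W x u)"
  unfolding nab_def
  by (rule trans[OF dd_apply2(2)[where F=h, OF open_U x h_lin1 h_lin2 h_diff[OF x] V W]])
     (simp_all add: h_parallel[OF x] linear_add[OF h_lin1[OF x]] linear_add[OF h_lin2[OF x]])

lemma diff_h:
  assumes x: "x \<in> U" and V: "V differentiable (at x)" and W: "W differentiable (at x)"
  shows "(\<lambda>y. h y (V y) (W y)) differentiable (at x)"
  by (rule dd_apply2(1)[where F=h, OF open_U x h_lin1 h_lin2 h_diff[OF x] V W])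

text \<open>The curvature annihilates a parallel tensor: antisymmetrise the second derivatives of a component of
\<open>h\<close>, which commute.\<close>

lemma riemann_h:
  assumes x: "x \<in> U"
  shows "h x (riemann G x u v w) z + h x w (riemann G x u v z) = 0"
proof -
  have sc: "smooth_on U (\<lambda>y. nab (\<lambda>_. w) y v)" for v w by (intro smooth_nab smooth_on_const)
  have dc: "(\<lambda>y. nab (\<lambda>_. w) y v) differentiable (at x)" for v w
    using smooth_on_differentiable[OF sc x] .
  have e: "dd (\<lambda>y. dd (\<lambda>y. h y w z) y v) x u =
     h x (nab (\<lambda>y. nab (\<lambda>_. w) y v) x u) z + h x (nab (\<lambda>_. w) x v) (nab (\<lambda>_. z) x u)
     + (h x (nab (\<lambda>_. w) x u) (nab (\<lambda>_. z) x v) + h x w (nab (\<lambda>y. nab (\<lambda>_. z) y v) x u))" for u v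
  proof -
    have "dd (\<lambda>y. dd (\<lambda>y. h y w z) y v) x u
        = dd (\<lambda>y. h y (nab (\<lambda>_. w) y v) z + h y w (nab (\<lambda>_. z) y v)) x u"
      by (rule dd_cong_open[OF open_U x]) (simp add: nab_const h_parallel)
    then show ?thesis
      by (simp add: dd_add diff_h[OF x dc] diff_h[OF x _ dc] dd_h[OF x dc] dd_h[OF x _ dc])
  qed
  have "dd (\<lambda>y. dd (\<lambda>y. h y w z) y v) x u = dd (\<lambda>y. dd (\<lambda>y. h y w z) y u) x v"
    by (rule dd_commute[OF open_U x h_smooth])
  then have "h x (nab (\<lambda>y. nab (\<lambda>_. w) y v) x u - nab (\<lambda>y. nab (\<lambda>_. w) y u) x v) z
      + h x w (nab (\<lambda>y. nab (\<lambda>_. z) y v) x u - nab (\<lambda>y. nab (\<lambda>_. z) y u) x v) = 0"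
    unfolding e by (simp add: linear_diff[OF h_lin1[OF x]] linear_diff[OF h_lin2[OF x]])
  then show ?thesis
    unfolding nab_commutator[OF x smooth_on_const] .
qed

end

locale parallel_trilinear = connection U G
  for U :: "(real^'n::finite) set" and G +
  fixes h :: "real^'n \<Rightarrow> real^'n \<Rightarrow> real^'n \<Rightarrow> real^'n \<Rightarrow> real"
  assumes h_lin: "\<And>y w z. y \<in> U \<Longrightarrow> linear (\<lambda>v. h y v w z)" 
    "\<And>y v z. y \<in> U \<Longrightarrow> linear (\<lambda>w. h y v w z)" "\<And>y v w. y \<in> U \<Longrightarrow> linear (\<lambda>z. h y v w z)"
    and h_smooth: "\<And>v w z. smooth_on U (\<lambda>y. h y v w z)"
    and h_parallel: "\<And>x u v w z. x \<in> U \<Longrightarrow> dd (\<lambda>y. h y v w z) x u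
       = h x (G x u v) w z + h x v (G x u w) z + h x v w (G x u z)"
begin

lemma h_diff: "x \<in> U \<Longrightarrow> (\<lambda>y. h y v w z) differentiable (at x)"
  using h_smooth smooth_on_differentiable by blast

lemma dd_h:
  assumes x: "x \<in> U" and V: "V differentiable (at x)" and W: "W differentiable (at x)" and Z: "Z differentiable (at x)"
  shows "dd (\<lambda>y. h y (V y) (W y) (Z y)) x u
    = h x (nab V x u) (W x) (Z x) + h x (V x) (nab W x u) (Z x) + h x (V x) (W x) (nab Z x u)"
  unfolding nab_def
  by (rule trans[OF dd_apply3(2)[where F=h, OF open_U x h_lin h_diff[OF x] V W Z]])
     (simp_all add: h_parallel[OF x] linear_add[OF h_lin(1)[OF x]] linear_add[OF h_lin(2)[OF x]] linear_add[OF h_lin(3)[OF x]])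

lemma diff_h:
  assumes x: "x \<in> U" and V: "V differentiable (at x)" and W: "W differentiable (at x)" and Z: "Z differentiable (at x)"
  shows "(\<lambda>y. h y (V y) (W y) (Z y)) differentiable (at x)"
  by (rule dd_apply3(1)[where F=h, OF open_U x h_lin h_diff[OF x] V W Z])

lemma riemann_h:
  assumes x: "x \<in> U"
  shows "h x (riemann G x u v w) z t + h x w (riemann G x u v z) t + h x w z (riemann G x u v t) = 0"
proof -
  have sc: "smooth_on U (\<lambda>y. nab (\<lambda>_. w) y v)" for v w by (intro smooth_nab smooth_on_const)
  have dc: "(\<lambda>y. nab (\<lambda>_. w) y v) differentiable (at x)" for v w
    using smooth_on_differentiable[OF sc x] .
  let ?n = "\<lambda>w u. nab (\<lambda>_. w) x u" and ?nn = "\<lambda>w u v. nab (\<lambda>y. nab (\<lambda>_. w) y v) x u"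
  have e: "dd (\<lambda>y. dd (\<lambda>y. h y w z t) y v) x u =
      h x (?nn w u v) z t + h x (?n w v) (?n z u) t + h x (?n w v) z (?n t u)
     + (h x (?n w u) (?n z v) t + h x w (?nn z u v) t + h x w (?n z v) (?n t u))
     + (h x (?n w u) z (?n t v) + h x w (?n z u) (?n t v) + h x w z (?nn t u v))" for u v
  proof -
    have "dd (\<lambda>y. dd (\<lambda>y. h y w z t) y v) x u
        = dd (\<lambda>y. h y (nab (\<lambda>_. w) y v) z t + h y w (nab (\<lambda>_. z) y v) t + h y w z (nab (\<lambda>_. t) y v)) x u"
      by (rule dd_cong_open[OF open_U x]) (simp add: nab_const h_parallel)
    then show ?thesis
      by (simp add: dd_add diff_h[OF x dc] diff_h[OF x _ dc] diff_h[OF x _ _ dc]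
           dd_h[OF x dc] dd_h[OF x _ dc] dd_h[OF x _ _ dc])
  qed
  have "dd (\<lambda>y. dd (\<lambda>y. h y w z t) y v) x u = dd (\<lambda>y. dd (\<lambda>y. h y w z t) y u) x v"
    by (rule dd_commute[OF open_U x h_smooth])
  then have "h x (?nn w u v - ?nn w v u) z t + h x w (?nn z u v - ?nn z v u) t + h x w z (?nn t u v - ?nn t v u) = 0"
    unfolding e by (simp add: linear_diff[OF h_lin(1)[OF x]] linear_diff[OF h_lin(2)[OF x]] linear_diff[OF h_lin(3)[OF x]])
  then show ?thesis
    unfolding nab_commutator[OF x smooth_on_const] .
qed

end

section \<open>The Levi-Civita connection\<close>

locale metric_chart =
  fixes U :: "(real^'n::finite) set" and g :: "real^'n \<Rightarrow> real^'n \<Rightarrow> real^'n \<Rightarrow> real"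
  assumes open_U: "open U"
    and g_lin: "\<And>y v. y \<in> U \<Longrightarrow> linear (\<lambda>w. g y v w)"
    and g_sym: "\<And>y v w. y \<in> U \<Longrightarrow> g y v w = g y w v"
    and g_pos: "\<And>y v. y \<in> U \<Longrightarrow> v \<noteq> 0 \<Longrightarrow> g y v v > 0"
    and g_smooth: "\<And>v w. smooth_on U (\<lambda>y. g y v w)"
begin

lemma g_lin1: assumes "y \<in> U" shows "linear (\<lambda>v. g y v w)"
  using g_lin[OF assms, of w] g_sym[OF assms, of w] by simp

lemma g_ext: assumes "y \<in> U" "\<And>w. g y v w = g y v' w" shows "v = v'"
proof (rule ccontr)
  assume "v \<noteq> v'"
  then have "g y (v - v') (v - v') > 0" using g_pos assms(1) by simp
  then show False using assms by (simp add: linear_diff[OF g_lin1])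
qed

lemma g_diff: "x \<in> U \<Longrightarrow> (\<lambda>y. g y v w) differentiable (at x)"
  using g_smooth smooth_on_differentiable by blast

lemma riesz:
  assumes y: "y \<in> U" and l: "linear l"
  shows "\<exists>v. \<forall>w. g y v w = l w"
proof -
  define T where "T v = (\<chi> i. g y v (axis i 1))" for v
  have lT: "linear T" by (rule linearI) (simp_all add: T_def vec_eq_iff linear_add[OF g_lin1[OF y]] linear_cmul[OF g_lin1[OF y]])
  have inj: "inj T"
  proof (rule injI)
    fix v v' assume "T v = T v'"
    then have "g y v (axis i 1) = g y v' (axis i 1)" for i by (simp add: T_def vec_eq_iff)
    then have "g y v w = g y v' w" for w
      using linear_family_expand[OF g_lin[OF y, of v], of w] linear_family_expand[OF g_lin[OF y, of v'], of w] by simp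
    then show "v = v'" using g_ext[OF y] by blast
  qed
  then obtain v where v: "T v = (\<chi> i. l (axis i 1))"
    using linear_injective_imp_surjective[OF lT] by (metis surjD)
  then have "g y v (axis i 1) = l (axis i 1)" for i by (simp add: T_def vec_eq_iff)
  then have "g y v w = l w" for w
    using linear_family_expand[OF g_lin[OF y, of v], of w] linear_family_expand[OF l, of w] by simp
  then show ?thesis by blast
qed

definition koszul :: "real^'n \<Rightarrow> real^'n \<Rightarrow> real^'n \<Rightarrow> real^'n \<Rightarrow> real" where
  "koszul x u v w = (dd (\<lambda>y. g y v w) x u + dd (\<lambda>y. g y u w) x v - dd (\<lambda>y. g y u v) x w) / 2"

lemma dd_g_lin:
  assumes "x \<in> U"
  shows "linear (\<lambda>u. dd (\<lambda>y. g y v w) x u)" "linear (\<lambda>v. dd (\<lambda>y. g y v w) x u)" "linear (\<lambda>w. dd (\<lambda>y. g y v w) x u)"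
  using linear_dd[OF g_diff[OF assms]] linear_dd_param[OF open_U assms g_lin1 g_diff[OF assms]]
    linear_dd_param[OF open_U assms g_lin g_diff[OF assms]] by auto

lemma linear_koszul:
  assumes "x \<in> U"
  shows "linear (\<lambda>u. koszul x u v w)" "linear (\<lambda>v. koszul x u v w)" "linear (\<lambda>w. koszul x u v w)"
  unfolding koszul_def
  by (rule linearI; simp add: linear_add[OF dd_g_lin(1)[OF assms]] linear_add[OF dd_g_lin(2)[OF assms]] linear_add[OF dd_g_lin(3)[OF assms]]
    linear_cmul[OF dd_g_lin(1)[OF assms]] linear_cmul[OF dd_g_lin(2)[OF assms]] linear_cmul[OF dd_g_lin(3)[OF assms]] field_simps)+

lemma dd_g_sym: "x \<in> U \<Longrightarrow> dd (\<lambda>y. g y v w) x u = dd (\<lambda>y. g y w v) x u"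
  by (rule dd_cong_open[OF open_U]) (auto simp: g_sym)

text \<open>Existence and uniqueness by the Koszul formula, which also exhibits the connection as the solution of a
linear system with smooth coefficients.\<close>

lemma levi_civita_spec:
  assumes x: "x \<in> U"
  defines "P \<equiv> \<lambda>\<Gamma>. bilinear \<Gamma> \<and> (\<forall>u v. \<Gamma> u v = \<Gamma> v u) \<and>
     (\<forall>u v w. dd (\<lambda>y. g y v w) x u = g x (\<Gamma> u v) w + g x v (\<Gamma> u w))"
  shows "P (levi_civita g x)" and "g x (levi_civita g x u v) w = koszul x u v w"
proof -
  have "\<exists>\<Gamma>. \<forall>u v w. g x (\<Gamma> u v) w = koszul x u v w"
    using riesz[OF x linear_koszul(3)[OF x]] by metis
  then obtain \<Gamma>0 where \<Gamma>0: "\<And>u v w. g x (\<Gamma>0 u v) w = koszul x u v w" by blast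
  have gx: "g x v (\<Gamma>0 u w) = koszul x u w v" for u v w using \<Gamma>0 g_sym[OF x] by metis
  have "bilinear \<Gamma>0"
    unfolding bilinear_def
    by (intro allI conjI linearI; rule g_ext[OF x])
       (simp_all add: \<Gamma>0 linear_add[OF g_lin1[OF x]] linear_cmul[OF g_lin1[OF x]]
         linear_add[OF linear_koszul(1)[OF x]] linear_add[OF linear_koszul(2)[OF x]]
         linear_cmul[OF linear_koszul(1)[OF x]] linear_cmul[OF linear_koszul(2)[OF x]])
  moreover have "\<Gamma>0 u v = \<Gamma>0 v u" for u v
    by (rule g_ext[OF x]) (simp add: \<Gamma>0 koszul_def dd_g_sym[OF x, of u v])
  moreover have "dd (\<lambda>y. g y v w) x u = g x (\<Gamma>0 u v) w + g x v (\<Gamma>0 u w)" for u v w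
    using dd_g_sym[OF x, of w v u] dd_g_sym[OF x, of w u v] dd_g_sym[OF x, of v u w]
    by (simp add: \<Gamma>0 gx koszul_def field_simps)
  ultimately have P0: "P \<Gamma>0" unfolding P_def by blast
  have uniq: "g x (\<Gamma> u v) w = koszul x u v w" if "P \<Gamma>" for \<Gamma> u v w
  proof -
    have s: "\<Gamma> u v = \<Gamma> v u" for u v using that by (simp add: P_def)
    have m: "dd (\<lambda>y. g y v w) x u = g x (\<Gamma> u v) w + g x v (\<Gamma> u w)" for u v w
      using that by (simp add: P_def)
    show ?thesis unfolding koszul_def m
      using s[of v u] s[of w u] s[of w v] g_sym[OF x, of v "\<Gamma> u w"] by simp
  qed
  have "levi_civita g x = (THE \<Gamma>. P \<Gamma>)" by (simp add: levi_civita_def P_def)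
  also have "\<dots> = \<Gamma>0"
  proof (rule the_equality)
    show "P \<Gamma>0" by (rule P0)
  next
    fix \<Gamma> assume "P \<Gamma>"
    then have "g x (\<Gamma> u v) w = g x (\<Gamma>0 u v) w" for u v w using uniq P0 by simp
    then show "\<Gamma> = \<Gamma>0" using g_ext[OF x] by (metis ext)
  qed
  finally have eq: "levi_civita g x = \<Gamma>0" .
  show "P (levi_civita g x)" "g x (levi_civita g x u v) w = koszul x u v w"
    using P0 \<Gamma>0 eq by auto
qed

lemma smooth_levi_civita: "smooth_on U (\<lambda>y. levi_civita g y u v)"
proof (rule smooth_on_solve[OF open_U g_lin _ g_smooth _ g_lin1, where l="\<lambda>y w. koszul y u v w"])
  show "v = 0" if "y \<in> U" "\<And>w. g y w v = 0" for y v
    using g_pos that by fastforce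
  show "smooth_on U (\<lambda>y. koszul y u v w)" for w
    unfolding koszul_def
    by (intro smooth_on_divide smooth_on_diff smooth_on_add smooth_on_dd g_smooth open_U smooth_on_const) simp
  show "g y w (levi_civita g y u v) = koszul y u v w" if "y \<in> U" for y w
    using levi_civita_spec(2)[OF that] g_sym[OF that] by simp
qed

lemma bilinear_levi_civita: "y \<in> U \<Longrightarrow> bilinear (levi_civita g y)"
  using levi_civita_spec(1) by blast

lemma levi_civita_metric:
  "y \<in> U \<Longrightarrow> dd (\<lambda>y. g y v w) y u = g y (levi_civita g y u v) w + g y v (levi_civita g y u w)"
  using levi_civita_spec(1) by blast

sublocale parallel_bilinear U "levi_civita g" g
proof (intro parallel_bilinear.intro connection.intro parallel_bilinear_axioms.intro)
  show "linear (\<lambda>u. levi_civita g y u v)" if "y \<in> U" for y v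
    using bilinear_levi_civita[OF that] by (simp add: bilinear_def)
  show "linear (\<lambda>v. levi_civita g y u v)" if "y \<in> U" for y u
    using bilinear_levi_civita[OF that] by (simp add: bilinear_def)
qed (fact open_U smooth_levi_civita g_lin1 g_lin g_smooth levi_civita_metric)+

lemma levi_civita_sym: "y \<in> U \<Longrightarrow> levi_civita g y u v = levi_civita g y v u"
  using levi_civita_spec(1) by blast

lemma riemann_pair_symmetry:
  assumes x: "x \<in> U"
  shows "g x (riemann (levi_civita g) x u v w) z = g x (riemann (levi_civita g) x w z u) v"
proof -
  define R where "R u v w z = g x (riemann (levi_civita g) x u v w) z" for u v w z
  have 1: "R u v w z = - R v u w z" for u v w z
    unfolding R_def using riemann_skew[of x u v w] by (simp add: linear_neg[OF g_lin1[OF x]])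
  have 2: "R u v w z = - R u v z w" for u v w z
    unfolding R_def using riemann_h[OF x, of u v w z] g_sym[OF x, of w] by simp
  have 3: "R u v w z + R v w u z + R w u v z = 0" for u v w z
    unfolding R_def using bianchi[OF x levi_civita_sym, of u v w] 
    by (simp flip: linear_add[OF g_lin1[OF x]] add: linear_0[OF g_lin1[OF x]])
  have "R u v w z = R w z u v"
    using 1 2 3[of u v w z] 3[of v w z u] 3[of w z u v] 3[of z u v w] by smt
  then show ?thesis by (simp add: R_def)
qed

end

section \<open>Torsion at a point\<close>

context su3_frame begin

lemma g_add: "g (x + y) z = g x z + g y z" "g x (y + z) = g x y + g x z"
  by (simp_all add: kappa_Jf e_simps algebra_simps sum.distrib)

lemma g_cmul: "g (c *\<^sub>R x) z = c * g x z" "g x (c *\<^sub>R z) = c * g x z"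
  by (simp_all add: kappa_Jf e_simps algebra_simps sum_distrib_left)

lemma linear_g: "linear (\<lambda>x. g x y)" "linear (\<lambda>y. g x y)"
  by (rule linearI; simp add: g_add g_cmul)+

lemma g_JJ: "g (Jf x) (Jf y) = g x y"
  by (simp add: kappa_Jf sum_6 e_Jf)

lemma g_pos: "v \<noteq> 0 \<Longrightarrow> g v v > 0"
proof -
  assume "v \<noteq> 0"
  then obtain i where "e i v \<noteq> 0" using e_ext[of v 0] by (auto simp: e_simps)
  then show ?thesis unfolding kappa_Jf
    by (intro sum_pos2[where i=i]) (auto simp: zero_less_mult_iff)
qed

lemma g_ext: "(\<And>w. g v w = g v' w) \<Longrightarrow> v = v'"
  by (rule e_ext) (simp flip: g_b)

lemma Omega_skew: "\<Omega> [x, y, z] = - \<Omega> [y, x, z]" "\<Omega> [x, y, z] = - \<Omega> [x, z, y]"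
  by (simp_all add: Omega_e')

lemma linear_eq_on_b:
  assumes "linear f" "linear h" "\<And>i. f (b i) = h (b i)"
  shows "f v = h v"
proof -
  have "f (\<Sum>i\<in>UNIV. e i v *\<^sub>R b i) = h (\<Sum>i\<in>UNIV. e i v *\<^sub>R b i)"
    by (simp add: linear_sum linear_cmul assms)
  then show ?thesis by (simp flip: expand)
qed

lemma sum_frame_J:
  fixes h :: "real^6 \<Rightarrow> real^6 \<Rightarrow> real"
  assumes "\<And>y. linear (\<lambda>x. h x y)" "\<And>x. linear (\<lambda>y. h x y)"
  shows "(\<Sum>i\<in>UNIV. h (Jf (b i)) (Jf (b i))) = (\<Sum>i\<in>UNIV. h (b i) (b i))"
  by (simp add: sum_6 Jf_b linear_neg[OF assms(1)] linear_neg[OF assms(2)])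

end

lemma (in su3_frame) trace_matrix_frame:
  assumes "linear f" shows "trace (matrix f) = (\<Sum>i\<in>UNIV. e i (f (b i)))"
proof -
  have 1: "f (axis a 1) = (\<Sum>i\<in>UNIV. e i (axis a 1) *\<^sub>R f (b i))" for a
    using arg_cong[OF expand[of "axis a 1"], of f] by (simp add: linear_sum[OF assms] linear_cmul[OF assms])
  have 2: "e i w = (\<Sum>a\<in>UNIV. w $ a * e i (axis a 1))" for i w
    using linear_family_expand[OF linear_e[of i], of w] by simp
  have "trace (matrix f) = (\<Sum>a\<in>UNIV. \<Sum>i\<in>UNIV. e i (axis a 1) * f (b i) $ a)"
    unfolding trace_def matrix_def by (simp add: 1 sum_component)
  also have "\<dots> = (\<Sum>i\<in>UNIV. \<Sum>a\<in>UNIV. f (b i) $ a * e i (axis a 1))"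
    by (subst sum.swap) (simp add: mult.commute)
  finally show ?thesis by (simp flip: 2)
qed

text \<open>A skew endomorphism \<open>M\<close> may be moved to the other factor of the inverse metric \<open>\<Sum>\<^sub>i b\<^sub>i \<otimes> b\<^sub>i\<close> at the price of a sign.\<close>

lemma (in su3_frame) sum_frame_skew:
  fixes h :: "real^6 \<Rightarrow> real^6 \<Rightarrow> real"
  assumes h: "\<And>y. linear (\<lambda>x. h x y)" "\<And>x. linear (\<lambda>y. h x y)"
    and M: "\<And>x y. g (M x) y = - g x (M y)"
  shows "(\<Sum>i\<in>UNIV. h (M (b i)) (b i)) = - (\<Sum>i\<in>UNIV. h (b i) (M (b i)))"
proof -
  have m: "e j (M (b i)) = - e i (M (b j))" for i j
    using M[of "b i" "b j"] g_sym[of "b i"] by (simp add: g_b)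
  have 1: "h (M (b i)) (b i) = (\<Sum>j\<in>UNIV. e j (M (b i)) * h (b j) (b i))" for i
    using arg_cong[OF expand[of "M (b i)"], of "\<lambda>x. h x (b i)"] by (simp add: linear_sum[OF h(1)] linear_cmul[OF h(1)])
  have 2: "h (b j) (M (b j)) = (\<Sum>i\<in>UNIV. e i (M (b j)) * h (b j) (b i))" for j
    using arg_cong[OF expand[of "M (b j)"], of "\<lambda>x. h (b j) x"] by (simp add: linear_sum[OF h(2)] linear_cmul[OF h(2)])
  have "(\<Sum>i\<in>UNIV. h (M (b i)) (b i)) = (\<Sum>j\<in>UNIV. \<Sum>i\<in>UNIV. e j (M (b i)) * h (b j) (b i))"
    unfolding 1 by (rule sum.swap)
  also have "\<dots> = - (\<Sum>i\<in>UNIV. h (b i) (M (b i)))"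
    unfolding 2 by (subst m) (simp add: sum_negf)
  finally show ?thesis .
qed

lemma (in su3_frame) g_norm: "g x x = (\<Sum>k\<in>UNIV. (e k x)^2)"
  by (simp add: kappa_Jf power2_eq_square)

text \<open>The numbers are the entries of a Hermitian matrix \<open>H\<close> with diagonal \<open>x1, x2, x3\<close> and
\<open>H\<^sub>1\<^sub>2 = p + ip'\<close>, \<open>H\<^sub>1\<^sub>3 = r + ir'\<close>, \<open>H\<^sub>2\<^sub>3 = s + is'\<close>. The hypotheses say that \<open>H\<close> is trace-free and
\<open>H\<^sup>2 = \<mu>\<close>. Three numbers \<open>\<plusminus>\<surd>\<mu>\<close> only add up to zero if \<open>\<mu> = 0\<close>. The computation avoids eigenvalues: \<open>D\<close> is
the real part of \<open>H\<^sub>1\<^sub>2 H\<^sub>2\<^sub>3 H\<^sub>3\<^sub>1\<close>, and \<open>tr H\<^sup>3 = \<mu> tr H = 0\<close> gives \<open>D = x1 x2 x3\<close>.\<close>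

lemma hermitian_traceless_square:
  fixes x1 x2 x3 p p' r r' s s' \<mu> :: real
  assumes tr: "x1 + x2 + x3 = 0"
    and d: "x1^2 + (p^2 + p'^2) + (r^2 + r'^2) = \<mu>" "x2^2 + (p^2 + p'^2) + (s^2 + s'^2) = \<mu>"
      "x3^2 + (r^2 + r'^2) + (s^2 + s'^2) = \<mu>"
    and o: "x3 * p = r * s + r' * s'" "x3 * p' = r' * s - r * s'" "x2 * r = p * s - p' * s'"
      "x2 * r' = p * s' + p' * s" "x1 * s = p * r + p' * r'" "x1 * s' = p * r' - p' * r"
  shows "\<mu> = 0"
proof -
  define P R S where "P = p^2 + p'^2" and "R = r^2 + r'^2" and "S = s^2 + s'^2"
  define D where "D = p * r * s + p * r' * s' + p' * r' * s - p' * r * s'"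
  have nn: "P \<ge> 0" "R \<ge> 0" "S \<ge> 0" by (auto simp: P_def R_def S_def)
  have D: "x3 * P = D" "x2 * R = D" "x1 * S = D" unfolding P_def R_def S_def D_def using o by algebra+
  have RS: "x3^2 * P = R * S" unfolding P_def R_def S_def using o(1,2) by algebra
  have d': "x1^2 + P + R = \<mu>" "x2^2 + P + S = \<mu>" "x3^2 + R + S = \<mu>" using d by (auto simp: P_def R_def S_def)
  have x3: "x3 = - x1 - x2" using tr by simp
  have "D = x1 * x2 * x3"
  proof -
    have "x1 * (x1^2 + P + R) + x2 * (x2^2 + P + S) + x3 * (x3^2 + R + S) = 0"
      unfolding d' using tr by (simp flip: distrib_right)
    moreover have "x1 * (x1^2 + P + R) + x2 * (x2^2 + P + S) + x3 * (x3^2 + R + S)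
      = 3 * (x1 * x2 * x3) - x3 * P - x2 * R - x1 * S" unfolding x3 by algebra
    ultimately show ?thesis using D by simp
  qed
  note D3 = this
  show ?thesis
  proof (cases "x1 = 0 \<or> x2 = 0 \<or> x3 = 0")
    case False
    then have "P = x1 * x2" "R = x1 * x3" "S = x2 * x3" using D D3 by (auto simp: mult.assoc mult.left_commute)
    then have nonneg: "0 \<le> x1 * x2 + x1 * x3 + x2 * x3" using nn by simp
    have "x1 * x2 + x1 * x3 + x2 * x3 = - ((x1^2 + x2^2 + x3^2) / 2)"
      unfolding x3 by (simp add: power2_eq_square algebra_simps)
    also have "\<dots> < 0" using False by (simp add: add_pos_pos)
    finally show ?thesis using leD[OF nonneg] by contradiction
  next
    case True
    then have z: "x3 * P = 0" "x2 * R = 0" "x1 * S = 0" using D D3 by auto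
    have "x3^2 * P = 0" using z(1) by simp
    then have RS0: "R * S = 0" using RS by simp
    show ?thesis
    proof (cases "x1 = 0 \<and> x2 = 0 \<and> x3 = 0")
      case True then show ?thesis using d' RS0 by auto
    next
      case False
      then have "(x1 = 0 \<and> x2 \<noteq> 0 \<and> x3 \<noteq> 0) \<or> (x2 = 0 \<and> x1 \<noteq> 0 \<and> x3 \<noteq> 0) \<or> (x3 = 0 \<and> x1 \<noteq> 0 \<and> x2 \<noteq> 0)"
        using True tr by auto
      then show ?thesis using z d' by auto
    qed
  qed
qed

text \<open>The algebraic properties of \<open>A u = \<nabla>\<^sub>u J\<close> at one point: \<open>A_skew\<close> and \<open>A_J\<close> hold for every
almost Hermitian structure, \<open>A_cyc\<close> is \<open>d\<kappa> = 0\<close>.\<close>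

locale torsion_algebra = su3_frame +
  fixes A :: "real^6 \<Rightarrow> real^6 \<Rightarrow> real^6"
  assumes A_lin: "\<And>v. linear (\<lambda>u. A u v)" "\<And>u. linear (\<lambda>v. A u v)"
    and A_skew: "\<And>u v w. g (A u v) w = - g v (A u w)"
    and A_J: "\<And>u v. A u (Jf v) = - Jf (A u v)"
    and A_cyc: "\<And>u v w. g (A u v) w + g (A v w) u + g (A w u) v = 0"
begin

text \<open>The defect \<open>F\<close> is alternating by the cyclic identity, and \<open>J\<close> may be moved between its last two arguments,
hence between any two. But \<open>J\<close> changes the sign of \<open>F\<close> when it is moved from the first argument to the
second, so \<open>F = 0\<close>.\<close>

lemma A_Jdir: "A (Jf u) v = A u (Jf v)"
proof (rule g_ext)
  fix w
  define T where "T u v w = g (A u v) w" for u v w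
  have s: "T u v w = - T u w v" for u v w using A_skew[of u v w] g_sym[of v] by (simp add: T_def)
  have j: "T u (Jf v) w = T u v (Jf w)" for u v w by (simp add: T_def A_J g_J_skew linear_neg[OF linear_g(1)])
  have c: "T u v w + T v w u + T w u v = 0" for u v w using A_cyc by (simp add: T_def)
  have m: "T (- u) v w = - T u v w" "T u (- v) w = - T u v w" "T u v (- w) = - T u v w" for u v w
    by (simp_all add: T_def linear_neg[OF A_lin(1)] linear_neg[OF A_lin(2)] linear_neg[OF linear_g(1)] linear_neg[OF linear_g(2)])
  define F where "F u v w = T (Jf u) v w - T u (Jf v) w" for u v w
  have cycF: "F u v w = F v w u" for u v w
    using c[of "Jf u" v w] c[of u "Jf v" w] j[of v w u] s[of w "Jf u" v] s[of w u "Jf v"] j[of w u v]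
     s[of v "Jf w" u] unfolding F_def by simp
  have FJ: "F u (Jf v) w = F u v (Jf w)" for u v w
    unfolding F_def using j[of "Jf u" v w] j[of u "Jf v" w] by simp
  have anti: "F (Jf u) v w = - F u (Jf v) w" for u v w
    unfolding F_def by (simp add: Jf_Jf m)
  have "F u (Jf v) w = 0" for u v w
    using anti[of u v w] cycF[of "Jf u" v w] FJ[of v w u] cycF[of u v "Jf w"] FJ[of u v w] by linarith
  from this[of u "Jf v" w] show "T (Jf u) v w = T u (Jf v) w" unfolding F_def by (simp add: Jf_Jf linear_neg[OF linear_Jf] m)
qed

text \<open>The endomorphism \<open>a\<close> with \<open>A\<^sub>u w = a(u) \<times> w\<close>, whose components are read off \<open>A\<^sub>u b\<^sub>1\<close> and \<open>A\<^sub>u b\<^sub>3\<close>.\<close>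

definition tor :: "real^6 \<Rightarrow> real^6" where
  "tor u = e 5 (A u (b 3)) *\<^sub>R b 1 - e 6 (A u (b 3)) *\<^sub>R b 2 - e 5 (A u (b 1)) *\<^sub>R b 3 + e 6 (A u (b 1)) *\<^sub>R b 4
     + e 3 (A u (b 1)) *\<^sub>R b 5 - e 4 (A u (b 1)) *\<^sub>R b 6"

lemma A_b_even: "A u (b 2) = - Jf (A u (b 1))" "A u (b 4) = - Jf (A u (b 3))" "A u (b 6) = - Jf (A u (b 5))"
  using A_J[of u] Jf_b by metis+

text \<open>The matrix of \<open>A\<^sub>u\<close> is skew and anticommutes with \<open>J\<close>, which leaves six free entries, the
components of \<open>a(u)\<close>.\<close>

lemma A_tor: "g (A u v) w = \<Omega> [tor u, v, w]"
proof -
  have sk: "e j (A u (b i)) = - e i (A u (b j))" for i j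
    using A_skew[of u "b i" "b j"] g_sym[of "b i"] by (simp add: g_b)
  have z: "e i (A u (b i)) = 0" for i using sk[of i i] by simp
  note s = sk[of 1 2] sk[of 1 3] sk[of 1 4] sk[of 1 5] sk[of 1 6] sk[of 2 3] sk[of 2 4] sk[of 2 5] sk[of 2 6]
    sk[of 3 4] sk[of 3 5] sk[of 3 6] sk[of 4 5] sk[of 4 6] sk[of 5 6] z[of 1] z[of 2] z[of 3] z[of 4] z[of 5] z[of 6]
  have "\<forall>i j. e j (A u (b i)) = \<Omega> [tor u, b i, b j]"
    using s
    by (simp add: forall_6 Omega_bb tor_def e_simps e_b A_b_even e_Jf)
  then have e: "g (A u (b i)) (b j) = \<Omega> [tor u, b i, b j]" for i j by (simp add: g_b)
  have 1: "g (A u (b i)) w = \<Omega> [tor u, b i, w]" for i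
    by (rule linear_eq_on_b[OF linear_g(2) linear_Omega(3) e])
  have "linear (\<lambda>v. g (A u v) w)" using linear_compose[OF A_lin(2) linear_g(1)] by (simp add: o_def)
  then show ?thesis using linear_eq_on_b[OF _ linear_Omega(2) 1] by blast
qed

lemma e_A: "e i (A u v) = \<Omega> [tor u, v, b i]"
  using A_tor[of u v "b i"] by (simp add: g_b)

lemma tor_J: "tor (Jf u) = Jf (tor u)"
  by (rule e_ext6) (simp_all add: tor_def e_simps e_b A_Jdir A_J e_Jf)

lemma tor_even: "tor (b 2) = Jf (tor (b 1))" "tor (b 4) = Jf (tor (b 3))" "tor (b 6) = Jf (tor (b 5))"
  using tor_J Jf_b by metis+

end

text \<open>Here \<open>\<Phi> u\<close> is the derivative of \<open>\<Omega>\<close> in direction \<open>u\<close> along the Hermitian connection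
\<open>\<nabla> - \<onehalf> J\<nabla>J\<close>. The last hypothesis is \<open>d\<Omega> = 0\<close>: a torsion-free connection computes the exterior
derivative, and the Hermitian connection differs from one by \<open>\<onehalf> J A\<close>.\<close>

locale closed_torsion_algebra = torsion_algebra +
  fixes \<Phi> :: "real^6 \<Rightarrow> real^6 \<Rightarrow> real^6 \<Rightarrow> real^6 \<Rightarrow> real"
  assumes \<Phi>_lin: "\<And>u y z. linear (\<lambda>x. \<Phi> u x y z)" "\<And>u x z. linear (\<lambda>y. \<Phi> u x y z)" "\<And>u x y. linear (\<lambda>z. \<Phi> u x y z)"
      "\<And>x y z. linear (\<lambda>u. \<Phi> u x y z)"
    and \<Phi>_skew: "\<And>u x y z. \<Phi> u x y z = - \<Phi> u y x z" "\<And>u x y z. \<Phi> u x y z = - \<Phi> u x z y"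
    and \<Phi>_J: "\<And>u x y z. \<Phi> u (Jf x) y z = \<Phi> u x (Jf y) z"
    and \<Phi>_135: "\<And>u. \<Phi> u (b 1) (b 3) (b 5) = 0"
    and closed: "\<And>u x y z. (\<Phi> u x y z - (\<Omega> [Jf (A u x), y, z] - \<Omega> [Jf (A u y), x, z] + \<Omega> [Jf (A u z), x, y]) / 2)
       - (\<Phi> x u y z - (\<Omega> [Jf (A x u), y, z] - \<Omega> [Jf (A x y), u, z] + \<Omega> [Jf (A x z), u, y]) / 2)
       + (\<Phi> y u x z - (\<Omega> [Jf (A y u), x, z] - \<Omega> [Jf (A y x), u, z] + \<Omega> [Jf (A y z), u, x]) / 2)
       - (\<Phi> z u x y - (\<Omega> [Jf (A z u), x, y] - \<Omega> [Jf (A z x), u, y] + \<Omega> [Jf (A z y), u, x]) / 2) = 0"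
begin

lemma \<Phi>_J': "\<Phi> u x (Jf y) z = \<Phi> u (Jf x) y z" "\<Phi> u x y (Jf z) = \<Phi> u (Jf x) y z"
proof -
  show "\<Phi> u x (Jf y) z = \<Phi> u (Jf x) y z" using \<Phi>_J by simp
  show "\<Phi> u x y (Jf z) = \<Phi> u (Jf x) y z"
    using \<Phi>_skew(1)[of u x y "Jf z"] \<Phi>_skew(2)[of u y x "Jf z"] \<Phi>_J[of u y z x] \<Phi>_skew(1)[of u "Jf y" z x]
     \<Phi>_skew(2)[of u y z "Jf x"] \<Phi>_skew(1)[of u "Jf x" y z]  \<Phi>_J[of u z y x] \<Phi>_J[of u x y z] \<Phi>_J[of u y x z] \<Phi>_skew
    by metis
qed

text \<open>A 3-form between whose arguments \<open>J\<close> may be moved is the real part of a complex multiple of the complex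
volume form. Its component along \<open>\<Omega>\<close> itself is the value at \<open>b\<^sub>1, b\<^sub>3, b\<^sub>5\<close>, which is zero.\<close>

lemma \<Phi>_Omega: "\<Phi> u x y z = - \<Phi> u (b 2) (b 3) (b 5) * \<Omega> [Jf x, y, z]"
proof -
  let ?q = "- \<Phi> u (b 2) (b 3) (b 5)"
  have rep: "\<Phi> u x x z = 0" "\<Phi> u x z z = 0" "\<Phi> u x z x = 0" for x z
    using \<Phi>_skew(1)[of u x x z] \<Phi>_skew(2)[of u x z z] \<Phi>_skew(1)[of u x z x] \<Phi>_skew(2)[of u z x x] by simp_all
  have repJ: "\<Phi> u (Jf x) x z = 0" "\<Phi> u (Jf x) z z = 0" "\<Phi> u (Jf x) z x = 0" for x z
    using \<Phi>_J[of u x x z] \<Phi>_skew(1)[of u x "Jf x" z] rep(2)[of "Jf x" z] \<Phi>_J[of u x z x] \<Phi>_skew(2)[of u x "Jf z" x]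
      \<Phi>_J'(2)[of u x z x] \<Phi>_skew(2)[of u x z "Jf x"] \<Phi>_J[of u x x z] rep by (metis neg_equal_zero)+
  have ev: "b 2 = Jf (b 1)" "b 4 = Jf (b 3)" "b 6 = Jf (b 5)" by (simp_all add: Jf_b)
  have neg: "\<Phi> u (- x) y z = - \<Phi> u x y z" for x y z using linear_neg[OF \<Phi>_lin(1)] .
  note p = \<Phi>_skew(1)[of u "b 3" "b 1" "b 5"] \<Phi>_skew(2)[of u "b 1" "b 5" "b 3"]
    \<Phi>_skew(2)[of u "b 3" "b 5" "b 1"] \<Phi>_skew(1)[of u "b 5" "b 1" "b 3"] \<Phi>_skew(1)[of u "b 5" "b 3" "b 1"] \<Phi>_135[of u]
  have p': "\<Phi> u (Jf (b 1)) (b 5) (b 3) = - \<Phi> u (Jf (b 1)) (b 3) (b 5)"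
     "\<Phi> u (Jf (b 3)) (b 1) (b 5) = - \<Phi> u (Jf (b 1)) (b 3) (b 5)"
     "\<Phi> u (Jf (b 3)) (b 5) (b 1) = \<Phi> u (Jf (b 1)) (b 3) (b 5)"
     "\<Phi> u (Jf (b 5)) (b 1) (b 3) = \<Phi> u (Jf (b 1)) (b 3) (b 5)"
     "\<Phi> u (Jf (b 5)) (b 3) (b 1) = - \<Phi> u (Jf (b 1)) (b 3) (b 5)"
    using \<Phi>_skew(2)[of u "Jf (b 1)" "b 5" "b 3"] \<Phi>_J[of u "b 3" "b 1" "b 5"] \<Phi>_skew(1)[of u "b 3" "Jf (b 1)" "b 5"]
     \<Phi>_skew(2)[of u "Jf (b 3)" "b 5" "b 1"] \<Phi>_J'(2)[of u "b 1" "b 3" "b 5"] \<Phi>_skew(2)[of u "b 1" "b 3" "Jf (b 5)"]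
     \<Phi>_skew(1)[of u "b 1" "Jf (b 5)" "b 3"] \<Phi>_skew(2)[of u "Jf (b 5)" "b 3" "b 1"] by simp_all
  have "\<forall>i j k. \<Phi> u (b i) (b j) (b k) = ?q * \<Omega> [Jf (b i), b j, b k]"
    unfolding forall_6 Omega_bb e_Jf e_b
    unfolding ev \<Phi>_J' Jf_Jf linear_neg[OF linear_Jf] neg
    by (simp add: rep repJ p p')
  then have b: "\<Phi> u (b i) (b j) (b k) = ?q * \<Omega> [Jf (b i), b j, b k]" for i j k by blast
  have l: "linear (\<lambda>x. ?q * \<Omega> [Jf x, y, z])" "linear (\<lambda>y. ?q * \<Omega> [Jf x, y, z])" "linear (\<lambda>z. ?q * \<Omega> [Jf x, y, z])" for x y z
    by (rule linearI; simp add: linear_add[OF linear_Jf] linear_cmul[OF linear_Jf] linear_add[OF linear_Omega(1)] linear_add[OF linear_Omega(2)]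
      linear_add[OF linear_Omega(3)] linear_cmul[OF linear_Omega(1)] linear_cmul[OF linear_Omega(2)] linear_cmul[OF linear_Omega(3)] algebra_simps)+
  have 1: "\<Phi> u (b i) (b j) z = ?q * \<Omega> [Jf (b i), b j, z]" for i j
    by (rule linear_eq_on_b[OF \<Phi>_lin(3) l(3) b])
  have 2: "\<Phi> u (b i) y z = ?q * \<Omega> [Jf (b i), y, z]" for i
    by (rule linear_eq_on_b[OF \<Phi>_lin(2) l(2) 1])
  show ?thesis
    by (rule linear_eq_on_b[OF \<Phi>_lin(1) l(1) 2])
qed

text \<open>Solving \<open>d\<Omega> = 0\<close>. Its fifteen components and two components of \<open>d\<kappa> = 0\<close> form a linear system for the
eighteen real entries of the complex matrix \<open>a\<close> and for the six numbers \<open>q\<close> that describe \<open>\<Phi>\<close>. The solutions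
are \<open>q = 0\<close> together with the trace-free Hermitian matrices.\<close>

lemma torsion_relations:
  shows "e 1 (tor (b 1)) + e 3 (tor (b 3)) + e 5 (tor (b 5)) = 0"
    and "e 2 (tor (b 1)) = 0" "e 4 (tor (b 3)) = 0" "e 6 (tor (b 5)) = 0"
    and "e 1 (tor (b 3)) = e 3 (tor (b 1))" "e 2 (tor (b 3)) = - e 4 (tor (b 1))"
    and "e 1 (tor (b 5)) = e 5 (tor (b 1))" "e 2 (tor (b 5)) = - e 6 (tor (b 1))"
    and "e 3 (tor (b 5)) = e 5 (tor (b 3))" "e 4 (tor (b 5)) = - e 6 (tor (b 3))"
    and "\<Phi> (b k) (b 2) (b 3) (b 5) = 0"
proof -
  define q where "q k = \<Phi> (b k) (b 2) (b 3) (b 5)" for k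
  have P: "\<Phi> (b k) x y z = - q k * \<Omega> [Jf x, y, z]" for k x y z
    unfolding q_def by (rule \<Phi>_Omega)
  note C = A_cyc[unfolded A_tor]
  have cl: "- q i * \<Omega> [Jf (b j), b k, b l] + q j * \<Omega> [Jf (b i), b k, b l] - q k * \<Omega> [Jf (b i), b j, b l] + q l * \<Omega> [Jf (b i), b j, b k]
     = ((\<Omega> [Jf (A (b i) (b j)), b k, b l] - \<Omega> [Jf (A (b i) (b k)), b j, b l] + \<Omega> [Jf (A (b i) (b l)), b j, b k]) 
       - (\<Omega> [Jf (A (b j) (b i)), b k, b l] - \<Omega> [Jf (A (b j) (b k)), b i, b l] + \<Omega> [Jf (A (b j) (b l)), b i, b k]) 
       + (\<Omega> [Jf (A (b k) (b i)), b j, b l] - \<Omega> [Jf (A (b k) (b j)), b i, b l] + \<Omega> [Jf (A (b k) (b l)), b i, b j]) 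
       - (\<Omega> [Jf (A (b l) (b i)), b j, b k] - \<Omega> [Jf (A (b l) (b j)), b i, b k] + \<Omega> [Jf (A (b l) (b k)), b i, b j])) / 2" for i j k l
    using closed[of "b i" "b j" "b k" "b l"] unfolding P by (simp add: field_simps)
  \<comment> \<open>once the cross products of frame vectors are tabulated, these are linear equations in real unknowns\<close>
  note eqs = cl[of 1 2 3 4] cl[of 1 2 3 5] cl[of 1 2 3 6] cl[of 1 2 4 5] cl[of 1 2 4 6] cl[of 1 2 5 6]
    cl[of 1 3 4 5] cl[of 1 3 4 6] cl[of 1 3 5 6] cl[of 1 4 5 6] cl[of 2 3 4 5] cl[of 2 3 4 6] cl[of 2 3 5 6] cl[of 2 4 5 6] cl[of 3 4 5 6]
    C[of "b 1" "b 3" "b 5"] C[of "b 1" "b 3" "b 6"]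
  note eqs' = eqs[unfolded Omega_bb tor_even e_Jf e_A, unfolded Omega_bb tor_even e_Jf e_b, simplified]
  show "e 1 (tor (b 1)) + e 3 (tor (b 3)) + e 5 (tor (b 5)) = 0"
    "e 2 (tor (b 1)) = 0" "e 4 (tor (b 3)) = 0" "e 6 (tor (b 5)) = 0"
    "e 1 (tor (b 3)) = e 3 (tor (b 1))" "e 2 (tor (b 3)) = - e 4 (tor (b 1))"
    "e 1 (tor (b 5)) = e 5 (tor (b 1))" "e 2 (tor (b 5)) = - e 6 (tor (b 1))"
    "e 3 (tor (b 5)) = e 5 (tor (b 3))" "e 4 (tor (b 5)) = - e 6 (tor (b 3))"
    using eqs' by linarith+
  have "q 1 = 0" "q 2 = 0" "q 3 = 0" "q 4 = 0" "q 5 = 0" "q 6 = 0"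
    using eqs' by linarith+
  then have "\<forall>k. q k = 0" by (simp add: forall_6)
  then show "\<Phi> (b k) (b 2) (b 3) (b 5) = 0" by (simp add: q_def)
qed

lemma \<Phi>_zero: "\<Phi> u x y z = 0"
proof -
  have "\<Phi> (b k) x y z = 0" for k
    by (rule trans[OF \<Phi>_Omega]) (simp add: torsion_relations(11))
  then show ?thesis
    using linear_eq_on_b[OF \<Phi>_lin(4) linear_zero, of x y z u] by simp
qed


lemma linear_tor: "linear tor"
  by (rule linearI; rule e_ext6; simp add: tor_def e_simps e_b linear_add[OF A_lin(1)] linear_cmul[OF A_lin(1)])

lemma tor_sym: "g (tor x) y = g x (tor y)"
proof -
  have "\<forall>i j. e j (tor (b i)) = e i (tor (b j))"
    unfolding forall_6 tor_even e_Jf by (simp add: torsion_relations)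
  then have b: "g (tor (b i)) (b j) = g (b i) (tor (b j))" for i j
    using g_sym[of "b i"] by (simp add: g_b)
  have l: "linear (\<lambda>x. g (tor x) y)" "linear (\<lambda>y. g x (tor y))" for x y
    using linear_compose[OF linear_tor linear_g(1)] linear_compose[OF linear_tor linear_g(2)] by (simp_all add: o_def)
  have 1: "g (tor (b i)) y = g (b i) (tor y)" for i
    by (rule linear_eq_on_b[OF linear_g(2) l(2) b])
  show ?thesis by (rule linear_eq_on_b[OF l(1) linear_g(1) 1])
qed

text \<open>The next two lemmas sum \<open>|a(u) \<times> v|\<^sup>2\<close> over an orthonormal frame, in \<open>v\<close> and in \<open>u\<close> respectively.\<close>

lemma norm_A_dir: "(\<Sum>i\<in>UNIV. g (A x (b i)) (A x (b i))) = 4 * g (tor x) (tor x)"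
  unfolding g_norm e_A by (simp add: sum_6 Omega_bb)

lemma norm_A_arg: "(\<Sum>i\<in>UNIV. g (A (b i) x) (A (b i) x)) = (\<Sum>i\<in>UNIV. g (tor (b i)) (tor (b i))) * g x x - 2 * g (tor x) (tor x)"
proof -
  have "g (A (b i) x) (A (b i) x) = g (tor (b i)) (tor (b i)) * g x x - (e i (tor x))^2 - (e i (tor (Jf x)))^2" for i
  proof -
    have "g (tor (b i)) x = e i (tor x)" unfolding tor_sym using g_sym[of "b i"] by (simp add: g_b)
    moreover have "g (Jf (tor (b i))) x = - e i (tor (Jf x))"
      unfolding g_J_skew tor_sym using g_sym[of "b i"] by (simp add: g_b)
    ultimately show ?thesis
      using cross_norm[of "tor (b i)" x] unfolding g_norm[of "A (b i) x"] e_A by simp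
  qed
  then have "(\<Sum>i\<in>UNIV. g (A (b i) x) (A (b i) x)) = (\<Sum>i\<in>UNIV. g (tor (b i)) (tor (b i))) * g x x
      - g (tor x) (tor x) - g (tor (Jf x)) (tor (Jf x))"
    by (simp add: sum_subtractf sum_distrib_right flip: g_norm)
  then show ?thesis by (simp add: tor_J g_JJ)
qed

text \<open>By the two norms above the hypothesis says that \<open>|a x|\<^sup>2\<close> is a constant multiple of \<open>|x|\<^sup>2\<close>, so the
square of the trace-free Hermitian matrix \<open>a\<close> is scalar.\<close>

lemma torsion_free_if_pinched:
  assumes "\<And>x. (\<Sum>i\<in>UNIV. g (A x (b i)) (A x (b i))) / 2 - (\<Sum>i\<in>UNIV. g (A (b i) x) (A (b i) x)) = c * g x x"
  shows "A u v = 0"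
proof -
  \<comment> \<open>\<open>4 |a x|\<^sup>2 - |a|\<^sup>2 |x|\<^sup>2 = c |x|\<^sup>2\<close>\<close>
  define \<mu> where "\<mu> = (c + (\<Sum>i\<in>UNIV. g (tor (b i)) (tor (b i)))) / 4"
  have n: "g (tor x) (tor x) = \<mu> * g x x" for x
    using assms[of x] unfolding norm_A_dir norm_A_arg \<mu>_def by (simp add: field_simps)
  have pol: "g (tor x) (tor y) = \<mu> * g x y" for x y
    using n[of "x + y"] n[of x] n[of y] g_sym[of "tor y" "tor x"] g_sym[of y x]
    by (simp add: linear_add[OF linear_tor] g_add algebra_simps)
  note eqs = pol[of "b 1" "b 1"] pol[of "b 3" "b 3"] pol[of "b 5" "b 5"] pol[of "b 1" "b 3"] pol[of "b 1" "b 4"]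
     pol[of "b 1" "b 5"] pol[of "b 1" "b 6"] pol[of "b 3" "b 5"] pol[of "b 3" "b 6"]
  define x1 x2 x3 p p' r r' s s' where v: "x1 = e 1 (tor (b 1))" "x2 = e 3 (tor (b 3))" "x3 = e 5 (tor (b 5))"
    "p = e 3 (tor (b 1))" "p' = e 4 (tor (b 1))" "r = e 5 (tor (b 1))" "r' = e 6 (tor (b 1))"
    "s = e 5 (tor (b 3))" "s' = e 6 (tor (b 3))"
  have tr: "x1 + x2 + x3 = 0" using torsion_relations(1) by (simp add: v)
  note eqs' = eqs[unfolded tor_even kappa_Jf sum_6 e_Jf torsion_relations(2-10), folded v, unfolded e_b, simplified]
  have \<mu>: "\<mu> = 0"
  proof (rule hermitian_traceless_square[OF tr])
    show "x1^2 + (p^2 + p'^2) + (r^2 + r'^2) = \<mu>" "x2^2 + (p^2 + p'^2) + (s^2 + s'^2) = \<mu>"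
      "x3^2 + (r^2 + r'^2) + (s^2 + s'^2) = \<mu>"
      using eqs'(1-3) by (simp_all add: power2_eq_square)
    show "x3 * p = r * s + r' * s'" "x3 * p' = r' * s - r * s'" "x2 * r = p * s - p' * s'"
      "x2 * r' = p * s' + p' * s" "x1 * s = p * r + p' * r'" "x1 * s' = p * r' - p' * r"
      using eqs'(4-9) tr by algebra+
  qed
  then have "tor x = 0" for x using n[of x] g_pos by fastforce
  then have "g (A u v) w = g 0 w" for w
    by (simp add: A_tor linear_0[OF linear_Omega(1)] linear_0[OF linear_g(1)])
  then show ?thesis using g_ext by blast
qed

end

section \<open>Curvature at a point\<close>

text \<open>Second order data at one point: \<open>B u v\<close> is the second covariant derivative of \<open>J\<close>, \<open>R\<close> the curvature of
\<open>\<nabla>\<close>, and \<open>R'\<close> the curvature of the Hermitian connection. The hypotheses on \<open>B\<close> are those on \<open>A\<close>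
differentiated once more, \<open>B_comm\<close> is the Ricci identity, and \<open>R'\<close> annihilates the parallel tensors \<open>g\<close> and
\<open>\<Omega>\<close>.\<close>

locale curvature_algebra = torsion_algebra +
  fixes B R R' :: "real^6 \<Rightarrow> real^6 \<Rightarrow> real^6 \<Rightarrow> real^6"
  assumes B_lin: "\<And>u w. linear (\<lambda>v. B u v w)"
    and B_J: "\<And>u v w. Jf (B u v w) + B u v (Jf w) + A u (A v w) + A v (A u w) = 0"
    and B_skew: "\<And>u v w z. g (B u v w) z = - g w (B u v z)"
    and B_cyc: "\<And>x u v w. g (B x u v) w + g (B x v w) u + g (B x w u) v = 0"
    and B_Jdir: "\<And>u v w. B u (Jf v) w + A (A u v) w = B u v (Jf w) + A v (A u w)"
    and B_comm: "\<And>u v w. B u v w - B v u w = R u v (Jf w) - Jf (R u v w)"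
    and R_antisym: "\<And>u v w. R u v w = - R v u w"
    and R_bianchi: "\<And>u v w. R u v w + R v w u + R w u v = 0"
    and R_lin: "\<And>v w. linear (\<lambda>u. R u v w)"
    and R_skew: "\<And>u v w z. g (R u v w) z = - g w (R u v z)"
    and R_split: "\<And>u v w. R u v w = R' u v w + (1/4) *\<^sub>R (A u (A v w) - A v (A u w)) + (1/2) *\<^sub>R Jf (B u v w - B v u w)"
    and R'_skew: "\<And>u v w z. g (R' u v w) z = - g w (R' u v z)"
    and R'_Omega: "\<And>u v x y z. \<Omega> [R' u v x, y, z] + \<Omega> [x, R' u v y, z] + \<Omega> [x, y, R' u v z] = 0"
begin

definition ric :: "real^6 \<Rightarrow> real^6 \<Rightarrow> real" where "ric v w = (\<Sum>i\<in>UNIV. g (R (b i) v w) (b i))"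

definition star_ric :: "real^6 \<Rightarrow> real^6 \<Rightarrow> real" where "star_ric v w = (\<Sum>i\<in>UNIV. g (R (b i) v w) (Jf (b i)))"

text \<open>Up to a factor, the curvature that \<open>R\<close> induces on the canonical bundle.\<close>

definition canonical_curv :: "real^6 \<Rightarrow> real^6 \<Rightarrow> real" where "canonical_curv u v = (\<Sum>i\<in>UNIV. g (R u v (b i)) (Jf (b i)))"

lemma g_diff: "g (x - y) z = g x z - g y z" "g x (y - z) = g x y - g x z"
  and g_neg: "g (- x) z = - g x z" "g x (- z) = - g x z"
  by (simp_all add: linear_diff[OF linear_g(1)] linear_diff[OF linear_g(2)] linear_neg[OF linear_g(1)] linear_neg[OF linear_g(2)])

text \<open>This is the derivative of the identity \<open>\<Sum>\<^sub>i g(A\<^bsub>b\<^sub>i\<^esub> y, b\<^sub>i) = 0\<close>, that \<open>J\<close> is divergence-free. Replacing the frame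
\<open>b\<^sub>i\<close> by \<open>J b\<^sub>i\<close> does not change the trace, while it changes the sign of \<open>B\<close> up to quadratic terms, and those cancel.\<close>

lemma trace_B: "(\<Sum>i\<in>UNIV. g (B x (b i) y) (b i)) = 0"
proof -
  have B': "B x (Jf v) w = - Jf (B x v w) - A x (A v w) - A (A x v) w" for v w
    using B_Jdir[of x v w] B_J[of x v w] by (simp add: algebra_simps eq_neg_iff_add_eq_0)
  have lB: "linear (\<lambda>v. g (B x v y) z)" "linear (\<lambda>z. g (B x v y) z)" for v z
    using linear_compose[OF B_lin linear_g(1)] linear_g(2) by (simp_all add: o_def)
  have "g (B x (Jf (b i)) y) (Jf (b i)) = - g (B x (b i) y) (b i) - g (A (b i) y) (Jf (A x (b i))) - g (A (A x (b i)) y) (Jf (b i))" for i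
  proof -
    have "g (A x (A (b i) y)) (Jf (b i)) = g (A (b i) y) (Jf (A x (b i)))"
      using A_skew[of x "A (b i) y" "Jf (b i)"] by (simp add: A_J g_neg)
    then show ?thesis unfolding B' by (simp add: g_diff g_neg g_JJ)
  qed
  then have "(\<Sum>i\<in>UNIV. g (B x (Jf (b i)) y) (Jf (b i))) = - (\<Sum>i\<in>UNIV. g (B x (b i) y) (b i))
     - (\<Sum>i\<in>UNIV. g (A (b i) y) (Jf (A x (b i)))) - (\<Sum>i\<in>UNIV. g (A (A x (b i)) y) (Jf (b i)))"
    by (simp add: sum_subtractf sum_negf)
  moreover have "(\<Sum>i\<in>UNIV. g (A (A x (b i)) y) (Jf (b i))) = - (\<Sum>i\<in>UNIV. g (A (b i) y) (Jf (A x (b i))))"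
  proof (rule sum_frame_skew[where h="\<lambda>v w. g (A v y) (Jf w)"])
    show "linear (\<lambda>v. g (A v y) (Jf w))" for w
      using linear_compose[OF A_lin(1) linear_g(1)] by (simp add: o_def)
    show "linear (\<lambda>w. g (A v y) (Jf w))" for v
      using linear_compose[OF linear_Jf linear_g(2)] by (simp add: o_def)
  qed (rule A_skew)
  ultimately show ?thesis using sum_frame_J[of "\<lambda>v z. g (B x v y) z", OF lB] by simp
qed

lemma star_ric_eq: "star_ric x y = - ric x (Jf y) + (\<Sum>i\<in>UNIV. g (B (b i) x y) (b i))"
proof -
  have "g (R (b i) x y) (Jf (b i)) = - g (R (b i) x (Jf y)) (b i) + g (B (b i) x y) (b i) - g (B x (b i) y) (b i)" for i
  proof -
    have "Jf (R (b i) x y) = R (b i) x (Jf y) - B (b i) x y + B x (b i) y"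
      using B_comm[of "b i" x y] by (simp add: algebra_simps)
    then show ?thesis using g_J_skew[of "R (b i) x y" "b i"] by (simp add: g_diff g_add)
  qed
  then show ?thesis
    by (simp add: star_ric_def ric_def sum_subtractf sum.distrib sum_negf trace_B)
qed

text \<open>The first Bianchi identity, traced against \<open>J\<close>.\<close>

lemma canonical_curv_star_ric: "canonical_curv x y = star_ric y x - star_ric x y"
proof -
  have "R x y (b i) = R (b i) y x - R (b i) x y" for i
    using R_bianchi[of x y "b i"] R_antisym[of y "b i" x] by (simp add: algebra_simps eq_neg_iff_add_eq_0)
  then show ?thesis by (simp add: canonical_curv_def star_ric_def g_diff sum_subtractf)
qed

text \<open>A skew endomorphism that annihilates \<open>\<Omega>\<close> has vanishing complex trace; up to a factor, that trace is the
value at \<open>b\<^sub>1, b\<^sub>3, b\<^sub>6\<close> of the form obtained by letting the endomorphism act on \<open>\<Omega>\<close>.\<close>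

lemma canonical_curv_herm: "(\<Sum>i\<in>UNIV. g (R' u v (b i)) (Jf (b i))) = 0"
proof -
  have sk: "e j (R' u v (b i)) = - e i (R' u v (b j))" for i j
    using R'_skew[of u v "b i" "b j"] g_sym[of "b i"] by (simp add: g_b)
  have "\<Omega> [R' u v (b 1), b 3, b 6] - \<Omega> [R' u v (b 3), b 1, b 6] + \<Omega> [R' u v (b 6), b 1, b 3] = 0"
    using R'_Omega[of u v "b 1" "b 3" "b 6"] Omega_skew(1)[of "b 1" "R' u v (b 3)" "b 6"]
      Omega_skew(2)[of "b 1" "b 3" "R' u v (b 6)"] Omega_skew(1)[of "b 1" "R' u v (b 6)" "b 3"] by linarith
  then show ?thesis
    using sk[of 1 2] sk[of 3 4] sk[of 5 6] by (simp add: Omega_bb sum_6 kappa_Jf e_Jf e_b)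
qed

text \<open>\<open>R\<close> and \<open>R'\<close> differ by \<open>J\<close> composed with a skew endomorphism, whose trace against \<open>J\<close> vanishes, and by a
commutator of \<open>A\<close>, which accounts for the right side.\<close>

lemma canonical_curv_J: "canonical_curv x (Jf x) = - (\<Sum>i\<in>UNIV. g (A x (b i)) (A x (b i))) / 2"
proof -
  have "g (R x (Jf x) (b i)) (Jf (b i)) = g (R' x (Jf x) (b i)) (Jf (b i)) - g (A x (b i)) (A x (b i)) / 2" for i
  proof -
    have "g (B u v w) w = 0" for u v w using B_skew[of u v w w] g_sym[of w] by simp
    then have 1: "g (Jf (B x (Jf x) (b i) - B (Jf x) x (b i))) (Jf (b i)) = 0" by (simp add: g_JJ g_diff)
    have "g (A x (A (Jf x) (b i))) (Jf (b i)) = - g (A x (b i)) (A x (b i))"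
      unfolding A_skew[of x "A (Jf x) (b i)"] by (simp add: A_Jdir A_J g_neg g_JJ)
    moreover have "g (A (Jf x) (A x (b i))) (Jf (b i)) = g (A x (b i)) (A x (b i))"
      unfolding A_Jdir A_skew[of x "Jf (A x (b i))"] by (simp add: A_J g_neg g_JJ)
    ultimately show ?thesis unfolding R_split[of x "Jf x" "b i"] g_add g_cmul g_diff 1 by simp
  qed
  then show ?thesis by (simp add: canonical_curv_def sum_subtractf canonical_curv_herm sum_divide_distrib)
qed

text \<open>Differentiating \<open>J\<^sup>2 = -1\<close> twice shows that the part of \<open>B\<close> that commutes with \<open>J\<close> is quadratic in \<open>A\<close>.\<close>

lemma laplacian_J: "g (B u u x) (Jf x) = - g (A u x) (A u x)"
proof -
  have "g (Jf (B u u x) + B u u (Jf x) + A u (A u x) + A u (A u x)) x = 0"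
    unfolding B_J by (rule linear_0[OF linear_g(1)])
  then show ?thesis
    using g_J_skew[of "B u u x" x] B_skew[of u u "Jf x" x] g_sym[of "Jf x" "B u u x"] A_skew[of u "A u x" x]
    unfolding g_add by linarith
qed

text \<open>The canonical curvature is the antisymmetrised star-Ricci form, and by \<open>star_ric_eq\<close> this is the \<open>J\<close>-invariant
Ricci tensor up to a trace of \<open>B\<close>. The derivative of \<open>d\<kappa> = 0\<close> turns that trace into the rough Laplacian
of \<open>J\<close>.\<close>

lemma ricci_J_invariant:
  "ric x x + ric (Jf x) (Jf x) = (\<Sum>i\<in>UNIV. g (A x (b i)) (A x (b i))) / 2 - (\<Sum>i\<in>UNIV. g (A (b i) x) (A (b i) x))"
proof -
  have ev: "ric u (- v) = - ric u v" for u v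
  proof -
    have "R a u (- v) = - R a u v" for a
      by (rule g_ext) (simp add: R_skew[of a u _ ] g_neg)
    then show ?thesis by (simp add: ric_def g_neg sum_negf)
  qed
  have L: "g (B (b i) x (Jf x)) (b i) - g (B (b i) (Jf x) x) (b i) = g (A (b i) x) (A (b i) x)" for i
    using B_cyc[of "b i" x "Jf x" "b i"] B_skew[of "b i" "Jf x" "b i" x] g_sym[of "b i"] laplacian_J[of "b i" x] by simp
  have "canonical_curv x (Jf x) = star_ric (Jf x) x - star_ric x (Jf x)" by (rule canonical_curv_star_ric)
  also have "\<dots> = - ric (Jf x) (Jf x) - ric x x
     - (\<Sum>i\<in>UNIV. g (B (b i) x (Jf x)) (b i) - g (B (b i) (Jf x) x) (b i))"
    by (simp add: star_ric_eq Jf_Jf ev sum_subtractf)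
  finally show ?thesis unfolding L canonical_curv_J by simp
qed

text \<open>For \<open>\<nabla>J = 0\<close> the star-Ricci form is symmetric, since the canonical curvature vanishes, and skew, by the
pair symmetry of the curvature.\<close>

lemma ricci_flat:
  assumes A0: "\<And>u v. A u v = 0" and B0: "\<And>u v w. B u v w = 0"
    and pair: "\<And>u v w z. g (R u v w) z = g (R w z u) v"
  shows "ric x y = 0"
proof -
  have z: "g 0 w = 0" for w using linear_0[OF linear_g(1)] .
  have s: "star_ric x y = - ric x (Jf y)" for x y by (simp add: star_ric_eq B0 z)
  have "R u v w = R' u v w" for u v w by (simp add: R_split[of u v w] A0 B0 linear_0[OF linear_Jf])
  then have "canonical_curv u v = 0" for u v by (simp add: canonical_curv_def canonical_curv_herm)
  then have sym: "star_ric x y = star_ric y x" for x y using canonical_curv_star_ric[of x y] by simp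
  have asym: "star_ric x y = - star_ric y x" for x y
  proof -
    have "star_ric x y = (\<Sum>i\<in>UNIV. g (R (Jf (b i)) y x) (b i))"
      unfolding star_ric_def
    proof (rule sum.cong[OF refl])
      fix i
      show "g (R (b i) x y) (Jf (b i)) = g (R (Jf (b i)) y x) (b i)"
        unfolding pair[of "b i" x y "Jf (b i)"] R_antisym[of y "Jf (b i)"] g_neg R_skew[of "Jf (b i)" y "b i"]
        using g_sym by simp
    qed
    also have "\<dots> = - (\<Sum>i\<in>UNIV. g (R (b i) y x) (Jf (b i)))"
    proof (rule sum_frame_skew[where h="\<lambda>v w. g (R v y x) w", OF _ linear_g(2) g_J_skew])
      show "linear (\<lambda>v. g (R v y x) w)" for w
        using linear_compose[OF R_lin linear_g(1)] by (simp add: o_def)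
    qed
    finally show ?thesis by (simp add: star_ric_def)
  qed
  have "star_ric x y = 0" for x y using sym[of x y] asym[of x y] by simp
  then have "ric x (Jf y) = 0" for y using s by simp
  from this[of "- Jf y"] show ?thesis by (simp add: linear_neg[OF linear_Jf] Jf_Jf)
qed

end

section \<open>SU(3)-structures in a chart\<close>

locale su3_chart =
  fixes U :: "(real^6) set" and \<kappa> \<Omega> :: "real^6 \<Rightarrow> (6, real) tensor"
  assumes open_dom: "open U"
    and smooth_\<kappa>: "\<And>vs. length vs = 2 \<Longrightarrow> smooth_on U (\<lambda>x. \<kappa> x vs)"
    and smooth_\<Omega>: "\<And>vs. length vs = 3 \<Longrightarrow> smooth_on U (\<lambda>x. \<Omega> x vs)"
    and adapted: "\<And>x. x \<in> U \<Longrightarrow> \<exists>e. adapted_coframe (\<kappa> x) (\<Omega> x) e"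
begin

definition J :: "real^6 \<Rightarrow> real^6 \<Rightarrow> real^6" where "J x = induced_J (\<kappa> x) (\<Omega> x)"

definition g :: "real^6 \<Rightarrow> real^6 \<Rightarrow> real^6 \<Rightarrow> real" where "g x u v = \<kappa> x [u, J x v]"

lemma frame_at:
  assumes "x \<in> U"
  obtains e b where "su3_frame (\<kappa> x) (\<Omega> x) e b" "su3_frame.Jf e b = J x"
proof -
  obtain e where e: "adapted_coframe (\<kappa> x) (\<Omega> x) e" using adapted[OF assms] by blast
  then obtain b where b: "dual_frame e b" using dual_frame_exists unfolding adapted_coframe_def by blast
  have f: "su3_frame (\<kappa> x) (\<Omega> x) e b" using e b by (rule su3_frame.intro)
  show thesis using that[OF f] su3_frame.induced_J_eq[OF f] by (simp add: J_def)
qed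

lemma pointwise:
  assumes x: "x \<in> U"
  shows linear_J: "linear (J x)" and J_J: "J x (J x v) = - v"
    and g_lin': "linear (\<lambda>w. g x v w)" and g_sym': "g x v w = g x w v" and g_pos': "v \<noteq> 0 \<Longrightarrow> g x v v > 0"
    and g_J: "g x (J x v) w = - g x v (J x w)" and \<kappa>_g: "\<kappa> x [v, w] = g x (J x v) w"
    and \<kappa>_lin: "linear (\<lambda>v. \<kappa> x [v, w])" "linear (\<lambda>w. \<kappa> x [v, w])"
    and \<kappa>_nondeg: "(\<And>w. \<kappa> x [w, v] = 0) \<Longrightarrow> v = 0"
    and \<Omega>_lin: "linear (\<lambda>a. \<Omega> x [a, c, d])" "linear (\<lambda>c. \<Omega> x [a, c, d])" "linear (\<lambda>d. \<Omega> x [a, c, d])"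
    and \<Omega>_skew: "\<Omega> x [a, c, d] = - \<Omega> x [c, a, d]" "\<Omega> x [a, c, d] = - \<Omega> x [a, d, c]"
    and \<Omega>_J: "\<Omega> x [J x a, c, d] = \<Omega> x [a, J x c, d]"
    and \<Omega>_comass: "(\<Omega> x [a, c, d])^2 \<le> g x a a * g x c c * g x d d"
proof -
  obtain e b where f: "su3_frame (\<kappa> x) (\<Omega> x) e b" and Jx: "su3_frame.Jf e b = J x" using frame_at[OF x] .
  interpret f: su3_frame "\<kappa> x" "\<Omega> x" e b by (rule f)
  note [simp] = Jx
  note gd = g_def[of x]
  show "linear (J x)" using f.linear_Jf by simp
  show "J x (J x v) = - v" using f.Jf_Jf by simp
  show "linear (\<lambda>w. g x v w)" unfolding gd using f.linear_g(2) by simp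
  show "g x v w = g x w v" unfolding gd using f.g_sym by simp
  show "v \<noteq> 0 \<Longrightarrow> g x v v > 0" unfolding gd using f.g_pos by simp
  show "g x (J x v) w = - g x v (J x w)" unfolding gd using f.g_J_skew by simp
  show "\<kappa> x [v, w] = g x (J x v) w" unfolding gd using f.kappa_eq_g[of v w] by simp
  show "linear (\<lambda>v. \<kappa> x [v, w])" "linear (\<lambda>w. \<kappa> x [v, w])"
    by (rule linearI; simp add: f.kappa_e f.e_simps algebra_simps)+
  show "(\<And>w. \<kappa> x [w, v] = 0) \<Longrightarrow> v = 0" by (rule f.kappa_nondeg)
  show "linear (\<lambda>a. \<Omega> x [a, c, d])" "linear (\<lambda>c. \<Omega> x [a, c, d])" "linear (\<lambda>d. \<Omega> x [a, c, d])"
    by (rule f.linear_Omega)+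
  show "\<Omega> x [a, c, d] = - \<Omega> x [c, a, d]" "\<Omega> x [a, c, d] = - \<Omega> x [a, d, c]"
    by (rule f.Omega_skew)+
  show "\<Omega> x [J x a, c, d] = \<Omega> x [a, J x c, d]" using f.Omega_J by simp
  show "(\<Omega> x [a, c, d])^2 \<le> g x a a * g x c c * g x d d" unfolding gd using f.Omega_comass by simp
qed

lemma smooth_g: "smooth_on U (\<lambda>x. g x u v)"
proof -
  define E where "E x = (SOME E. \<forall>w a. \<kappa> x [w, E a] = w $ a)" for x
  have E: "\<kappa> x [w, E x a] = w $ a" if x: "x \<in> U" for x w a
  proof -
    obtain e b where f: "su3_frame (\<kappa> x) (\<Omega> x) e b" using frame_at[OF x] .
    show ?thesis using someI_ex[OF su3_frame.kappa_dual_exists[OF f]] unfolding E_def by blast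
  qed
  have sE: "smooth_on U (\<lambda>x. E x a)" for a
    by (rule smooth_on_solve[where \<beta>="\<lambda>x v w. \<kappa> x [v, w]" and l="\<lambda>x w. w $ a", OF open_dom])
      (auto simp: E intro: \<kappa>_lin \<kappa>_nondeg smooth_\<kappa> smooth_on_const)
  have eq: "g x u v = - (\<Sum>i\<in>UNIV. \<Sum>j\<in>UNIV. \<Omega> x [u, axis i 1, axis j 1] * \<Omega> x [v, E x i, E x j]) / 4" if x: "x \<in> U" for x
  proof -
    obtain e b where f: "su3_frame (\<kappa> x) (\<Omega> x) e b" and Jx: "su3_frame.Jf e b = J x" using frame_at[OF x] .
    show ?thesis unfolding g_def
      using su3_frame.metric_contraction[OF f E[OF x], of u v] by (simp add: Jx)
  qed
  have s: "smooth_on U (\<lambda>x. \<Omega> x [v, E x i, E x j])" for i j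
  proof -
    have h: "smooth_on U (\<lambda>x. \<Omega> x [v, w, E x j])" for w
      by (rule smooth_on_apply[where F="\<lambda>x z. \<Omega> x [v, w, z]", OF open_dom \<Omega>_lin(3) smooth_\<Omega> sE]) auto
    show ?thesis
      by (rule smooth_on_apply[where F="\<lambda>x z. \<Omega> x [v, z, E x j]", OF open_dom \<Omega>_lin(2) h sE])
  qed
  show ?thesis
  proof (subst smooth_on_cong[OF open_dom eq])
    show "smooth_on U (\<lambda>x. - (\<Sum>i\<in>UNIV. \<Sum>j\<in>UNIV. \<Omega> x [u, axis i 1, axis j 1] * \<Omega> x [v, E x i, E x j]) / 4)"
      by (intro smooth_on_divide smooth_on_minus smooth_on_sum smooth_on_mult s smooth_\<Omega> smooth_on_const open_dom) auto
  qed
qed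

lemma smooth_J: "smooth_on U (\<lambda>x. J x v)"
  by (rule smooth_on_solve[where \<beta>="\<lambda>x v w. \<kappa> x [v, w]" and l="\<lambda>x w. g x w v", OF open_dom])
    (auto simp: g_def[symmetric] intro: \<kappa>_lin \<kappa>_nondeg smooth_\<kappa> smooth_g)

sublocale metric_chart U g
  using g_sym' by (intro metric_chart.intro open_dom g_lin' g_pos' smooth_g)

lemma smooth_J_apply: "smooth_on U V \<Longrightarrow> smooth_on U (\<lambda>y. J y (V y))"
  by (rule smooth_on_apply[OF open_dom linear_J smooth_J])

abbreviation (input) \<Gamma> where "\<Gamma> \<equiv> levi_civita g"

definition A :: "real^6 \<Rightarrow> real^6 \<Rightarrow> real^6 \<Rightarrow> real^6" where "A = cov_deriv_endo (levi_civita g) J"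

lemma A_nab: "A x u v = nab (\<lambda>y. J y v) x u - J x (\<Gamma> x u v)"
  by (simp add: A_def cov_deriv_endo_def nab_def)

lemma smooth_A: "smooth_on U (\<lambda>y. A y u v)"
  unfolding A_nab
  by (intro smooth_on_diff open_dom smooth_nab smooth_J smooth_J_apply smooth_levi_civita)

lemma A_lin: assumes x: "x \<in> U" shows "linear (\<lambda>u. A x u v)" "linear (\<lambda>v. A x u v)"
proof -
  have dJ: "(\<lambda>y. J y v) differentiable (at x)" for v using smooth_on_differentiable[OF smooth_J x] .
  have 1: "linear (\<lambda>u. J x (\<Gamma> x u v))" "linear (\<lambda>v. J x (\<Gamma> x u v))" "linear (\<lambda>v. \<Gamma> x u (J x v))" for u v
    using linear_compose[OF lin_dir[OF x] linear_J[OF x]] linear_compose[OF lin_arg[OF x] linear_J[OF x]]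
      linear_compose[OF linear_J[OF x] lin_arg[OF x]] by (simp_all add: o_def)
  show "linear (\<lambda>u. A x u v)" unfolding A_def cov_deriv_endo_def
    by (intro linear_compose_sub linear_compose_add linear_dd[OF dJ] lin_dir[OF x] 1)
  show "linear (\<lambda>v. A x u v)" unfolding A_def cov_deriv_endo_def
    by (intro linear_compose_sub linear_compose_add linear_dd_param[OF open_dom x linear_J dJ] 1)
qed

lemma smooth_A_apply: "smooth_on U Z \<Longrightarrow> smooth_on U V \<Longrightarrow> smooth_on U (\<lambda>y. A y (Z y) (V y))"
  by (rule smooth_on_apply[where F="\<lambda>y z. A y z (V y)", OF open_dom A_lin(1)])
    (auto intro: smooth_on_apply[OF open_dom A_lin(2) smooth_A])

lemma nab_J: assumes x: "x \<in> U" and V: "smooth_on U V"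
  shows "nab (\<lambda>y. J y (V y)) x u = A x u (V x) + J x (nab V x u)"
proof -
  have "dd (\<lambda>y. J y (V y)) x u = dd (\<lambda>y. J y (V x)) x u + J x (dd V x u)"
    by (rule dd_apply(2)[OF open_dom x linear_J smooth_on_differentiable[OF smooth_J x] smooth_on_differentiable[OF V x]])
  then show ?thesis
    unfolding nab_def A_def cov_deriv_endo_def by (simp add: linear_add[OF linear_J[OF x]])
qed

text \<open>The second covariant derivative of \<open>J\<close>.\<close>

definition B :: "real^6 \<Rightarrow> real^6 \<Rightarrow> real^6 \<Rightarrow> real^6 \<Rightarrow> real^6" where
  "B x u v w = nab (\<lambda>y. A y v w) x u - A x (\<Gamma> x u v) w - A x v (\<Gamma> x u w)"

lemma nab_A: assumes x: "x \<in> U" and Z: "smooth_on U Z" and V: "smooth_on U V"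
  shows "nab (\<lambda>y. A y (Z y) (V y)) x u = B x u (Z x) (V x) + A x (nab Z x u) (V x) + A x (Z x) (nab V x u)"
proof -
  have "dd (\<lambda>y. A y (Z y) (V y)) x u = dd (\<lambda>y. A y (Z x) (V x)) x u + A x (dd Z x u) (V x) + A x (Z x) (dd V x u)"
    by (rule dd_apply2(2)[OF open_dom x A_lin smooth_on_differentiable[OF smooth_A x]
       smooth_on_differentiable[OF Z x] smooth_on_differentiable[OF V x]])
  then show ?thesis
    unfolding nab_def B_def by (simp add: linear_add[OF A_lin(1)[OF x]] linear_add[OF A_lin(2)[OF x]])
qed

lemma dd_zero: "x \<in> U \<Longrightarrow> (\<And>y. y \<in> U \<Longrightarrow> f y = 0) \<Longrightarrow> dd f x u = 0"
  using dd_cong_open[OF open_dom, of x f "\<lambda>_. 0" u] by simp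

lemma nab_zero: "x \<in> U \<Longrightarrow> (\<And>y. y \<in> U \<Longrightarrow> f y = 0) \<Longrightarrow> nab f x u = 0"
  using dd_zero[of x f u] by (simp add: nab_def linear_0[OF lin_arg])

lemmas smooth_rules = smooth_par smooth_J_apply smooth_A_apply smooth_on_const
lemmas smooth_diff = smooth_on_differentiable[OF _ , rotated 1]

lemma A_J: assumes x: "x \<in> U" shows "A x u (J x v) = - J x (A x u v)"
proof -
  have "nab (\<lambda>y. J y (J y (par x v y)) + par x v y) x u = 0"
    by (rule nab_zero[OF x]) (simp add: J_J)
  then have "A x u (J x v) + J x (A x u v) = 0"
    by (simp add: nab_add[OF x smooth_diff[OF x] smooth_diff[OF x]] nab_J[OF x] smooth_rules x linear_add[OF linear_J[OF x]] linear_0[OF linear_J[OF x]])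
  then show ?thesis by (simp add: eq_neg_iff_add_eq_0)
qed

lemma A_skew: assumes x: "x \<in> U" shows "g x (A x u v) w = - g x v (A x u w)"
proof -
  have "dd (\<lambda>y. g y (J y (par x v y)) (par x w y) + g y (par x v y) (J y (par x w y))) x u = 0"
    by (rule dd_zero[OF x]) (simp add: g_J)
  then have "g x (A x u v) w + g x v (A x u w) = 0"
    by (simp add: dd_add diff_h[OF x smooth_diff[OF x] smooth_diff[OF x]] dd_h[OF x smooth_diff[OF x] smooth_diff[OF x]] nab_J[OF x] smooth_rules x linear_0[OF linear_J[OF x]]
      linear_0[OF g_lin[OF x]] linear_0[OF g_lin1[OF x]])
  then show ?thesis by simp
qed

end

locale sgcy_chart = su3_chart +
  assumes closed_\<kappa>: "\<And>x vs. x \<in> U \<Longrightarrow> length vs = 3 \<Longrightarrow> ext_deriv \<kappa> x vs = 0"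
    and closed_\<Omega>: "\<And>x vs. x \<in> U \<Longrightarrow> length vs = 4 \<Longrightarrow> ext_deriv \<Omega> x vs = 0"
begin

lemma A_cyc: assumes x: "x \<in> U" shows "g x (A x u v) w + g x (A x v w) u + g x (A x w u) v = 0"
proof -
  have d: "dd (\<lambda>y. \<kappa> y [v, w]) x u = g x (A x u v) w + g x (J x (\<Gamma> x u v)) w + g x (J x v) (\<Gamma> x u w)" for u v w
  proof -
    have "dd (\<lambda>y. \<kappa> y [v, w]) x u = dd (\<lambda>y. g y (J y v) w) x u"
      by (rule dd_cong_open[OF open_dom x]) (rule \<kappa>_g)
    then show ?thesis
      by (simp add: dd_h[OF x smooth_diff[OF x] smooth_diff[OF x]] smooth_rules nab_J[OF x] nab_const smooth_J linear_add[OF g_lin1[OF x]])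
  qed
  have "dd (\<lambda>y. \<kappa> y [v, w]) x u - dd (\<lambda>y. \<kappa> y [u, w]) x v + dd (\<lambda>y. \<kappa> y [u, v]) x w = 0"
    using closed_\<kappa>[OF x, of "[u, v, w]"] by (simp add: ext_deriv_def eval_nat_numeral lessThan_Suc algebra_simps)
  then show ?thesis
    unfolding d levi_civita_sym[OF x, of v u] levi_civita_sym[OF x, of w u] levi_civita_sym[OF x, of w v]
    using g_J[OF x, of "\<Gamma> x u w" v] g_sym[OF x, of "\<Gamma> x u w" "J x v"]
      A_skew[OF x, of v u w] g_sym[OF x, of u "A x v w"] by linarith
qed

lemma torsion_algebra_at:
  assumes x: "x \<in> U" and f: "su3_frame (\<kappa> x) (\<Omega> x) e b" and Jx: "su3_frame.Jf e b = J x"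
  shows "torsion_algebra (\<kappa> x) (\<Omega> x) e b (A x)"
proof -
  show ?thesis
    by (intro torsion_algebra.intro torsion_algebra_axioms.intro f, unfold Jx g_def[symmetric])
      (rule A_lin[OF x] A_skew[OF x] A_J[OF x] A_cyc[OF x])+
qed

lemma A_Jdir: assumes x: "x \<in> U" shows "A x (J x u) v = A x u (J x v)"
proof -
  obtain e b where f: "su3_frame (\<kappa> x) (\<Omega> x) e b" and Jx: "su3_frame.Jf e b = J x" using frame_at[OF x] .
  show ?thesis using torsion_algebra.A_Jdir[OF torsion_algebra_at[OF x f Jx]] by (simp add: Jx)
qed

lemma B_J: assumes x: "x \<in> U" shows "J x (B x u v w) + B x u v (J x w) + A x u (A x v w) + A x v (A x u w) = 0"
proof -
  have "nab (\<lambda>y. J y (A y (par x v y) (par x w y)) + A y (par x v y) (J y (par x w y))) x u = 0"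
    by (rule nab_zero[OF x]) (simp add: A_J)
  then show ?thesis
    by (simp add: nab_add[OF x smooth_diff[OF x] smooth_diff[OF x]] nab_J[OF x] nab_A[OF x] smooth_rules x
      linear_0[OF linear_J[OF x]] linear_0[OF A_lin(1)[OF x]] linear_0[OF A_lin(2)[OF x]] algebra_simps)
qed

lemma B_skew: assumes x: "x \<in> U" shows "g x (B x u v w) z = - g x w (B x u v z)"
proof -
  have "dd (\<lambda>y. g y (A y (par x v y) (par x w y)) (par x z y) + g y (par x w y) (A y (par x v y) (par x z y))) x u = 0"
    by (rule dd_zero[OF x]) (simp add: A_skew)
  then show ?thesis
    by (simp add: dd_add diff_h[OF x smooth_diff[OF x] smooth_diff[OF x]] dd_h[OF x smooth_diff[OF x] smooth_diff[OF x]] nab_A[OF x] smooth_rules x 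
      linear_0[OF A_lin(1)[OF x]] linear_0[OF A_lin(2)[OF x]] linear_0[OF g_lin[OF x]] linear_0[OF g_lin1[OF x]])
qed

lemma B_cyc: assumes x: "x \<in> U" shows "g x (B x t u v) w + g x (B x t v w) u + g x (B x t w u) v = 0"
proof -
  have "dd (\<lambda>y. g y (A y (par x u y) (par x v y)) (par x w y) + g y (A y (par x v y) (par x w y)) (par x u y)
       + g y (A y (par x w y) (par x u y)) (par x v y)) x t = 0"
    by (rule dd_zero[OF x]) (simp add: A_cyc)
  then show ?thesis
    by (simp add: dd_add diff_h[OF x smooth_diff[OF x] smooth_diff[OF x]] dd_h[OF x smooth_diff[OF x] smooth_diff[OF x]] nab_A[OF x] smooth_rules x
      linear_0[OF A_lin(1)[OF x]] linear_0[OF A_lin(2)[OF x]] linear_0[OF g_lin[OF x]] linear_0[OF g_lin1[OF x]])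
qed

lemma B_Jdir: assumes x: "x \<in> U" shows "B x u (J x v) w + A x (A x u v) w = B x u v (J x w) + A x v (A x u w)"
proof -
  have "nab (\<lambda>y. A y (J y (par x v y)) (par x w y) - A y (par x v y) (J y (par x w y))) x u = 0"
    by (rule nab_zero[OF x]) (simp add: A_Jdir)
  then show ?thesis
    by (simp add: nab_diff[OF x smooth_diff[OF x] smooth_diff[OF x]] nab_J[OF x] nab_A[OF x] smooth_rules x
      linear_0[OF linear_J[OF x]] linear_0[OF A_lin(1)[OF x]] linear_0[OF A_lin(2)[OF x]])
qed

lemma B_lin: assumes x: "x \<in> U" shows "linear (\<lambda>v. B x u v w)"
proof -
  have 1: "linear (\<lambda>v. dd (\<lambda>y. A y v w) x u)" "linear (\<lambda>v. \<Gamma> x u (A x v w))" "linear (\<lambda>v. A x (\<Gamma> x u v) w)"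
    using linear_dd_param[OF open_dom x A_lin(1) smooth_diff[OF x smooth_A]]
      linear_compose[OF A_lin(1)[OF x] lin_arg[OF x]] linear_compose[OF lin_arg[OF x] A_lin(1)[OF x]]
    by (simp_all add: o_def)
  show ?thesis unfolding B_def nab_def
    by (intro linear_compose_sub linear_compose_add 1 A_lin[OF x])
qed

lemma nab_A_const: assumes x: "x \<in> U"
  shows "nab (\<lambda>y. A y v w) x u = B x u v w + A x (\<Gamma> x u v) w + A x v (\<Gamma> x u w)"
  by (simp add: B_def)

lemma B_comm: assumes x: "x \<in> U"
  shows "B x u v w - B x v u w = riemann \<Gamma> x u v (J x w) - J x (riemann \<Gamma> x u v w)"
proof -
  have e: "nab (\<lambda>y. nab (\<lambda>y. J y w) y v) x u
     = B x u v w + A x (\<Gamma> x u v) w + A x v (\<Gamma> x u w) + (A x u (\<Gamma> x v w) + J x (nab (\<lambda>y. \<Gamma> y v w) x u))" for u v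
  proof -
    have "nab (\<lambda>y. nab (\<lambda>y. J y w) y v) x u = nab (\<lambda>y. A y v w + J y (\<Gamma> y v w)) x u"
      by (rule nab_cong[OF x]) (simp add: A_nab)
    then show ?thesis
      by (simp add: nab_add[OF x smooth_diff[OF x] smooth_diff[OF x]] smooth_A smooth_levi_civita nab_A_const[OF x] nab_J[OF x] smooth_rules)
  qed
  show ?thesis
    using nab_commutator[OF x, of "\<lambda>y. J y w" v u, OF smooth_J] unfolding e riemann_nab
    by (simp add: levi_civita_sym[OF x, of v u] linear_diff[OF linear_J[OF x]] algebra_simps)
qed

text \<open>The Hermitian connection \<open>\<nabla> - \<onehalf> J\<nabla>J\<close>; the correction is skew and makes \<open>J\<close> parallel.\<close>

definition \<Gamma>h :: "real^6 \<Rightarrow> real^6 \<Rightarrow> real^6 \<Rightarrow> real^6" where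
  "\<Gamma>h y u v = \<Gamma> y u v - (1/2) *\<^sub>R J y (A y u v)"

lemma herm_connection: "connection U \<Gamma>h"
proof
  show "open U" by (rule open_dom)
  fix u v show "smooth_on U (\<lambda>y. \<Gamma>h y u v)" unfolding \<Gamma>h_def
    by (intro smooth_on_diff smooth_on_scaleR smooth_on_const smooth_levi_civita smooth_J_apply smooth_A open_dom)
qed (simp_all add: \<Gamma>h_def linear_add[OF lin_dir] linear_add[OF lin_arg] linear_cmul[OF lin_dir] linear_cmul[OF lin_arg]
   linear_add[OF A_lin(1)] linear_add[OF A_lin(2)] linear_cmul[OF A_lin(1)] linear_cmul[OF A_lin(2)]
   linear_add[OF linear_J] linear_cmul[OF linear_J] algebra_simps)

lemma herm_metric: assumes x: "x \<in> U"
  shows "dd (\<lambda>y. g y v w) x u = g x (\<Gamma>h x u v) w + g x v (\<Gamma>h x u w)"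
proof -
  have "g x (J x (A x u v)) w + g x v (J x (A x u w)) = 0"
    using A_skew[OF x, of u v "J x w"] by (simp add: g_J[OF x] A_J[OF x] linear_neg[OF g_lin[OF x]])
  then show ?thesis
    unfolding levi_civita_metric[OF x] \<Gamma>h_def
    by (simp add: linear_diff[OF g_lin[OF x]] linear_diff[OF g_lin1[OF x]] linear_cmul[OF g_lin[OF x]] linear_cmul[OF g_lin1[OF x]] field_simps)
qed

interpretation herm: parallel_bilinear U \<Gamma>h g
  by (intro parallel_bilinear.intro parallel_bilinear_axioms.intro herm_connection g_lin g_lin1 g_smooth herm_metric)

lemma herm_nab: "herm.nab V x u = nab V x u - (1/2) *\<^sub>R J x (A x u (V x))"
  by (simp add: herm.nab_def nab_def \<Gamma>h_def)

lemma herm_nab_J: assumes x: "x \<in> U" and V: "smooth_on U V"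
  shows "herm.nab (\<lambda>y. J y (V y)) x u = J x (herm.nab V x u)"
proof -
  have "A x u (V x) = (1/2) *\<^sub>R A x u (V x) + (1/2) *\<^sub>R A x u (V x)" by (simp flip: scaleR_left.add)
  then show ?thesis
    by (simp add: herm_nab nab_J[OF x V] A_J[OF x] J_J[OF x] linear_neg[OF linear_J[OF x]] linear_diff[OF linear_J[OF x]] linear_cmul[OF linear_J[OF x]] algebra_simps)
qed

lemma riemann_herm: assumes x: "x \<in> U"
  shows "riemann \<Gamma> x u v w = riemann \<Gamma>h x u v w + (1/4) *\<^sub>R (A x u (A x v w) - A x v (A x u w))
     + (1/2) *\<^sub>R J x (B x u v w - B x v u w)"
proof -
  have e: "herm.nab (\<lambda>y. \<Gamma>h y v w) x u = nab (\<lambda>y. \<Gamma> y v w) x u - (1/4) *\<^sub>R A x u (A x v w)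
      - (1/2) *\<^sub>R J x (B x u v w) - (1/2) *\<^sub>R J x (A x (\<Gamma> x u v) w)
      - (1/2) *\<^sub>R (J x (A x v (\<Gamma> x u w)) + J x (A x u (\<Gamma> x v w)))" for u v
  proof -
    have 1: "nab (\<lambda>y. \<Gamma>h y v w) x u = nab (\<lambda>y. \<Gamma> y v w) x u - (1/2) *\<^sub>R nab (\<lambda>y. J y (A y v w)) x u"
      unfolding \<Gamma>h_def
      by (simp add: nab_diff[OF x smooth_diff[OF x] smooth_diff[OF x]] nab_cmul[OF x smooth_diff[OF x]] smooth_levi_civita smooth_rules smooth_A smooth_on_scaleR open_dom smooth_on_const)
    have 2: "nab (\<lambda>y. J y (A y v w)) x u = A x u (A x v w) + J x (B x u v w + A x (\<Gamma> x u v) w + A x v (\<Gamma> x u w))"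
      by (simp add: nab_J[OF x smooth_A] nab_A_const[OF x])
    have 3: "J x (A x u (\<Gamma>h x v w)) = J x (A x u (\<Gamma> x v w)) - (1/2) *\<^sub>R A x u (A x v w)"
      by (simp add: \<Gamma>h_def linear_diff[OF A_lin(2)[OF x]] linear_cmul[OF A_lin(2)[OF x]] A_J[OF x] linear_diff[OF linear_J[OF x]]
         linear_add[OF linear_J[OF x]] linear_cmul[OF linear_J[OF x]] linear_neg[OF linear_J[OF x]] J_J[OF x])
    show ?thesis unfolding herm_nab 1 2 3
      by (simp add: linear_add[OF linear_J[OF x]] scaleR_add_right scaleR_diff_right algebra_simps flip: scaleR_left.add)
  qed
  show ?thesis
    unfolding herm.riemann_nab e riemann_nab
    by (simp add: levi_civita_sym[OF x, of v u] linear_diff[OF linear_J[OF x]] scaleR_diff_right algebra_simps)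
qed

text \<open>The covariant derivative of \<open>\<Omega>\<close> along the Hermitian connection.\<close>

definition herm_deriv_\<Omega> :: "real^6 \<Rightarrow> real^6 \<Rightarrow> real^6 \<Rightarrow> real^6 \<Rightarrow> real^6 \<Rightarrow> real" where
  "herm_deriv_\<Omega> x u a b c = dd (\<lambda>y. \<Omega> y [a, b, c]) x u - \<Omega> x [\<Gamma>h x u a, b, c] - \<Omega> x [a, \<Gamma>h x u b, c] - \<Omega> x [a, b, \<Gamma>h x u c]"

lemma dd_Omega:
  assumes x: "x \<in> U" and V: "smooth_on U V" "smooth_on U W" "smooth_on U Z"
  shows "dd (\<lambda>y. \<Omega> y [V y, W y, Z y]) x u = herm_deriv_\<Omega> x u (V x) (W x) (Z x) + \<Omega> x [herm.nab V x u, W x, Z x]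
     + \<Omega> x [V x, herm.nab W x u, Z x] + \<Omega> x [V x, W x, herm.nab Z x u]"
    and "(\<lambda>y. \<Omega> y [V y, W y, Z y]) differentiable (at x)"
proof -
  have d: "(\<lambda>y. \<Omega> y [a, b, c]) differentiable (at x)" for a b c
    by (rule smooth_on_differentiable[OF smooth_\<Omega> x]) simp
  note a = dd_apply3[where F="\<lambda>y a b c. \<Omega> y [a, b, c]", OF open_dom x \<Omega>_lin d smooth_diff[OF x V(1)] smooth_diff[OF x V(2)] smooth_diff[OF x V(3)]]
  show "dd (\<lambda>y. \<Omega> y [V y, W y, Z y]) x u = herm_deriv_\<Omega> x u (V x) (W x) (Z x) + \<Omega> x [herm.nab V x u, W x, Z x]
     + \<Omega> x [V x, herm.nab W x u, Z x] + \<Omega> x [V x, W x, herm.nab Z x u]"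
    by (rule trans[OF a(2)])
      (simp_all add: herm_deriv_\<Omega>_def herm.nab_def linear_add[OF \<Omega>_lin(1)[OF x]] linear_add[OF \<Omega>_lin(2)[OF x]] linear_add[OF \<Omega>_lin(3)[OF x]])
  show "(\<lambda>y. \<Omega> y [V y, W y, Z y]) differentiable (at x)" by (rule a(1))
qed

lemma herm_deriv_\<Omega>_lin: assumes x: "x \<in> U"
  shows "linear (\<lambda>u. herm_deriv_\<Omega> x u a b c)" "linear (\<lambda>a. herm_deriv_\<Omega> x u a b c)" "linear (\<lambda>b. herm_deriv_\<Omega> x u a b c)" "linear (\<lambda>c. herm_deriv_\<Omega> x u a b c)"
proof -
  have d: "(\<lambda>y. \<Omega> y [a, b, c]) differentiable (at x)" for a b c
    by (rule smooth_on_differentiable[OF smooth_\<Omega> x]) simp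
  note c1 = linear_compose[OF herm.lin_dir[OF x] \<Omega>_lin(1)[OF x]] linear_compose[OF herm.lin_dir[OF x] \<Omega>_lin(2)[OF x]] linear_compose[OF herm.lin_dir[OF x] \<Omega>_lin(3)[OF x]]
    linear_compose[OF herm.lin_arg[OF x] \<Omega>_lin(1)[OF x]] linear_compose[OF herm.lin_arg[OF x] \<Omega>_lin(2)[OF x]] linear_compose[OF herm.lin_arg[OF x] \<Omega>_lin(3)[OF x]]
  note c = c1[unfolded o_def]
  show "linear (\<lambda>u. herm_deriv_\<Omega> x u a b c)" unfolding herm_deriv_\<Omega>_def
    by (intro linear_compose_sub linear_dd[OF d] c)
  show "linear (\<lambda>a. herm_deriv_\<Omega> x u a b c)" unfolding herm_deriv_\<Omega>_def
    by (intro linear_compose_sub c \<Omega>_lin[OF x] linear_dd_param[where F="\<lambda>y a. \<Omega> y [a, b, c]", OF open_dom x \<Omega>_lin(1) d])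
  show "linear (\<lambda>b. herm_deriv_\<Omega> x u a b c)" unfolding herm_deriv_\<Omega>_def
    by (intro linear_compose_sub c \<Omega>_lin[OF x] linear_dd_param[where F="\<lambda>y b. \<Omega> y [a, b, c]", OF open_dom x \<Omega>_lin(2) d])
  show "linear (\<lambda>c. herm_deriv_\<Omega> x u a b c)" unfolding herm_deriv_\<Omega>_def
    by (intro linear_compose_sub c \<Omega>_lin[OF x] linear_dd_param[where F="\<lambda>y c. \<Omega> y [a, b, c]", OF open_dom x \<Omega>_lin(3) d])
qed

lemma herm_deriv_\<Omega>_skew: assumes x: "x \<in> U"
  shows "herm_deriv_\<Omega> x u a b c = - herm_deriv_\<Omega> x u b a c" "herm_deriv_\<Omega> x u a b c = - herm_deriv_\<Omega> x u a c b"
proof -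
  have d: "(\<lambda>y. \<Omega> y [a, b, c]) differentiable (at x)" for a b c
    by (rule smooth_on_differentiable[OF smooth_\<Omega> x]) simp
  have 1: "dd (\<lambda>y. \<Omega> y [a, b, c]) x u = - dd (\<lambda>y. \<Omega> y [b, a, c]) x u"
    unfolding dd_minus[OF d, symmetric] by (rule dd_cong_open[OF open_dom x]) (rule \<Omega>_skew(1))
  have 2: "dd (\<lambda>y. \<Omega> y [a, b, c]) x u = - dd (\<lambda>y. \<Omega> y [a, c, b]) x u"
    unfolding dd_minus[OF d, symmetric] by (rule dd_cong_open[OF open_dom x]) (rule \<Omega>_skew(2))
  show "herm_deriv_\<Omega> x u a b c = - herm_deriv_\<Omega> x u b a c"
    unfolding herm_deriv_\<Omega>_def 1 using \<Omega>_skew(1)[OF x, of "\<Gamma>h x u a" b c] \<Omega>_skew(1)[OF x, of a "\<Gamma>h x u b" c] \<Omega>_skew(1)[OF x, of a b "\<Gamma>h x u c"] by simp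
  show "herm_deriv_\<Omega> x u a b c = - herm_deriv_\<Omega> x u a c b"
    unfolding herm_deriv_\<Omega>_def 2 using \<Omega>_skew(2)[OF x, of "\<Gamma>h x u a" b c] \<Omega>_skew(2)[OF x, of a "\<Gamma>h x u b" c] \<Omega>_skew(2)[OF x, of a b "\<Gamma>h x u c"] by simp
qed

lemma herm_deriv_\<Omega>_J: assumes x: "x \<in> U" shows "herm_deriv_\<Omega> x u (J x a) b c = herm_deriv_\<Omega> x u a (J x b) c"
proof -
  have z: "\<Omega> x [0, p, q] = 0" "\<Omega> x [p, 0, q] = 0" "\<Omega> x [p, q, 0] = 0" for p q
    using linear_0[OF \<Omega>_lin(1)[OF x]] linear_0[OF \<Omega>_lin(2)[OF x]] linear_0[OF \<Omega>_lin(3)[OF x]] by auto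
  have "dd (\<lambda>y. \<Omega> y [J y (herm.par x a y), herm.par x b y, herm.par x c y] - \<Omega> y [herm.par x a y, J y (herm.par x b y), herm.par x c y]) x u = 0"
    by (rule dd_zero[OF x]) (simp add: \<Omega>_J)
  then show ?thesis
    by (simp add: dd_diff dd_Omega[OF x] herm_nab_J[OF x] smooth_J_apply herm.smooth_par x linear_0[OF linear_J[OF x]] z)
qed

text \<open>\<open>\<Omega>\<close> has constant norm and the connection is metric, so the derivative has no component along \<open>\<Omega>\<close>. In the
form of a first derivative test: on fields that are parallel at \<open>x\<close>, the function
\<open>\<Omega>(a, b, c)\<^sup>2 - |a|\<^sup>2 |b|\<^sup>2 |c|\<^sup>2\<close> is nowhere positive because \<open>\<Omega>\<close> is a calibration, and it vanishes at \<open>x\<close>.\<close>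

lemma herm_deriv_\<Omega>_calibrated: assumes x: "x \<in> U"
  and o: "g x a a = 1" "g x b b = 1" "g x c c = 1" "\<Omega> x [a, b, c] = 1"
  shows "herm_deriv_\<Omega> x u a b c = 0"
proof -
  have z: "\<Omega> x [0, p, q] = 0" "\<Omega> x [p, 0, q] = 0" "\<Omega> x [p, q, 0] = 0" for p q
    using linear_0[OF \<Omega>_lin(1)[OF x]] linear_0[OF \<Omega>_lin(2)[OF x]] linear_0[OF \<Omega>_lin(3)[OF x]] by auto
  have zg: "g x 0 p = 0" "g x p 0 = 0" for p using linear_0[OF g_lin[OF x]] linear_0[OF g_lin1[OF x]] by auto
  define w where "w = (\<lambda>y. \<Omega> y [herm.par x a y, herm.par x b y, herm.par x c y])"
  define n where "n v = (\<lambda>y. g y (herm.par x v y) (herm.par x v y))" for v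
  have dw: "w differentiable (at x)" "dd w x u = herm_deriv_\<Omega> x u a b c"
    unfolding w_def by (simp_all add: dd_Omega[OF x] herm.smooth_par x z)
  have dn: "n v differentiable (at x)" "dd (n v) x u = 0" for v
    unfolding n_def by (simp_all add: herm.diff_h[OF x] herm.dd_h[OF x] herm.diff_par x zg)
  let ?f = "\<lambda>y. w y * w y - n a y * n b y * n c y"
  have "dd ?f x = (\<lambda>u. 0)"
  proof (rule differential_zero_maxmin[OF x open_dom])
    show "(?f has_derivative dd ?f x) (at x)"
      by (intro has_dd differentiable_diff differentiable_mult dw dn)
    have "?f x = 0" by (simp add: w_def n_def x o)
    moreover have "?f y \<le> 0" if "y \<in> U" for y
      using \<Omega>_comass[OF that, of "herm.par x a y" "herm.par x b y" "herm.par x c y"] by (simp add: w_def n_def power2_eq_square)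
    ultimately show "(\<forall>y\<in>U. ?f y \<le> ?f x) \<or> (\<forall>y\<in>U. ?f x \<le> ?f y)" by simp
  qed
  then have "dd ?f x u = 0" by metis
  moreover have "dd ?f x u = 2 * herm_deriv_\<Omega> x u a b c"
    by (simp add: dd_diff dd_mult differentiable_mult dw dn) (simp add: w_def x o)
  ultimately show ?thesis by simp
qed

text \<open>The exterior derivative of \<open>\<Omega>\<close> written with the Hermitian connection. The Christoffel symbols of the
torsion-free connection cancel in pairs, and only the terms with \<open>\<onehalf> J A\<close> remain.\<close>

lemma herm_deriv_\<Omega>_closed: assumes x: "x \<in> U"
  shows "(herm_deriv_\<Omega> x u a b c - (\<Omega> x [J x (A x u a), b, c] - \<Omega> x [J x (A x u b), a, c] + \<Omega> x [J x (A x u c), a, b]) / 2)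
       - (herm_deriv_\<Omega> x a u b c - (\<Omega> x [J x (A x a u), b, c] - \<Omega> x [J x (A x a b), u, c] + \<Omega> x [J x (A x a c), u, b]) / 2)
       + (herm_deriv_\<Omega> x b u a c - (\<Omega> x [J x (A x b u), a, c] - \<Omega> x [J x (A x b a), u, c] + \<Omega> x [J x (A x b c), u, a]) / 2)
       - (herm_deriv_\<Omega> x c u a b - (\<Omega> x [J x (A x c u), a, b] - \<Omega> x [J x (A x c a), u, b] + \<Omega> x [J x (A x c b), u, a]) / 2) = 0"
proof -
  have "dd (\<lambda>y. \<Omega> y [a, b, c]) x u - dd (\<lambda>y. \<Omega> y [u, b, c]) x a + dd (\<lambda>y. \<Omega> y [u, a, c]) x b - dd (\<lambda>y. \<Omega> y [u, a, b]) x c = 0"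
    using closed_\<Omega>[OF x, of "[u, a, b, c]"] by (simp add: ext_deriv_def eval_nat_numeral lessThan_Suc algebra_simps)
  moreover have "dd (\<lambda>y. \<Omega> y [a, b, c]) x u = (herm_deriv_\<Omega> x u a b c - (\<Omega> x [J x (A x u a), b, c] - \<Omega> x [J x (A x u b), a, c] + \<Omega> x [J x (A x u c), a, b]) / 2)
      + (\<Omega> x [\<Gamma> x u a, b, c] - \<Omega> x [\<Gamma> x u b, a, c] + \<Omega> x [\<Gamma> x u c, a, b])" for u a b c
  proof -
    have r: "\<Omega> x [p, q, r] = - \<Omega> x [q, p, r]" "\<Omega> x [p, q, r] = \<Omega> x [r, p, q]" for p q r
      using \<Omega>_skew[OF x, of p q r] \<Omega>_skew(2)[OF x, of p q r] \<Omega>_skew(1)[OF x, of p r q] by simp_all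
    show ?thesis
      using r(1)[of a "\<Gamma>h x u b" c] r(2)[of a b "\<Gamma>h x u c"]
      by (simp add: herm_deriv_\<Omega>_def \<Gamma>h_def linear_diff[OF \<Omega>_lin(1)[OF x]] linear_cmul[OF \<Omega>_lin(1)[OF x]] field_simps)
  qed
  ultimately show ?thesis
    by (simp add: levi_civita_sym[OF x, of a u] levi_civita_sym[OF x, of b u] levi_civita_sym[OF x, of c u]
      levi_civita_sym[OF x, of b a] levi_civita_sym[OF x, of c a] levi_civita_sym[OF x, of c b])
qed

lemma closed_torsion_algebra_at:
  assumes x: "x \<in> U" and f: "su3_frame (\<kappa> x) (\<Omega> x) e b" and Jx: "su3_frame.Jf e b = J x"
  shows "closed_torsion_algebra (\<kappa> x) (\<Omega> x) e b (A x) (herm_deriv_\<Omega> x)"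
proof -
  interpret f: su3_frame "\<kappa> x" "\<Omega> x" e b by (rule f)
  have gb: "g x (b i) (b i) = 1" for i unfolding g_def Jx[symmetric] by (simp add: f.g_b f.e_b)
  have "\<Omega> x [b 1, b 3, b 5] = 1" by (simp add: f.Omega_bb f.e_b)
  then have cal: "herm_deriv_\<Omega> x u (b 1) (b 3) (b 5) = 0" for u using herm_deriv_\<Omega>_calibrated[OF x] gb by blast
  show ?thesis
    by (intro closed_torsion_algebra.intro closed_torsion_algebra_axioms.intro torsion_algebra_at[OF x f Jx], unfold Jx)
      (rule cal herm_deriv_\<Omega>_closed[OF x] herm_deriv_\<Omega>_lin[OF x] herm_deriv_\<Omega>_skew[OF x] herm_deriv_\<Omega>_J[OF x])+
qed

lemma herm_Omega: "parallel_trilinear U \<Gamma>h (\<lambda>x a b c. \<Omega> x [a, b, c])"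
proof (intro parallel_trilinear.intro parallel_trilinear_axioms.intro herm_connection \<Omega>_lin)
  show "smooth_on U (\<lambda>y. \<Omega> y [v, w, z])" for v w z by (rule smooth_\<Omega>) simp
  fix x u v w z assume x: "x \<in> U"
  obtain e b where f: "su3_frame (\<kappa> x) (\<Omega> x) e b" and Jx: "su3_frame.Jf e b = J x" using frame_at[OF x] .
  have "herm_deriv_\<Omega> x u v w z = 0"
    by (rule closed_torsion_algebra.\<Phi>_zero[OF closed_torsion_algebra_at[OF x f Jx]])
  then show "dd (\<lambda>y. \<Omega> y [v, w, z]) x u = \<Omega> x [\<Gamma>h x u v, w, z] + \<Omega> x [v, \<Gamma>h x u w, z] + \<Omega> x [v, w, \<Gamma>h x u z]"
    by (simp add: herm_deriv_\<Omega>_def)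
qed

lemma curvature_algebra_at:
  assumes x: "x \<in> U" and f: "su3_frame (\<kappa> x) (\<Omega> x) e b" and Jx: "su3_frame.Jf e b = J x"
  shows "curvature_algebra (\<kappa> x) (\<Omega> x) e b (A x) (B x) (riemann \<Gamma> x) (riemann \<Gamma>h x)"
proof -
  have eq0: "p + q = 0 \<Longrightarrow> p = - q" for p q :: real by simp
  have bi: "riemann \<Gamma> x u v w + riemann \<Gamma> x v w u + riemann \<Gamma> x w u v = 0" for u v w
    by (rule bianchi[OF x levi_civita_sym])
  show ?thesis
    by (intro curvature_algebra.intro curvature_algebra_axioms.intro torsion_algebra_at[OF x f Jx],
      unfold Jx g_def[symmetric])
     (rule B_lin[OF x] B_J[OF x] B_skew[OF x] B_cyc[OF x] B_Jdir[OF x] B_comm[OF x]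
       riemann_skew bi linear_riemann_dir[OF x] eq0[OF riemann_h[OF x]]
       riemann_herm[OF x] eq0[OF herm.riemann_h[OF x]] parallel_trilinear.riemann_h[OF herm_Omega x])+
qed

section \<open>Einstein metrics and parallel structures\<close>

lemma ricci_frame:
  assumes x: "x \<in> U" and f: "su3_frame (\<kappa> x) (\<Omega> x) e b" and Jx: "su3_frame.Jf e b = J x"
  shows "ricci g x v w = (\<Sum>i\<in>UNIV. g x (riemann \<Gamma> x (b i) v w) (b i))"
proof -
  interpret f: su3_frame "\<kappa> x" "\<Omega> x" e b by (rule f)
  have "g x v (b i) = e i v" for v i unfolding g_def Jx[symmetric] by (rule f.g_b)
  then show ?thesis unfolding ricci_def f.trace_matrix_frame[OF linear_riemann_dir[OF x]] by simp
qed

lemma einstein_imp_A_zero: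
  assumes x: "x \<in> U" and ein: "\<And>v w. traceless_ricci g x v w = 0"
  shows "A x u v = 0"
proof -
  obtain e b where f: "su3_frame (\<kappa> x) (\<Omega> x) e b" and Jx: "su3_frame.Jf e b = J x" using frame_at[OF x] .
  interpret C: curvature_algebra "\<kappa> x" "\<Omega> x" e b "A x" "B x" "riemann \<Gamma> x" "riemann \<Gamma>h x"
    by (rule curvature_algebra_at[OF x f Jx])
  interpret T: closed_torsion_algebra "\<kappa> x" "\<Omega> x" e b "A x" "herm_deriv_\<Omega> x"
    by (rule closed_torsion_algebra_at[OF x f Jx])
  note gx = g_def[of x, symmetric]
  define c where "c = metric_trace (g x) (ricci g x) / real CARD(6)"
  have R: "C.ric v w = c * g x v w" for v w
    using ein[of v w] ricci_frame[OF x f Jx, of v w] by (simp add: C.ric_def Jx gx traceless_ricci_def c_def)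
  have "g x (J x v) (J x v) = g x v v" for v using C.g_JJ[of v v] by (simp add: Jx gx)
  then have "(\<Sum>i\<in>UNIV. g x (A x v (b i)) (A x v (b i))) / 2 - (\<Sum>i\<in>UNIV. g x (A x (b i) v) (A x (b i) v)) = (2 * c) * g x v v" for v
    using C.ricci_J_invariant[of v] by (simp add: R Jx gx)
  then show ?thesis by (rule T.torsion_free_if_pinched[of "2 * c", unfolded Jx gx])
qed

lemma ricci_zero:
  assumes A0: "\<And>y u v. y \<in> U \<Longrightarrow> A y u v = 0" and x: "x \<in> U"
  shows "ricci g x v w = 0"
proof -
  obtain e b where f: "su3_frame (\<kappa> x) (\<Omega> x) e b" and Jx: "su3_frame.Jf e b = J x" using frame_at[OF x] .
  interpret C: curvature_algebra "\<kappa> x" "\<Omega> x" e b "A x" "B x" "riemann \<Gamma> x" "riemann \<Gamma>h x"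
    by (rule curvature_algebra_at[OF x f Jx])
  note gx = g_def[of x, symmetric]
  have B0: "B x u v w = 0" for u v w
    using nab_zero[OF x, of "\<lambda>y. A y v w" u] A0 by (simp add: B_def x)
  have "C.ric v w = 0"
    using A0[OF x] B0 riemann_pair_symmetry[OF x] by (intro C.ricci_flat) (simp_all only: Jx gx)
  then show ?thesis using ricci_frame[OF x f Jx, of v w] by (simp add: C.ric_def Jx gx)
qed

lemma A_zero_imp_parallel:
  assumes A0: "\<And>y u v. y \<in> U \<Longrightarrow> A y u v = 0" and x: "x \<in> U"
  shows "length vs = 2 \<Longrightarrow> cov_deriv \<Gamma> \<kappa> x u vs = 0"
    and "length ws = 3 \<Longrightarrow> cov_deriv \<Gamma>
      (\<lambda>x vs. complex_of_real (\<Omega> x vs) + \<i> * complex_of_real (\<Omega> x (map (J x) vs))) x u ws = 0"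
proof -
  interpret vol: parallel_trilinear U \<Gamma>h "\<lambda>x a b c. \<Omega> x [a, b, c]" by (rule herm_Omega)
  have \<Gamma>h: "\<Gamma>h y u v = \<Gamma> y u v" if "y \<in> U" for y u v
    using A0[OF that] by (simp add: \<Gamma>h_def linear_0[OF linear_J[OF that]])
  have herm_nab_eq: "herm.nab V x u = nab V x u" for V u by (simp add: herm.nab_def nab_def \<Gamma>h[OF x])
  have nJ: "nab (\<lambda>y. J y v) x u = J x (\<Gamma> x u v)" for u v using A0[OF x] by (simp add: A_nab)
  show "cov_deriv \<Gamma> \<kappa> x u vs = 0" if "length vs = 2"
  proof -
    obtain v w where vs: "vs = [v, w]" using \<open>length vs = 2\<close> by (auto simp: numeral_2_eq_2 length_Suc_conv)
    have "dd (\<lambda>y. \<kappa> y [v, w]) x u = dd (\<lambda>y. g y (J y v) w) x u"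
      by (rule dd_cong_open[OF open_dom x]) (rule \<kappa>_g)
    also have "\<dots> = \<kappa> x [\<Gamma> x u v, w] + \<kappa> x [v, \<Gamma> x u w]"
      by (simp add: dd_h[OF x smooth_diff[OF x] smooth_diff[OF x]] smooth_rules nJ nab_const smooth_J \<kappa>_g[OF x])
    finally show ?thesis by (simp add: vs cov_deriv_def eval_nat_numeral lessThan_Suc)
  qed
  show "cov_deriv \<Gamma> (\<lambda>x vs. complex_of_real (\<Omega> x vs) + \<i> * complex_of_real (\<Omega> x (map (J x) vs))) x u ws = 0"
    if "length ws = 3"
  proof -
    obtain a b c where ws: "ws = [a, b, c]" using \<open>length ws = 3\<close> by (auto simp: numeral_3_eq_3 length_Suc_conv)
    have s: "smooth_on U (\<lambda>y. J y v)" for v by (rule smooth_J)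
    have d1: "(\<lambda>y. \<Omega> y [a, b, c]) differentiable (at x)"
      "(\<lambda>y. \<Omega> y [J y a, J y b, J y c]) differentiable (at x)"
      by (auto intro!: dd_Omega(2)[OF x] smooth_J smooth_on_const)
    have "((\<lambda>y. complex_of_real (\<Omega> y [a, b, c]) + \<i> * complex_of_real (\<Omega> y [J y a, J y b, J y c])) has_derivative
       (\<lambda>u. complex_of_real (dd (\<lambda>y. \<Omega> y [a, b, c]) x u) + \<i> * complex_of_real (dd (\<lambda>y. \<Omega> y [J y a, J y b, J y c]) x u))) (at x)"
      by (intro derivative_intros has_dd d1)
    from dd_eqI[OF this, of u]
    have d: "dd (\<lambda>y. complex_of_real (\<Omega> y [a, b, c]) + \<i> * complex_of_real (\<Omega> y [J y a, J y b, J y c])) x u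
      = complex_of_real (\<Omega> x [\<Gamma> x u a, b, c] + \<Omega> x [a, \<Gamma> x u b, c] + \<Omega> x [a, b, \<Gamma> x u c])
       + \<i> * complex_of_real (\<Omega> x [J x (\<Gamma> x u a), J x b, J x c] + \<Omega> x [J x a, J x (\<Gamma> x u b), J x c] + \<Omega> x [J x a, J x b, J x (\<Gamma> x u c)])"
      by (simp add: vol.h_parallel[OF x] \<Gamma>h[OF x] vol.dd_h[OF x smooth_diff[OF x s] smooth_diff[OF x s] smooth_diff[OF x s]] herm_nab_eq nJ)
    show ?thesis
      by (simp add: ws cov_deriv_def eval_nat_numeral lessThan_Suc d algebra_simps)
  qed
qed

end

text \<open>Each chart of the atlas carries the situation studied above, with the same \<open>g\<close>, \<open>J\<close> and \<open>\<nabla>J\<close>.\<close>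

theorem corollary4p1:
  fixes X :: "'a topology" and A :: "('a, 6) chart set"
    and \<kappa> \<Omega> :: "('a, 6, (6, real) tensor) field"
  assumes "smooth_manifold X A"
    and "special_generalized_calabi_yau A \<kappa> \<Omega>"
  shows "einstein A (induced_metric \<kappa> \<Omega>) \<longleftrightarrow> calabi_yau A \<kappa> \<Omega>"
proof -
  have su3: "su3_structure A \<kappa> \<Omega>" and cl: "closed_form A 2 \<kappa>" "closed_form A 3 \<Omega>"
    using assms(2) by (auto simp: special_generalized_calabi_yau_def)
  have chart: "sgcy_chart (chart_image c) (\<kappa> c) (\<Omega> c)" if "c \<in> A" for c
  proof (intro sgcy_chart.intro su3_chart.intro sgcy_chart_axioms.intro)
    show "open (chart_image c)"
      using assms(1) that by (auto simp: smooth_manifold_def is_chart_def)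
    show "smooth_on (chart_image c) (\<lambda>x. \<kappa> c x vs)" if "length vs = 2" for vs
      using su3 \<open>c \<in> A\<close> that by (auto simp: su3_structure_def differential_form_def)
    show "smooth_on (chart_image c) (\<lambda>x. \<Omega> c x vs)" if "length vs = 3" for vs
      using su3 \<open>c \<in> A\<close> that by (auto simp: su3_structure_def differential_form_def)
    show "\<exists>e. adapted_coframe (\<kappa> c x) (\<Omega> c x) e" if "x \<in> chart_image c" for x
      using su3 \<open>c \<in> A\<close> that by (auto simp: su3_structure_def)
    show "ext_deriv (\<kappa> c) x vs = 0" if "x \<in> chart_image c" "length vs = 3" for x vs
      using cl(1) \<open>c \<in> A\<close> that by (auto simp: closed_form_def)
    show "ext_deriv (\<Omega> c) x vs = 0" if "x \<in> chart_image c" "length vs = 4" for x vs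
      using cl(2) \<open>c \<in> A\<close> that by (auto simp: closed_form_def)
  qed
  have J: "J_field \<kappa> \<Omega> c = su3_chart.J (\<kappa> c) (\<Omega> c)" if "c \<in> A" for c
    using sgcy_chart.axioms(1)[OF chart[OF that]] by (simp add: fun_eq_iff J_field_def su3_chart.J_def)
  have g: "induced_metric \<kappa> \<Omega> c = su3_chart.g (\<kappa> c) (\<Omega> c)" if "c \<in> A" for c
    using sgcy_chart.axioms(1)[OF chart[OF that]] by (simp add: fun_eq_iff induced_metric_def su3_chart.g_def J[OF that])
  have A: "cov_deriv_endo (levi_civita (induced_metric \<kappa> \<Omega> c)) (J_field \<kappa> \<Omega> c) = su3_chart.A (\<kappa> c) (\<Omega> c)" if "c \<in> A" for c
    using sgcy_chart.axioms(1)[OF chart[OF that]] by (simp add: su3_chart.A_def J[OF that] g[OF that])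
  show ?thesis
  proof
    assume ein: "einstein A (induced_metric \<kappa> \<Omega>)"
    show "calabi_yau A \<kappa> \<Omega>"
      unfolding calabi_yau_def Let_def
    proof (intro conjI su3 ballI)
      fix c x assume c: "c \<in> A" and x: "x \<in> chart_image c"
      interpret C: sgcy_chart "chart_image c" "\<kappa> c" "\<Omega> c" by (rule chart[OF c])
      have A0: "C.A y u v = 0" if "y \<in> chart_image c" for y u v
      proof (rule C.einstein_imp_A_zero[OF that])
        show "traceless_ricci C.g y v w = 0" for v w
          using ein c that unfolding einstein_def g[OF c, symmetric] by blast
      qed
      have vol: "complex_volume \<kappa> \<Omega> c = (\<lambda>x vs. complex_of_real (\<Omega> c x vs) + \<i> * complex_of_real (\<Omega> c x (map (C.J x) vs)))"
        by (simp add: fun_eq_iff complex_volume_def J[OF c])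
      show "\<forall>u vs. length vs = 2 \<longrightarrow> cov_deriv (levi_civita (induced_metric \<kappa> \<Omega> c)) (\<kappa> c) x u vs = 0"
        unfolding g[OF c] using C.A_zero_imp_parallel(1)[OF A0 x] by blast
      show "\<forall>u v. cov_deriv_endo (levi_civita (induced_metric \<kappa> \<Omega> c)) (J_field \<kappa> \<Omega> c) x u v = 0"
        unfolding A[OF c] using A0[OF x] by blast
      show "\<forall>u vs. length vs = 3 \<longrightarrow> cov_deriv (levi_civita (induced_metric \<kappa> \<Omega> c)) (complex_volume \<kappa> \<Omega> c) x u vs = 0"
        unfolding g[OF c] vol using C.A_zero_imp_parallel(2)[OF A0 x] by blast
    qed
  next
    assume cy: "calabi_yau A \<kappa> \<Omega>"
    show "einstein A (induced_metric \<kappa> \<Omega>)"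
      unfolding einstein_def
    proof (intro ballI allI)
      fix c x v w assume c: "c \<in> A" and x: "x \<in> chart_image c"
      interpret C: sgcy_chart "chart_image c" "\<kappa> c" "\<Omega> c" by (rule chart[OF c])
      have A0: "C.A y u v = 0" if "y \<in> chart_image c" for y u v
        using cy c that unfolding calabi_yau_def Let_def A[OF c, symmetric] by blast
      have ric: "ricci C.g x v w = 0" for v w by (rule C.ricci_zero[OF A0 x])
      then have "gram (ricci C.g x) = 0" by (simp add: gram_def vec_eq_iff)
      then have "metric_trace (C.g x) (ricci C.g x) = 0" by (simp add: metric_trace_def matrix_matrix_mult_def trace_def)
      then show "traceless_ricci (induced_metric \<kappa> \<Omega> c) x v w = 0"
        unfolding g[OF c] by (simp add: traceless_ricci_def ric)
    qed
  qed
qed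

end
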